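(* Let the field of scalars be $\mathbb{F}=\mathbb{R}$. Let $H\le \mathrm{GL}_d(\mathbb{R})$ be an irreducibly admissible matrix group with associated open dual orbit $\mathcal{O}\subset\mathbb{R}^d$, and let $\Psi=(\psi_h)_{h\in H}$ be the system of dilates $\psi_h=|\det(h)|^{-1}\psi(h^{-1}\,\cdot)$ of a real-valued $0\ne\psi\in L^2(\mathbb{R}^d)$ such that $\widehat\psi$ is compactly supported inside $\mathcal{O}$ and $$\int_H|\widehat\psi(h^T\xi)|^2\,d\mu_H(h)=1\quad\text{for a.e. }\xi\in\mathbb{R}^d,$$ where $\mu_H$ is the left Haar measure on $H$. Let $0\ne f\in L^2(\mathbb{R}^d)$ be real-valued. If the boundaries of $F:=\mathrm{int}(\mathrm{supp}(\widehat f))$ and $V:=\mathrm{int}(\mathrm{supp}(\widehat\psi))$ are (Lebesgue) null sets, and if $F\cap\mathcal{O}$ is connected, then $f$ is uniquely sign retrievable: whenever $g\in L^2(\mathbb{R}^d)$ is real-valued and $|g*\psi_h^*|=|f*\psi_h^*|$ for all $h\in H$, then $g=f$ or $g=-f$.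
   Context: A closed matrix group $H\le\mathrm{GL}_d(\mathbb{R})$ is called irreducibly admissible if there exists a unique open set $\mathcal{O}\subset\mathbb{R}^d$ (which necessarily is of full measure) such that $\mathcal{O}=H^T\xi_{\mathcal{O}}=\{h^T\xi_{\mathcal O}:h\in H\}$ for a suitable $\xi_{\mathcal{O}}\in\mathbb{R}^d$, and in addition the dual stabilizer $H_{\xi_{\mathcal{O}}}=\{h\in H:h^T\xi_{\mathcal{O}}=\xi_{\mathcal{O}}\}$ is compact. The set $\mathcal{O}$ is called the open dual orbit of $H$. Notation: $g^*(x)=\overline{g(-x)}$, $*$ is convolution, $\widehat{\cdot}$ is the Fourier transform on $L^2(\mathbb{R}^d)$, so that $\widehat{\psi_h}(\xi)=\widehat\psi(h^T\xi)$. For $g\in L^p(\mathbb{R}^d)$, $\mathrm{supp}(g)$ is the essential support, i.e. the complement of the union of all open sets on which $g=0$ almost everywhere; $\mathrm{int}$ denotes topological interior.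
   Formalization: The added hypothesis that supp(f^) lies in the closure of F is needed: otherwise f^ may have a piece of positive measure with empty interior (a fat Cantor set of radii) that F does not see, and its sign can be flipped independently, so the literal claim fails. *)

theory Defs
  imports "HOL-Analysis.Analysis" "HOL-Algebra.Group"
begin

section \<open>Matrix groups and their dual action\<close>

definition GL :: "(real^'n^'n) monoid" where
  "GL = \<lparr>carrier = {A. invertible A}, mult = (**), one = mat 1\<rparr>"

text \<open>Closed means closed in the relative topology of the general linear group; such a
  group need not be a closed set of matrices.\<close>

definition closed_matrix_group :: "(real^'n^'n) set \<Rightarrow> bool" where
  "closed_matrix_group H \<longleftrightarrow>
     subgroup H GL \<and> closedin (top_of_set {A. invertible A}) H"

definition dual_orbit :: "(real^'n^'n) set \<Rightarrow> real^'n \<Rightarrow> (real^'n) set" where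
  "dual_orbit H \<xi> = {transpose h *v \<xi> | h. h \<in> H}"

definition dual_stabilizer :: "(real^'n^'n) set \<Rightarrow> real^'n \<Rightarrow> (real^'n^'n) set" where
  "dual_stabilizer H \<xi> = {h \<in> H. transpose h *v \<xi> = \<xi>}"

definition is_open_dual_orbit :: "(real^'n^'n) set \<Rightarrow> (real^'n) set \<Rightarrow> bool" where
  "is_open_dual_orbit H U \<longleftrightarrow> open U \<and> (\<exists>\<xi>. U = dual_orbit H \<xi>)"

definition open_dual_orbit :: "(real^'n^'n) set \<Rightarrow> (real^'n) set" where
  "open_dual_orbit H = (THE U. is_open_dual_orbit H U)"

text \<open>The stabilizers of two points of one orbit are conjugate in \<open>H\<close>, so it does not matter
  at which point of the open orbit compactness is required. That the orbit has full measure is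
  a consequence and not part of the definition.\<close>

definition irreducibly_admissible :: "(real^'n^'n) set \<Rightarrow> bool" where
  "irreducibly_admissible H \<longleftrightarrow>
     closed_matrix_group H \<and>
     (\<exists>!U. is_open_dual_orbit H U) \<and>
     (\<exists>\<xi>. open_dual_orbit H = dual_orbit H \<xi> \<and> compact (dual_stabilizer H \<xi>))"

text \<open>\<open>H\<close> is locally compact and second countable, so a Borel measure that is finite on compact
  sets is automatically regular. Haar measure is determined up to a positive factor only.\<close>

definition left_Haar_measure :: "(real^'n^'n) set \<Rightarrow> (real^'n^'n) measure \<Rightarrow> bool" where
  "left_Haar_measure H \<mu> \<longleftrightarrow>
     sets \<mu> = sets (restrict_space borel H) \<and>
     emeasure \<mu> H \<noteq> 0 \<and>
     (\<forall>K\<subseteq>H. compact K \<longrightarrow> emeasure \<mu> K < \<infinity>) \<and>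
     (\<forall>g\<in>H. \<forall>A\<in>sets \<mu>. emeasure \<mu> ((\<lambda>h. g ** h) ` A) = emeasure \<mu> A)"


section \<open>Square-integrable functions and the Fourier transform\<close>

text \<open>Elements of \<open>L\<^sup>2\<close> are represented by Borel functions; equality in \<open>L\<^sup>2\<close> is equality almost
  everywhere.\<close>

definition square_integrable :: "(real^'n \<Rightarrow> 'b::euclidean_space) \<Rightarrow> bool" where
  "square_integrable f \<longleftrightarrow>
     f \<in> borel_measurable lborel \<and> integrable lborel (\<lambda>x. (norm (f x))\<^sup>2)"

definition fourier_L1 :: "(real^'n \<Rightarrow> complex) \<Rightarrow> real^'n \<Rightarrow> complex" where
  "fourier_L1 f \<xi> = (LINT x|lborel. f x * cis (- 2 * pi * (x \<bullet> \<xi>)))"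

text \<open>The Plancherel extension to \<open>L\<^sup>2\<close>: the truncations of \<open>f\<close> to balls are in \<open>L\<^sup>1 \<inter> L\<^sup>2\<close> and
  converge to \<open>f\<close> in \<open>L\<^sup>2\<close>, so the transform of \<open>f\<close> is the \<open>L\<^sup>2\<close>-limit of their transforms. The
  nonnegative integral is used so that a function that is not square-integrable does not count
  as having distance 0.\<close>

definition is_fourier_L2 :: "(real^'n \<Rightarrow> complex) \<Rightarrow> (real^'n \<Rightarrow> complex) \<Rightarrow> bool" where
  "is_fourier_L2 f F \<longleftrightarrow>
     square_integrable F \<and>
     (\<lambda>n. \<integral>\<^sup>+\<xi>. ennreal
        ((cmod (F \<xi> - fourier_L1 (\<lambda>x. indicator (ball 0 (real n)) x * f x) \<xi>))\<^sup>2) \<partial>lborel)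
     \<longlonglongrightarrow> 0"

text \<open>A representative of the transform of a real-valued function, determined up to a null set.\<close>

definition fourier_L2 :: "(real^'n \<Rightarrow> real) \<Rightarrow> real^'n \<Rightarrow> complex" where
  "fourier_L2 f = (SOME F. is_fourier_L2 (\<lambda>x. complex_of_real (f x)) F)"

text \<open>An essential support can have positive measure and empty interior (a fat Cantor set), so
  it may exceed the closure of its interior by a set of positive measure.\<close>

definition ess_support :: "(real^'n \<Rightarrow> 'b::real_normed_vector) \<Rightarrow> (real^'n) set" where
  "ess_support g = - \<Union>{U. open U \<and> (AE x in lborel. x \<in> U \<longrightarrow> g x = 0)}"


section \<open>Dilates, convolution and sign retrieval\<close>

definition dilate :: "real^'n^'n \<Rightarrow> (real^'n \<Rightarrow> real) \<Rightarrow> real^'n \<Rightarrow> real" where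
  "dilate h \<psi> x = inverse \<bar>det h\<bar> * \<psi> (matrix_inv h *v x)"

text \<open>The involution \<open>g\<^sup>*(x) = cnj (g (- x))\<close>; for real scalars the conjugation is trivial.\<close>

definition involution :: "(real^'n \<Rightarrow> real) \<Rightarrow> real^'n \<Rightarrow> real" where
  "involution g x = g (- x)"

text \<open>For \<open>f\<close> and \<open>g\<close> in \<open>L\<^sup>2\<close> the integral exists for every \<open>x\<close> and is continuous in \<open>x\<close>.\<close>

definition convolution :: "(real^'n \<Rightarrow> real) \<Rightarrow> (real^'n \<Rightarrow> real) \<Rightarrow> real^'n \<Rightarrow> real" where
  "convolution f g x = (LINT y|lborel. f y * g (x - y))"

definition uniquely_sign_retrievable ::
    "(real^'n^'n) set \<Rightarrow> (real^'n \<Rightarrow> real) \<Rightarrow> (real^'n \<Rightarrow> real) \<Rightarrow> bool" where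
  "uniquely_sign_retrievable H \<psi> f \<longleftrightarrow>
     (\<forall>g. square_integrable g \<longrightarrow>
        (\<forall>h\<in>H. \<forall>x. \<bar>convolution g (involution (dilate h \<psi>)) x\<bar>
                  = \<bar>convolution f (involution (dilate h \<psi>)) x\<bar>) \<longrightarrow>
        (AE x in lborel. g x = f x) \<or> (AE x in lborel. g x = - f x))"

end

theory Submission
  imports Defs "HOL-Probability.Characteristic_Functions" "HOL-Complex_Analysis.Cauchy_Integral_Formula"
begin

text \<open>
  Write \<open>f^\<close>, \<open>g^\<close>, \<open>\<psi>^\<close> for the Fourier transforms. The function \<open>f * \<psi>\<^sub>h\<^sup>*\<close> is the inverse transform
  of the compactly supported integrable function \<open>\<xi> \<mapsto> f^ \<xi> * cnj (\<psi>^ (transpose h *v \<xi>))\<close>, hence entire on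
  every line. So if \<open>\<bar>g * \<psi>\<^sub>h\<^sup>*\<bar> = \<bar>f * \<psi>\<^sub>h\<^sup>*\<bar>\<close>, then \<open>g * \<psi>\<^sub>h\<^sup>* = \<plusminus> f * \<psi>\<^sub>h\<^sup>*\<close> with a single sign for each \<open>h\<close>, that is,
  \<open>g^ = \<plusminus> f^\<close> almost everywhere on \<open>{\<xi>. \<psi>^ (transpose h *v \<xi>) \<noteq> 0}\<close>. By a Steinhaus argument for the Haar
  measure of \<open>H\<close>, the set of \<open>h\<close> for which that set contains both of two given nearby points of the orbit has
  positive measure, so the sign is locally constant on the open orbit. As \<open>f^\<close> does not vanish almost
  everywhere on any nonempty open subset of \<open>F\<close>, connectedness makes the sign constant on \<open>F\<close> intersected
  with the orbit. Up to null sets this contains \<open>{\<xi>. f^ \<xi> \<noteq> 0}\<close>, the orbit being conull by the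
  admissibility condition.
\<close>

section \<open>Matrix groups, Haar measure and orbit maps\<close>

text \<open>The set \<open>W\<close> where \<open>\<psi>^\<close> is nonzero is merely measurable
  and may have empty interior, so the windows of nearby group elements cannot be glued by topology.
  What survives is a statement about measure: almost every frequency is brought into
  \<open>W\<close> by a set of \<open>h\<close> of positive Haar measure. Two facts make it local.
  Replacing \<open>\<eta>\<close> by \<open>transpose m *v \<eta>\<close> replaces \<open>h\<close>
  by \<open>m ** h\<close>, a left translation, which Haar measure does not see; and every point
  near \<open>\<eta>\<close> has this form with \<open>m\<close> near the identity, because the
  orbit is open. The sign is never introduced as a function, since \<open>f^\<close> may vanish on a
  set of positive measure inside \<open>F\<close>. Local constancy says instead that near each orbit
  point one of the two sets given by \<open>g^ = f^\<close>, \<open>f^ \<noteq> 0\<close> and by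
  \<open>g^ = - f^\<close>, \<open>f^ \<noteq> 0\<close> is null, a form that passes through Fubini;
  the same argument with both sets equal to the exceptional set gives
  \<open>g^ = \<plusminus> f^\<close> almost everywhere. Real scalars enter where equal moduli
  become the vanishing product \<open>(p - q) * (p + q)\<close>.\<close>

lemma bounded_bilinear_matrix_mult:
  "bounded_bilinear ((**) :: real^'n^'m \<Rightarrow> real^'k^'n \<Rightarrow> real^'k^'m)"
  unfolding bilinear_conv_bounded_bilinear[symmetric] bilinear_def
  by (auto intro!: linearI simp: matrix_matrix_mult_def vec_eq_iff sum.distrib
      algebra_simps sum_distrib_left)

lemma bounded_bilinear_matrix_vector_mult:
  "bounded_bilinear ((*v) :: real^'n^'m \<Rightarrow> real^'n \<Rightarrow> real^'m)"
  unfolding bilinear_conv_bounded_bilinear[symmetric] bilinear_def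
  by (auto intro!: linearI simp: matrix_vector_mult_def vec_eq_iff sum.distrib
      algebra_simps sum_distrib_left)

lemmas continuous_on_matrix_mult [continuous_intros] =
  bounded_bilinear.continuous_on[OF bounded_bilinear_matrix_mult]

lemmas continuous_on_matrix_vector_mult [continuous_intros] =
  bounded_bilinear.continuous_on[OF bounded_bilinear_matrix_vector_mult]

lemma continuous_on_transpose [continuous_intros]:
  fixes f :: "'a::topological_space \<Rightarrow> real^'n^'m"
  assumes "continuous_on S f"
  shows "continuous_on S (\<lambda>x. transpose (f x))"
  unfolding transpose_def by (intro continuous_intros assms)

lemma continuous_on_det [continuous_intros]:
  fixes f :: "'a::topological_space \<Rightarrow> real^'n^'n"
  assumes "continuous_on S f"
  shows "continuous_on S (\<lambda>x. det (f x))"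
  unfolding det_def by (intro continuous_intros assms)

lemma group_GL: "group (GL :: (real^'n^'n) monoid)"
proof (rule groupI, goal_cases)
  case (1 x y) then show ?case by (simp add: GL_def invertible_mult)
next
  case 2 show ?case by (auto simp: GL_def invertible_def)
next
  case (3 x y z) then show ?case by (simp add: GL_def matrix_mul_assoc)
next
  case (4 x) then show ?case by (simp add: GL_def)
next
  case (5 x) then show ?case by (auto simp add: GL_def invertible_def)
qed

lemma matrix_inv_cancel:
  assumes "invertible (a :: real^'n^'n)"
  shows "matrix_inv a ** a = mat 1" "a ** matrix_inv a = mat 1"
proof -
  obtain b where "a ** b = mat 1 \<and> b ** a = mat 1" using assms by (auto simp: invertible_def)
  then have "a ** matrix_inv a = mat 1 \<and> matrix_inv a ** a = mat 1"
    unfolding matrix_inv_def by (rule someI)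
  then show "matrix_inv a ** a = mat 1" "a ** matrix_inv a = mat 1" by auto
qed

text \<open>The dual action is a right action: the element applied last stands on the right of the
  product. A change of the base point within its orbit is therefore a left multiplication in the
  group, which matches left Haar measure.\<close>

lemma transpose_mult_vec:
  fixes \<xi> :: "real^'n"
  shows "transpose h *v (transpose k *v \<xi>) = transpose (k ** h) *v \<xi>"
  by (metis matrix_vector_mul_assoc matrix_transpose_mul)

section \<open>Closed matrix groups and their dual orbits\<close>

context
  fixes H :: "(real^'n^'n) set"
  assumes H: "closed_matrix_group H"
begin

lemma subgroup_GL: "subgroup H GL"
  using H by (simp add: closed_matrix_group_def)

lemma matrix_group_one: "mat 1 \<in> H"
  using subgroup.one_closed[OF subgroup_GL] by (simp add: GL_def)

lemma matrix_group_mult: "a \<in> H \<Longrightarrow> b \<in> H \<Longrightarrow> a ** b \<in> H"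
  using subgroup.m_closed[OF subgroup_GL] by (simp add: GL_def)

lemma matrix_group_invertible: "a \<in> H \<Longrightarrow> invertible a"
  using subgroup.subset[OF subgroup_GL] by (auto simp add: GL_def)

lemma matrix_group_matrix_inv: "a \<in> H \<Longrightarrow> matrix_inv a \<in> H"
proof -
  assume a: "a \<in> H"
  interpret group "GL :: (real^'n^'n) monoid" by (rule group_GL)
  have "a \<in> carrier GL" using a subgroup.subset[OF subgroup_GL] by auto
  from r_inv[OF this] have "a ** inv\<^bsub>GL\<^esub> a = mat 1" by (simp add: GL_def)
  \<comment> \<open>The inverse in \<open>GL\<close> is known only through the group axioms;
    uniqueness of inverses identifies it with \<open>matrix_inv\<close>.\<close>
  then have "matrix_inv a = inv\<^bsub>GL\<^esub> a"
    using matrix_inv_cancel[OF matrix_group_invertible[OF a]]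
    by (metis matrix_mul_assoc matrix_mul_lid matrix_mul_rid)
  then show ?thesis using subgroup.m_inv_closed[OF subgroup_GL a] by simp
qed

lemma matrix_group_det: "a \<in> H \<Longrightarrow> det a \<noteq> 0"
  using matrix_group_invertible by (simp add: invertible_det_nz)

lemma matrix_group_inv_mult: "a \<in> H \<Longrightarrow> matrix_inv a ** a = mat 1" "a \<in> H \<Longrightarrow> a ** matrix_inv a = mat 1"
  by (simp_all add: matrix_group_invertible matrix_inv_cancel)

lemma matrix_group_eq_Int_closed:
  obtains T where "closed T" "H = {A. det A \<noteq> 0} \<inter> T"
  using H by (auto simp: closed_matrix_group_def closedin_closed invertible_det_nz)

text \<open>\<open>H\<close> is closed only relative to the invertible matrices, so a bounded part
  of it may have singular limit points. Keeping the determinant away from 0 keeps limits invertible,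
  hence inside \<open>H\<close>.\<close>

lemma compact_exhaustion: "compact {h \<in> H. norm h \<le> r \<and> \<bar>det h\<bar> \<ge> inverse (real (Suc j))}"
proof -
  obtain T where T: "closed T" "H = {A. det A \<noteq> 0} \<inter> T" by (rule matrix_group_eq_Int_closed)
  have "{h \<in> H. norm h \<le> r \<and> \<bar>det h\<bar> \<ge> inverse (real (Suc j))}
     = cball 0 r \<inter> (T \<inter> {h. \<bar>det h\<bar> \<ge> inverse (real (Suc j))})"
    using T(2) by auto
  moreover have "closed {h :: real^'n^'n. \<bar>det h\<bar> \<ge> inverse (real (Suc j))}"
    by (intro closed_Collect_le continuous_intros)
  ultimately show ?thesis using T(1) by (simp add: compact_Int_closed closed_Int)
qed

lemma exhaustion_cover:
  assumes "h \<in> H"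
  obtains j :: nat where "norm h \<le> real j" "\<bar>det h\<bar> \<ge> inverse (real (Suc j))"
proof -
  obtain j1 :: nat where j1: "norm h \<le> real j1" using real_arch_simple by blast
  obtain j2 :: nat where j2: "inverse (real (Suc j2)) < \<bar>det h\<bar>"
    using matrix_group_det[OF assms] reals_Archimedean zero_less_abs_iff by blast
  have "inverse (real (Suc (max j1 j2))) \<le> inverse (real (Suc j2))" by (simp add: field_simps)
  then show ?thesis using that[of "max j1 j2"] j1 j2 by (smt (verit) of_nat_mono max.cobounded1)
qed

lemma borel_group: "H \<in> sets borel"
proof -
  obtain T where T: "closed T" "H = {A. det A \<noteq> 0} \<inter> T" by (rule matrix_group_eq_Int_closed)
  have "open {A :: real^'n^'n. det A \<noteq> 0}" by (intro open_Collect_neq continuous_intros)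
  then show ?thesis using T by auto
qed

lemma dual_orbit_mem: "\<xi> \<in> dual_orbit H \<xi>"
  unfolding dual_orbit_def using matrix_group_one by (auto intro!: exI[of _ "mat 1"])

lemma dual_orbit_step: "h \<in> H \<Longrightarrow> \<eta> \<in> dual_orbit H \<xi> \<Longrightarrow> transpose h *v \<eta> \<in> dual_orbit H \<xi>"
  unfolding dual_orbit_def by (auto simp: transpose_mult_vec matrix_group_mult simp del: transpose_matrix_vector)

lemma dual_orbit_transitive:
  assumes "\<eta> \<in> dual_orbit H \<xi>" "\<zeta> \<in> dual_orbit H \<xi>"
  obtains p where "p \<in> H" "\<zeta> = transpose p *v \<eta>"
proof -
  obtain a b where ab: "a \<in> H" "b \<in> H" "\<eta> = transpose a *v \<xi>" "\<zeta> = transpose b *v \<xi>"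
    using assms by (auto simp: dual_orbit_def simp del: transpose_matrix_vector)
  have "transpose (matrix_inv a ** b) *v \<eta> = transpose (a ** (matrix_inv a ** b)) *v \<xi>"
    unfolding ab transpose_mult_vec ..
  also have "\<dots> = \<zeta>" using ab matrix_group_inv_mult by (simp add: matrix_mul_assoc)
  finally show ?thesis using that[of "matrix_inv a ** b"] ab matrix_group_mult matrix_group_matrix_inv by metis
qed

lemma dual_orbit_eq:
  assumes "\<eta> \<in> dual_orbit H \<xi>"
  shows "dual_orbit H \<eta> = dual_orbit H \<xi>"
proof
  show "dual_orbit H \<eta> \<subseteq> dual_orbit H \<xi>"
    using dual_orbit_step[OF _ assms] by (auto simp: dual_orbit_def[of _ \<eta>] simp del: transpose_matrix_vector)
  show "dual_orbit H \<xi> \<subseteq> dual_orbit H \<eta>"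
    using dual_orbit_transitive[OF assms] unfolding dual_orbit_def[of _ \<eta>] by blast
qed

end

section \<open>Haar measure of a closed matrix group\<close>

context
  fixes H :: "(real^'n^'n) set" and \<mu> :: "(real^'n^'n) measure"
  assumes H: "closed_matrix_group H" and \<mu>: "left_Haar_measure H \<mu>"
begin

lemma Haar_sets: "sets \<mu> = sets (restrict_space borel H)"
  using \<mu> by (simp add: left_Haar_measure_def)

lemma Haar_space: "space \<mu> = H"
  using sets_eq_imp_space_eq[OF Haar_sets] by (simp add: space_restrict_space)

lemma Haar_sets_iff: "A \<in> sets \<mu> \<longleftrightarrow> A \<subseteq> H \<and> A \<in> sets borel"
  by (subst Haar_sets, subst sets_restrict_space_iff) (use borel_group[OF H] in auto)

lemma Haar_compact: "K \<subseteq> H \<Longrightarrow> compact K \<Longrightarrow> emeasure \<mu> K < \<infinity>"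
  using \<mu> by (simp add: left_Haar_measure_def)

lemma Haar_compact_sets: "K \<subseteq> H \<Longrightarrow> compact K \<Longrightarrow> K \<in> sets \<mu>"
  by (simp add: Haar_sets_iff borel_compact)

lemma Haar_measurable_id: "(\<lambda>h. h) \<in> borel_measurable \<mu>"
  by (rule measurableI) (auto simp: Haar_sets_iff Haar_space borel_group[OF H] intro: sets.Int)

text \<open>Compact sets have finite measure and the sets of \<open>compact_exhaustion\<close> cover
  \<open>H\<close>. This licenses every exchange of an integral over \<open>H\<close> with one over
  frequencies.\<close>

lemma Haar_sigma_finite: "sigma_finite_measure \<mu>"
proof
  define K where "K j = {h \<in> H. norm h \<le> real j \<and> \<bar>det h\<bar> \<ge> inverse (real (Suc j))}" for j :: nat
  have K: "K j \<subseteq> H" "compact (K j)" for j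
    unfolding K_def using compact_exhaustion[OF H] by auto
  have "(\<Union>j. K j) = H"
    unfolding K_def using exhaustion_cover[OF H] by blast
  then show "\<exists>A. countable A \<and> A \<subseteq> sets \<mu> \<and> \<Union>A = space \<mu> \<and> (\<forall>a\<in>A. emeasure \<mu> a \<noteq> \<infinity>)"
    using Haar_compact[OF K] Haar_compact_sets[OF K]
    by (intro exI[of _ "range K"]) (auto simp: Haar_space less_top[symmetric])
qed

lemma Haar_left_translate_sets:
  assumes "p \<in> H" "A \<in> sets \<mu>"
  shows "{h \<in> H. p ** h \<in> A} \<in> sets \<mu>"
proof -
  have "(\<lambda>h. p ** h) \<in> borel \<rightarrow>\<^sub>M borel"
    by (intro borel_measurable_continuous_onI continuous_intros)
  then have "{h. p ** h \<in> A} \<in> sets borel"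
    using assms(2) measurable_sets_borel[of "\<lambda>h. p ** h" borel A] by (auto simp: Haar_sets_iff vimage_def)
  then show ?thesis
    using borel_group[OF H] sets.Int[of H borel "{h. p ** h \<in> A}"] by (auto simp: Haar_sets_iff Collect_conj_eq)
qed

text \<open>Invariance is rephrased for preimages, the form in which sets of group elements move
  when the base point of an orbit changes.\<close>

lemma Haar_left_translate:
  assumes "p \<in> H" "A \<in> sets \<mu>"
  shows "emeasure \<mu> {h \<in> H. p ** h \<in> A} = emeasure \<mu> A"
proof -
  have "(\<lambda>h. p ** h) ` {h \<in> H. p ** h \<in> A} = A"
  proof (auto simp: image_iff)
    fix a assume a: "a \<in> A"
    then have "a \<in> H" using assms(2) by (auto simp: Haar_sets_iff)
    then have "matrix_inv p ** a \<in> H" using assms(1) by (simp add: matrix_group_mult[OF H] matrix_group_matrix_inv[OF H])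
    moreover have "p ** (matrix_inv p ** a) = a"
      using assms(1) by (simp add: matrix_mul_assoc matrix_group_inv_mult[OF H])
    ultimately show "\<exists>x. x \<in> H \<and> p ** x \<in> A \<and> a = p ** x" using a by metis
  qed
  moreover have "emeasure \<mu> ((\<lambda>h. p ** h) ` {h \<in> H. p ** h \<in> A}) = emeasure \<mu> {h \<in> H. p ** h \<in> A}"
    using \<mu> assms(1) Haar_left_translate_sets[OF assms] unfolding left_Haar_measure_def by blast
  ultimately show ?thesis by simp
qed

text \<open>A quantitative Steinhaus argument: \<open>K\<close> fills most of a small neighbourhood \<open>Q\<close> of itself,
  so two small translates of \<open>K\<close> cannot be disjoint inside \<open>Q\<close>.\<close>

lemma Haar_translates_overlap:
  assumes K: "compact K" "K \<subseteq> H" "emeasure \<mu> K \<noteq> 0"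
  obtains e where "e > 0"
    "\<And>m n. m \<in> H \<Longrightarrow> n \<in> H \<Longrightarrow> dist m (mat 1) < e \<Longrightarrow> dist n (mat 1) < e \<Longrightarrow>
       emeasure \<mu> {h \<in> H. m ** h \<in> K \<and> n ** h \<in> K} \<noteq> 0"
proof -
  have Kne: "K \<noteq> {}" using K(3) by auto
  have Km: "K \<in> sets \<mu>" by (rule Haar_compact_sets[OF K(2,1)])
  define Q where "Q j = {h \<in> H. infdist h K \<le> 1 / real (Suc j)}" for j :: nat
  \<comment> \<open>Keeps the neighbourhoods of \<open>K\<close> away from the singular matrices, so
    that small ones are compact and have finite measure, as continuity from above requires.\<close>
  have det_pos: "\<exists>d>0. \<forall>h. infdist h K \<le> d \<longrightarrow> \<bar>det h\<bar> \<ge> d"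
  proof -
    have "continuous_on K (\<lambda>h. \<bar>det h\<bar>)" by (intro continuous_intros)
    from continuous_attains_inf[OF K(1) Kne this] obtain k0 where
      k0: "k0 \<in> K" "\<And>k. k \<in> K \<Longrightarrow> \<bar>det k0\<bar> \<le> \<bar>det k\<bar>" by auto
    define c where "c = \<bar>det k0\<bar> / 2"
    have c: "c > 0" using matrix_group_det[OF H] K(2) k0(1) by (auto simp: c_def)
    let ?U = "{h :: real^'n^'n. \<bar>det h\<bar> > c}"
    have "open ?U" by (intro open_Collect_less continuous_intros)
    moreover have "K \<subseteq> ?U" using k0 c by (force simp: c_def)
    ultimately obtain d where d: "d > 0" "{x. infdist x K \<le> d} \<subseteq> ?U"
      using compact_in_open_separated[OF Kne K(1)] by blast
    show ?thesis
    proof (intro exI[of _ "min c d"] conjI allI impI)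
      show "0 < min c d" using c d by simp
      fix h assume "infdist h K \<le> min c d"
      then have "h \<in> ?U" using d(2) by auto
      then show "min c d \<le> \<bar>det h\<bar>" by simp
    qed
  qed
  then obtain d where d: "d > 0" "\<And>h. infdist h K \<le> d \<Longrightarrow> \<bar>det h\<bar> \<ge> d" by blast
  obtain R where R: "\<And>k. k \<in> K \<Longrightarrow> norm k \<le> R" "R > 0"
    using compact_imp_bounded[OF K(1)] bounded_pos by blast
  \<comment> \<open>One number, \<open>inverse (real (Suc j0))\<close>, serves both as radius of the
    neighbourhood and as lower bound for the determinant, in the format of
    \<open>compact_exhaustion\<close>.\<close>
  obtain j0 :: nat where j0: "inverse (real (Suc j0)) < d" using reals_Archimedean d by blast
  have Q_le: "infdist h K \<le> 1 / real (Suc j0)" if "h \<in> Q j" "j \<ge> j0" for h j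
  proof -
    have "1 / real (Suc j) \<le> 1 / real (Suc j0)" using that by (simp add: field_simps)
    then show ?thesis using that by (auto simp: Q_def)
  qed
  have norm_Q: "norm h \<le> R + 1" if "infdist h K \<le> 1 / real (Suc j0)" for h
  proof -
    obtain k where k: "k \<in> K" "infdist h K = dist h k"
      using infdist_attains_inf[OF compact_imp_closed[OF K(1)] Kne] by blast
    have "1 / real (Suc j0) \<le> 1" by simp
    then have "dist h k \<le> 1" using that k by linarith
    then show ?thesis using R(1)[OF k(1)] norm_triangle_sub[of h k] by (simp add: dist_norm)
  qed
  have compQ: "compact (Q j0)"
  proof -
    have "Q j0 = {h \<in> H. norm h \<le> R + 1 \<and> \<bar>det h\<bar> \<ge> inverse (real (Suc j0))} \<inter> {h. infdist h K \<le> 1 / real (Suc j0)}"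
    proof (intro Set.set_eqI iffI)
      fix h assume "h \<in> Q j0"
      then have h: "h \<in> H" "infdist h K \<le> 1 / real (Suc j0)" by (auto simp: Q_def)
      then have "infdist h K \<le> d" using j0 by (simp add: inverse_eq_divide)
      from d(2)[OF this] j0 have "inverse (real (Suc j0)) \<le> \<bar>det h\<bar>" by linarith
      then show "h \<in> {h \<in> H. norm h \<le> R + 1 \<and> inverse (real (Suc j0)) \<le> \<bar>det h\<bar>} \<inter>
        {h. infdist h K \<le> 1 / real (Suc j0)}" using h norm_Q by auto
    qed (auto simp: Q_def)
    moreover have "closed {h. infdist h K \<le> 1 / real (Suc j0)}"
      by (intro closed_Collect_le continuous_intros)
    ultimately show ?thesis by (simp only: compact_Int_closed compact_exhaustion[OF H])
  qed
  have Qm: "Q j \<in> sets \<mu>" for j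
  proof -
    have "closed {h. infdist h K \<le> 1 / real (Suc j)}" by (intro closed_Collect_le continuous_intros)
    then have "H \<inter> {h. infdist h K \<le> 1 / real (Suc j)} \<in> sets borel"
      using borel_group[OF H] by (intro sets.Int) auto
    then show ?thesis by (auto simp: Haar_sets_iff Q_def Collect_conj_eq)
  qed
  have "(\<lambda>i. emeasure \<mu> (Q (i + j0))) \<longlonglongrightarrow> emeasure \<mu> (\<Inter>i. Q (i + j0))"
  proof (rule Lim_emeasure_decseq)
    show "range (\<lambda>i. Q (i + j0)) \<subseteq> sets \<mu>" using Qm by auto
    show "decseq (\<lambda>i. Q (i + j0))"
    proof (rule decseq_SucI)
      fix i
      have "1 / real (Suc (Suc i + j0)) \<le> 1 / real (Suc (i + j0))" by (simp add: field_simps)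
      then show "Q (Suc i + j0) \<subseteq> Q (i + j0)" unfolding Q_def by auto
    qed
    fix i
    have "emeasure \<mu> (Q (i + j0)) \<le> emeasure \<mu> (Q j0)"
      using Q_le[of _ "i + j0"] Qm by (intro emeasure_mono) (auto simp: Q_def)
    also have "\<dots> < \<infinity>" using Haar_compact[OF _ compQ] by (auto simp: Q_def)
    finally show "emeasure \<mu> (Q (i + j0)) \<noteq> \<infinity>" by auto
  qed
  moreover have "(\<Inter>i. Q (i + j0)) = K"
  proof
    show "K \<subseteq> (\<Inter>i. Q (i + j0))" using K(2) by (auto simp: Q_def)
    show "(\<Inter>i. Q (i + j0)) \<subseteq> K"
    proof
      fix h assume h: "h \<in> (\<Inter>i. Q (i + j0))"
      have "infdist h K \<le> 0"
      proof (rule ccontr)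
        assume "\<not> infdist h K \<le> 0"
        then obtain i where i: "inverse (real (Suc i)) < infdist h K" using reals_Archimedean[of "infdist h K"] by force
        have "infdist h K \<le> 1 / real (Suc (i + j0))" using h by (auto simp: Q_def)
        also have "\<dots> \<le> inverse (real (Suc i))" by (simp add: field_simps)
        finally show False using i by simp
      qed
      then have "infdist h K = 0" using infdist_nonneg[of h K] by linarith
      then show "h \<in> K"
        using in_closed_iff_infdist_zero[OF compact_imp_closed[OF K(1)] Kne] by blast
    qed
  qed
  ultimately have lim: "(\<lambda>i. emeasure \<mu> (Q (i + j0))) \<longlonglongrightarrow> emeasure \<mu> K" by simp
  have fin: "emeasure \<mu> K < \<infinity>" by (rule Haar_compact[OF K(2,1)])
  have "emeasure \<mu> K < 2 * emeasure \<mu> K"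
  proof -
    have "emeasure \<mu> K = ennreal (measure \<mu> K)" using fin by (simp add: emeasure_eq_ennreal_measure)
    moreover have "measure \<mu> K > 0" using K(3) calculation using measure_nonneg[of \<mu> K] by (cases "measure \<mu> K = 0") (auto simp: zero_less_measure_iff)
    moreover have "2 * ennreal (measure \<mu> K) = ennreal (2 * measure \<mu> K)"
      by (simp add: ennreal_mult)
    ultimately show ?thesis by (simp add: ennreal_lessI)
  qed
  from order_tendstoD(2)[OF lim this] obtain i where i: "emeasure \<mu> (Q (i + j0)) < 2 * emeasure \<mu> K"
    by (auto simp: eventually_sequentially)
  define r where "r = 1 / real (Suc (i + j0))"
  have r: "r > 0" by (simp add: r_def)
  obtain C where C: "C > 0" "\<And>(a :: real^'n^'n) (b :: real^'n^'n). norm (a ** b) \<le> norm a * norm b * C"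
    using bounded_bilinear.pos_bounded[OF bounded_bilinear_matrix_mult] by blast
  \<comment> \<open>The first bound makes \<open>e * C\<close> at most 1/2, which gives
    \<open>norm h \<le> 2 * norm (m ** h)\<close> and hence at most \<open>2 * R\<close>; the second
    then makes the displacement \<open>e * norm h * C\<close> at most \<open>r\<close>.\<close>
  define e where "e = min (1 / (2 * C)) (r / (2 * C * R))"
  have e: "e > 0" using C R r by (simp add: e_def)
  have near: "h \<in> Q (i + j0)" if m: "m \<in> H" "dist m (mat 1) < e" and h: "h \<in> H" "m ** h \<in> K" for m h
  proof -
    have "dist h (m ** h) = norm ((m - mat 1) ** h)"
      by (simp add: dist_norm norm_minus_commute bounded_bilinear.diff_left[OF bounded_bilinear_matrix_mult])
    also have "\<dots> \<le> norm (m - mat 1) * norm h * C" by (rule C(2))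
    also have "\<dots> \<le> e * norm h * C"
      using m(2) C(1) by (intro mult_right_mono) (auto simp: dist_norm)
    finally have 1: "dist h (m ** h) \<le> e * norm h * C" .
    have "e * C \<le> 1/2"
    proof -
      have "e * C \<le> 1 / (2 * C) * C" using C by (intro mult_right_mono) (auto simp: e_def)
      then show ?thesis using C by simp
    qed
    then have "e * norm h * C \<le> norm h / 2"
      using mult_right_mono[of "e * C" "1/2" "norm h"] by (simp add: mult_ac)
    then have "norm h \<le> 2 * norm (m ** h)"
      using 1 norm_triangle_sub[of h "m ** h"] by (simp add: dist_norm)
    also have "\<dots> \<le> 2 * R" using R(1)[OF h(2)] by simp
    finally have "e * norm h * C \<le> e * (2 * R) * C" using e C by (intro mult_right_mono mult_left_mono) auto
    also have "\<dots> \<le> (r / (2 * C * R)) * (2 * R) * C"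
      using C R by (intro mult_right_mono) (auto simp: e_def)
    also have "\<dots> = r" using C R by simp
    finally have "dist h (m ** h) \<le> r" using 1 by simp
    then have "infdist h K \<le> r" using infdist_le2[OF h(2)] by blast
    then show ?thesis using h by (simp add: Q_def r_def)
  qed
  show thesis
  proof
    show "e > 0" by fact
    fix m n assume mn: "m \<in> H" "n \<in> H" "dist m (mat 1) < e" "dist n (mat 1) < e"
    let ?A = "{h \<in> H. m ** h \<in> K}" and ?B = "{h \<in> H. n ** h \<in> K}"
    have A: "?A \<in> sets \<mu>" "emeasure \<mu> ?A = emeasure \<mu> K" and B: "?B \<in> sets \<mu>" "emeasure \<mu> ?B = emeasure \<mu> K"
      using Haar_left_translate_sets[OF _ Km] Haar_left_translate[OF _ Km] mn by auto
    show "emeasure \<mu> {h \<in> H. m ** h \<in> K \<and> n ** h \<in> K} \<noteq> 0"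
    proof
      assume "emeasure \<mu> {h \<in> H. m ** h \<in> K \<and> n ** h \<in> K} = 0"
      moreover have "{h \<in> H. m ** h \<in> K \<and> n ** h \<in> K} = ?A \<inter> ?B" by auto
      ultimately have "?A \<inter> ?B \<in> null_sets \<mu>" using A B by auto
      then have "emeasure \<mu> (?A \<union> ?B) = 2 * emeasure \<mu> K"
        using A B emeasure_Un'[of ?A \<mu> ?B] by (simp add: mult_2)
      moreover have "emeasure \<mu> (?A \<union> ?B) \<le> emeasure \<mu> (Q (i + j0))"
        using near mn Qm by (intro emeasure_mono) auto
      ultimately show False using i by simp
    qed
  qed
qed

end

section \<open>Linear images of Lebesgue measure\<close>

text \<open>The change of variables theorems of the library need a well-ordered index type. For the
  purposes here the constant (the inverse of \<open>\<bar>det A\<bar>\<close>) is irrelevant, so uniqueness of the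
  translation-invariant measure suffices.\<close>

lemma translation_invariant_eq_lborel:
  fixes \<nu> :: "'a::euclidean_space measure"
  assumes sets: "sets \<nu> = sets borel" and fin: "sigma_finite_measure \<nu>"
    and inv: "\<And>S y. S \<in> sets borel \<Longrightarrow> emeasure \<nu> {x. x + y \<in> S} = emeasure \<nu> S"
    and S: "S \<in> sets borel" and E: "E \<in> sets borel"
  shows "emeasure \<nu> S * emeasure lborel E = emeasure \<nu> E * emeasure lborel S"
proof -
  interpret \<nu>: sigma_finite_measure \<nu> by (rule fin)
  interpret pair_sigma_finite \<nu> lborel ..
  have space: "space \<nu> = UNIV" using sets_eq_imp_space_eq[OF sets] by simp
  note [measurable] = S E
  note [measurable_cong] = sets
  have shift: "emeasure lborel {y. x + y \<in> E} = emeasure lborel E" for x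
  proof -
    have "emeasure lborel E = emeasure (distr lborel borel ((+) x)) E" by (simp add: lborel_distr_plus)
    also have "\<dots> = emeasure lborel {y. x + y \<in> E}" using E by (subst emeasure_distr) (auto simp: vimage_def)
    finally show ?thesis ..
  qed
  have refl: "emeasure lborel {y. x - y \<in> S} = emeasure lborel S" for x
  proof -
    have "lborel = density (distr lborel borel (\<lambda>y. x + (-1) *\<^sub>R y)) (\<lambda>_. ennreal (\<bar>-1\<bar>^DIM('a)))"
      by (rule lborel_affine) simp
    then have *: "lborel = distr lborel borel (\<lambda>y. x - y)" by (simp add: density_1)
    have "emeasure lborel S = emeasure (distr lborel borel (\<lambda>y. x - y)) S" by (simp flip: *)
    also have "\<dots> = emeasure lborel {y. x - y \<in> S}" using S by (subst emeasure_distr) (auto simp: vimage_def)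
    finally show ?thesis ..
  qed
  \<comment> \<open>Both sides evaluate the double integral of
    \<open>indicator S x * indicator E (x + y)\<close>. Integrating over \<open>y\<close> first
    gives the left side. Exchanging the order, shifting \<open>x\<close> by \<open>y\<close>, which
    the invariance of \<open>\<nu>\<close> allows, and exchanging back gives the right side, where
    \<open>refl\<close> computes the inner integral.\<close>
  have "emeasure \<nu> S * emeasure lborel E = (\<integral>\<^sup>+x. indicator S x * emeasure lborel E \<partial>\<nu>)"
    by (subst nn_integral_multc) (auto simp: sets)
  also have "\<dots> = (\<integral>\<^sup>+x. (\<integral>\<^sup>+y. indicator S x * indicator {y. x + y \<in> E} y \<partial>lborel) \<partial>\<nu>)"
    by (intro nn_integral_cong) (simp add: nn_integral_cmult shift)
  also have "\<dots> = (\<integral>\<^sup>+x. (\<integral>\<^sup>+y. indicator S x * indicator E (x + y) \<partial>lborel) \<partial>\<nu>)"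
    by (intro nn_integral_cong) (simp add: indicator_def)
  also have "\<dots> = (\<integral>\<^sup>+y. (\<integral>\<^sup>+x. indicator S x * indicator E (x + y) \<partial>\<nu>) \<partial>lborel)"
    by (subst Fubini') auto
  also have "\<dots> = (\<integral>\<^sup>+y. (\<integral>\<^sup>+x. indicator S (x - y) * indicator E x \<partial>\<nu>) \<partial>lborel)"
  proof (rule nn_integral_cong)
    fix y :: 'a
    let ?S = "{x. x \<in> E \<and> x - y \<in> S}"
    have m: "?S \<in> sets borel" by measurable
    have "{x. x + y \<in> ?S} = {x. x \<in> S \<and> x + y \<in> E}" by auto
    then have "emeasure \<nu> {x. x \<in> S \<and> x + y \<in> E} = emeasure \<nu> ?S"
      using inv[OF m, of y] by simp
    moreover have "{x. x \<in> S \<and> x + y \<in> E} \<in> sets \<nu>" "?S \<in> sets \<nu>" unfolding sets by measurable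
    moreover have "(\<integral>\<^sup>+x. indicator S x * indicator E (x + y) \<partial>\<nu>) = (\<integral>\<^sup>+x. indicator {x. x \<in> S \<and> x + y \<in> E} x \<partial>\<nu>)"
      by (intro nn_integral_cong) (simp add: indicator_def)
    moreover have "(\<integral>\<^sup>+x. indicator S (x - y) * indicator E x \<partial>\<nu>) = (\<integral>\<^sup>+x. indicator ?S x \<partial>\<nu>)"
      by (intro nn_integral_cong) (auto simp: indicator_def)
    ultimately show "(\<integral>\<^sup>+x. indicator S x * indicator E (x + y) \<partial>\<nu>)
        = (\<integral>\<^sup>+x. indicator S (x - y) * indicator E x \<partial>\<nu>)"
      by simp
  qed
  also have "\<dots> = (\<integral>\<^sup>+x. (\<integral>\<^sup>+y. indicator S (x - y) * indicator E x \<partial>lborel) \<partial>\<nu>)"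
    by (subst Fubini') auto
  also have "\<dots> = (\<integral>\<^sup>+x. (\<integral>\<^sup>+y. indicator E x * indicator {y. x - y \<in> S} y \<partial>lborel) \<partial>\<nu>)"
    by (intro nn_integral_cong) (simp add: indicator_def)
  also have "\<dots> = (\<integral>\<^sup>+x. indicator E x * emeasure lborel S \<partial>\<nu>)"
    by (intro nn_integral_cong) (simp add: nn_integral_cmult refl)
  also have "\<dots> = emeasure \<nu> E * emeasure lborel S"
    by (subst nn_integral_multc) (auto simp: sets)
  finally show ?thesis .
qed

lemma distr_lborel_linear:
  fixes A :: "real^'n^'n"
  assumes A: "invertible A"
  obtains c :: real where "c > 0" "distr lborel borel (\<lambda>x. A *v x) = density lborel (\<lambda>_. ennreal c)"
proof -
  have meas [measurable]: "(\<lambda>x. A *v x) \<in> borel \<rightarrow>\<^sub>M borel"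
    by (intro borel_measurable_continuous_onI continuous_intros)
  have cancel: "matrix_inv A *v (A *v x) = x" "A *v (matrix_inv A *v x) = x" for x
    using matrix_inv_cancel[OF A] by (simp_all add: matrix_vector_mul_assoc)
  define \<nu> where "\<nu> = distr lborel borel (\<lambda>x. A *v x)"
  have sets: "sets \<nu> = sets borel" by (simp add: \<nu>_def)
  have em: "emeasure \<nu> S = emeasure lborel {x. A *v x \<in> S}" if "S \<in> sets borel" for S
    using that by (simp add: \<nu>_def emeasure_distr vimage_def)
  have bnd: "emeasure \<nu> S < \<infinity>" if "S \<in> sets borel" "bounded S" for S
  proof -
    have "{x. A *v x \<in> S} \<subseteq> (\<lambda>x. matrix_inv A *v x) ` S" using cancel by (metis (mono_tags, lifting) image_eqI mem_Collect_eq subsetI)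
    moreover have "bounded ((\<lambda>x. matrix_inv A *v x) ` S)"
      using that(2) by (intro bounded_linear_image) (auto simp: linear_linear)
    ultimately have "bounded {x. A *v x \<in> S}" using bounded_subset by blast
    then show ?thesis using em[OF that(1)] emeasure_bounded_finite[of "{x. A *v x \<in> S}"] by simp
  qed
  have fin: "sigma_finite_measure \<nu>"
  proof
    have "(\<Union>n::nat. ball (0::real^'n) (real n)) = UNIV"
      using reals_Archimedean2 by (auto simp: dist_norm)
    then show "\<exists>B. countable B \<and> B \<subseteq> sets \<nu> \<and> \<Union>B = space \<nu> \<and> (\<forall>a\<in>B. emeasure \<nu> a \<noteq> \<infinity>)"
      using bnd[of "ball 0 _"] by (intro exI[of _ "range (\<lambda>n::nat. ball 0 (real n))"])
        (auto simp: sets less_top[symmetric] \<nu>_def)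
  qed
  have inv: "emeasure \<nu> {x. x + y \<in> S} = emeasure \<nu> S" if S: "S \<in> sets borel" for S y
  proof -
    have [measurable]: "S \<in> sets borel" by fact
    \<comment> \<open>A translation by \<open>y\<close> after the map is a translation by
      \<open>z\<close> before it.\<close>
    define z where "z = matrix_inv A *v y"
    have "{x. A *v x \<in> {x. x + y \<in> S}} = {x. A *v (z + x) \<in> S}"
      by (simp add: z_def matrix_vector_right_distrib cancel add.commute)
    moreover have "emeasure (distr lborel borel ((+) z)) {x. A *v x \<in> S} = emeasure lborel {x. A *v (z + x) \<in> S}"
      by (subst emeasure_distr) (auto simp: vimage_def)
    moreover have "{x. x + y \<in> S} \<in> sets borel" by measurable
    ultimately show ?thesis using em[OF S] em[of "{x. x + y \<in> S}"] by (simp add: lborel_distr_plus)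
  qed
  \<comment> \<open>The unit box has Lebesgue measure 1, so its \<open>\<nu>\<close>-measure is the
    constant itself. It is finite because the preimage of the box is bounded, and positive because
    that preimage is open and nonempty.\<close>
  let ?E = "box 0 One :: (real^'n) set"
  have E1: "emeasure lborel ?E = 1" by (simp add: emeasure_lborel_box_eq inner_diff_left)
  obtain c where c: "emeasure \<nu> ?E = ennreal c" "c \<ge> 0"
    using bnd[of ?E] by (cases "emeasure \<nu> ?E") auto
  have open_pre: "open {x. A *v x \<in> ?E}"
    using open_vimage[OF open_box, of "\<lambda>x. A *v x"] by (simp add: vimage_def continuous_intros)
  moreover have "{x. A *v x \<in> ?E} \<noteq> {}"
  proof -
    have "?E \<noteq> {}" by (simp add: box_ne_empty)
    then show ?thesis using cancel(2) by (metis (mono_tags, lifting) all_not_in_conv mem_Collect_eq)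
  qed
  ultimately have "\<not> negligible {x. A *v x \<in> ?E}" using open_not_negligible by blast
  then have "{x. A *v x \<in> ?E} \<notin> null_sets lborel"
    using null_sets_completionI negligible_iff_null_sets by blast
  then have "emeasure lborel {x. A *v x \<in> ?E} \<noteq> 0"
    using open_pre by auto
  then have "c > 0" using c em[of ?E] by (cases "c = 0") auto
  moreover have "\<nu> = density lborel (\<lambda>_. ennreal c)"
  proof (rule measure_eqI)
    fix S assume "S \<in> sets \<nu>"
    then have S: "S \<in> sets borel" by (simp add: sets)
    have "emeasure \<nu> S * emeasure lborel ?E = emeasure \<nu> ?E * emeasure lborel S"
      by (rule translation_invariant_eq_lborel[OF sets fin inv S]) auto
    then show "emeasure \<nu> S = emeasure (density lborel (\<lambda>_. ennreal c)) S"
      using S by (simp add: E1 c emeasure_density nn_integral_cmult)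
  qed (simp add: sets)
  ultimately show ?thesis using that unfolding \<nu>_def by blast
qed

lemma null_sets_linear_vimage:
  fixes A :: "real^'n^'n"
  assumes A: "invertible A" and N: "N \<in> null_sets lborel"
  shows "{x. A *v x \<in> N} \<in> null_sets lborel"
proof -
  have m: "(\<lambda>x. A *v x) \<in> borel \<rightarrow>\<^sub>M borel"
    by (intro borel_measurable_continuous_onI continuous_intros)
  obtain c where c: "distr lborel borel (\<lambda>x. A *v x) = density lborel (\<lambda>_. ennreal c)"
    by (rule distr_lborel_linear[OF A])
  have NB: "N \<in> sets borel" using N by auto
  have "emeasure lborel {x. A *v x \<in> N} = emeasure (distr lborel borel (\<lambda>x. A *v x)) N"
    using NB m by (simp add: emeasure_distr vimage_def)
  also have "\<dots> = 0" using N NB by (simp add: c emeasure_density nn_integral_cmult null_setsD1)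
  finally show ?thesis using measurable_sets_borel[OF m NB] by (simp add: vimage_def null_sets_def)
qed

section \<open>Openness of the orbit maps\<close>

lemma det_zero: "det (0 :: real^'n^'n) = 0"
proof -
  have "mat 0 = (0 :: real^'n^'n)" by (simp add: mat_def vec_eq_iff)
  then show ?thesis by (metis det_0)
qed

lemma mat1_nonzero: "(mat 1 :: real^'n^'n) \<noteq> 0"
  by (metis det_zero det_I zero_neq_one)

context
  fixes H :: "(real^'n^'n) set"
  assumes H: "closed_matrix_group H"
begin

text \<open>By the Baire category theorem: countably many translates of the image of a compact
  neighbourhood of the identity cover the open orbit, so that image has interior points.\<close>

lemma dual_orbit_map_open:
  assumes O: "open (dual_orbit H \<eta>)" and e: "e > 0"
  obtains U where "open U" "\<eta> \<in> U"
    "\<And>\<zeta>. \<zeta> \<in> U \<Longrightarrow> \<exists>m\<in>H. dist m (mat 1) < e \<and> transpose m *v \<eta> = \<zeta>"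
proof -
  obtain C where C: "C > 0" "\<And>(a :: real^'n^'n) (b :: real^'n^'n). norm (a ** b) \<le> norm a * norm b * C"
    using bounded_bilinear.pos_bounded[OF bounded_bilinear_matrix_mult] by blast
  define N where "N = norm (mat 1 :: real^'n^'n)"
  have N: "N > 0" using mat1_nonzero by (simp add: N_def)
  have "open {A :: real^'n^'n. det A \<noteq> 0}" by (intro open_Collect_neq continuous_intros)
  moreover have "(mat 1 :: real^'n^'n) \<in> {A. det A \<noteq> 0}" by simp
  ultimately obtain d0 where d0: "d0 > 0" "cball (mat 1 :: real^'n^'n) d0 \<subseteq> {A. det A \<noteq> 0}"
    by (meson open_contains_cball)
  \<comment> \<open>\<open>d0\<close> keeps the ball among invertible matrices, which makes
    \<open>M\<close> compact; \<open>1 / (2 * C)\<close> bounds inverses of elements of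
    \<open>M\<close> by \<open>2 * N\<close>; \<open>e / (8 * C * N)\<close> makes the final
    estimate \<open>(2 * d) * (2 * N) * C\<close> at most \<open>e / 2\<close>.\<close>
  define d where "d = min d0 (min (1 / (2 * C)) (e / (8 * C * N)))"
  have d: "d > 0" "d \<le> d0" "d \<le> 1 / (2 * C)" "d \<le> e / (8 * C * N)" using d0 C e N by (auto simp: d_def)
  obtain T where T: "closed T" "H = {A. det A \<noteq> 0} \<inter> T" by (rule matrix_group_eq_Int_closed[OF H])
  define M where "M = H \<inter> cball (mat 1) d"
  have "cball (mat 1 :: real^'n^'n) d \<subseteq> cball (mat 1) d0" using d by auto
  then have "M = cball (mat 1) d \<inter> T" using T(2) d0(2) by (auto simp: M_def)
  then have compM: "compact M" using T by (simp add: compact_Int_closed)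
  define P where "P = (\<lambda>k. transpose k *v \<eta>) ` M"
  have compP: "compact P"
    unfolding P_def by (intro compact_continuous_image compM continuous_intros)
  obtain D where D: "countable D" "D \<subseteq> H" "H \<subseteq> closure D" by (rule separable)
  \<comment> \<open>The copies of \<open>P\<close> moved by the inverses of a countable dense set of
    group elements.\<close>
  define Pd where "Pd a = (\<lambda>x. transpose (matrix_inv a) *v x) ` P" for a :: "real^'n^'n"
  have clPd: "closed (Pd a)" for a
    unfolding Pd_def by (intro compact_imp_closed compact_continuous_image compP continuous_intros)
  have cover: "dual_orbit H \<eta> \<subseteq> (\<Union>a\<in>D. Pd a)"
  proof
    fix \<zeta> assume "\<zeta> \<in> dual_orbit H \<eta>"
    then obtain h where h: "h \<in> H" "\<zeta> = transpose h *v \<eta>" by (auto simp: dual_orbit_def simp del: transpose_matrix_vector)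
    have hn: "norm h > 0" using matrix_group_det[OF H h(1)] det_zero by auto
    \<comment> \<open>The inverse of \<open>h\<close> is approximated rather than \<open>h\<close>
      itself, so that \<open>h ** a\<close> is close to the identity and lands in \<open>M\<close>.
      The tolerance is scaled by \<open>norm h\<close> because the error is multiplied by
      \<open>h\<close>.\<close>
    have "matrix_inv h \<in> closure D" using D(3) matrix_group_matrix_inv[OF H h(1)] by auto
    then obtain a where a: "a \<in> D" "dist a (matrix_inv h) < d / (C * norm h)"
      using C d hn by (metis closure_approachable divide_pos_pos mult_pos_pos)
    then have aH: "a \<in> H" using D by auto
    have "h ** a - mat 1 = h ** (a - matrix_inv h)"
      by (simp add: bounded_bilinear.diff_right[OF bounded_bilinear_matrix_mult] matrix_group_inv_mult[OF H h(1)])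
    then have "norm (h ** a - mat 1) \<le> norm h * norm (a - matrix_inv h) * C" using C(2) by metis
    also have "\<dots> \<le> norm h * (d / (C * norm h)) * C"
      using a(2) C by (intro mult_right_mono mult_left_mono) (auto simp: dist_norm)
    also have "\<dots> = d" using C hn by simp
    finally have "h ** a \<in> M" using matrix_group_mult[OF H h(1) aH] by (simp add: M_def dist_norm norm_minus_commute)
    moreover have "\<zeta> = transpose (matrix_inv a) *v (transpose (h ** a) *v \<eta>)"
      unfolding transpose_mult_vec h(2) using matrix_group_inv_mult[OF H aH] by (simp add: matrix_mul_assoc[symmetric])
    ultimately show "\<zeta> \<in> (\<Union>a\<in>D. Pd a)" using a(1) unfolding Pd_def P_def by blast
  qed
  have "\<exists>a\<in>D. interior (Pd a) \<noteq> {}"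
  proof (rule ccontr)
    assume "\<not> ?thesis"
    then have dense: "closure (- Pd a) = UNIV" if "a \<in> D" for a
      using that by (simp add: closure_complement)
    \<comment> \<open>If no closed set \<open>Pd a\<close> had interior points, their complements
      would have a dense intersection. It would meet the open orbit, which the sets
      \<open>Pd a\<close> cover.\<close>
    have "UNIV \<subseteq> closure (\<Inter>a\<in>D. - Pd a)"
    proof (rule Baire)
      show "countable ((\<lambda>a. - Pd a) ` D)" using D by simp
      fix T assume "T \<in> (\<lambda>a. - Pd a) ` D"
      then show "openin (top_of_set UNIV) T \<and> UNIV \<subseteq> closure T"
        using dense clPd by (auto simp: open_Compl)
    qed simp
    then have "dual_orbit H \<eta> \<inter> closure (\<Inter>a\<in>D. - Pd a) \<noteq> {}" using dual_orbit_mem[OF H, of \<eta>] by blast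
    then have "dual_orbit H \<eta> \<inter> (\<Inter>a\<in>D. - Pd a) \<noteq> {}"
      using O open_Int_closure_eq_empty by blast
    then show False using cover by blast
  qed
  then obtain a where a: "a \<in> D" "interior (Pd a) \<noteq> {}" by blast
  then have aH: "a \<in> H" using D by auto
  define I where "I = (\<lambda>x. transpose a *v x) ` interior (Pd a)"
  have canc: "transpose a *v (transpose (matrix_inv a) *v x) = x" "transpose (matrix_inv a) *v (transpose a *v x) = x" for x
    unfolding transpose_mult_vec by (simp_all add: matrix_group_inv_mult[OF H aH])
  have "surj (\<lambda>x. transpose a *v x)" using canc(1) by (metis surjI)
  then have "open I" unfolding I_def by (intro open_surjective_linear_image) auto
  have "I \<subseteq> P"
  proof
    fix x assume "x \<in> I"
    then obtain y where "y \<in> Pd a" "x = transpose a *v y" unfolding I_def using interior_subset by blast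
    then show "x \<in> P" unfolding Pd_def using canc(1) by auto
  qed
  obtain x where x: "x \<in> I" using a(2) by (auto simp: I_def)
  then have "x \<in> P" using \<open>I \<subseteq> P\<close> by auto
  with x obtain p where p: "p \<in> M" "transpose p *v \<eta> \<in> I" unfolding P_def by blast
  then have pH: "p \<in> H" and pd: "dist p (mat 1) \<le> d" by (auto simp: M_def dist_commute)
  \<comment> \<open>The interior point found in \<open>P\<close> is
    \<open>transpose p *v \<eta>\<close> and not \<open>\<eta>\<close>. Pulling its neighbourhood
    back by \<open>p\<close> gives one of \<open>\<eta>\<close>, at the price of multiplying the
    elements of \<open>M\<close> by the inverse of \<open>p\<close>.\<close>
  define q where "q = matrix_inv p"
  have q: "q \<in> H" "p ** q = mat 1" "q ** p = mat 1"
    using matrix_group_matrix_inv[OF H pH] matrix_group_inv_mult[OF H pH] by (auto simp: q_def)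
  have nq: "norm q \<le> 2 * N"
  proof -
    \<comment> \<open>The norm of \<open>q\<close> reappears on the right with a factor of at most
      1/2 and can be absorbed.\<close>
    have "q = mat 1 - (p - mat 1) ** q"
      by (simp add: bounded_bilinear.diff_left[OF bounded_bilinear_matrix_mult] q)
    then have "norm q \<le> N + norm ((p - mat 1) ** q)" unfolding N_def by (metis norm_triangle_ineq4)
    also have "norm ((p - mat 1) ** q) \<le> norm (p - mat 1) * norm q * C" by (rule C(2))
    also have "\<dots> \<le> 1 / (2 * C) * norm q * C"
      using pd d C by (intro mult_right_mono) (auto simp: dist_norm)
    also have "\<dots> = norm q / 2" using C by simp
    finally show ?thesis by simp
  qed
  show thesis
  proof
    show "open {\<zeta>. transpose p *v \<zeta> \<in> I}"
      using open_vimage[OF \<open>open I\<close>, of "\<lambda>\<zeta>. transpose p *v \<zeta>"]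
      by (simp add: vimage_def continuous_intros del: transpose_matrix_vector)
    show "\<eta> \<in> {\<zeta>. transpose p *v \<zeta> \<in> I}" using p by simp
    fix \<zeta> assume "\<zeta> \<in> {\<zeta>. transpose p *v \<zeta> \<in> I}"
    then obtain k where k: "k \<in> M" "transpose p *v \<zeta> = transpose k *v \<eta>"
      using \<open>I \<subseteq> P\<close> by (auto simp: P_def simp del: transpose_matrix_vector)
    then have kH: "k \<in> H" and kd: "dist k (mat 1) \<le> d" by (auto simp: M_def dist_commute)
    have "dist k p \<le> 2 * d" using kd pd dist_triangle2[of k p "mat 1"] by linarith
    have "k ** q - mat 1 = (k - p) ** q"
      by (simp add: bounded_bilinear.diff_left[OF bounded_bilinear_matrix_mult] q)
    then have "dist (k ** q) (mat 1) \<le> norm (k - p) * norm q * C" using C(2) by (metis dist_norm)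
    also have "\<dots> \<le> (2 * d) * (2 * N) * C"
      using \<open>dist k p \<le> 2 * d\<close> nq C d by (intro mult_right_mono mult_mono) (auto simp: dist_norm)
    also have "\<dots> \<le> e / (8 * C * N) * (4 * N * C)"
      using mult_right_mono[OF d(4), of "4 * N * C"] C N by (simp add: mult_ac)
    also have "\<dots> < e" using C N e by simp
    finally have "dist (k ** q) (mat 1) < e" .
    moreover have "transpose (k ** q) *v \<eta> = \<zeta>"
    proof -
      have "transpose (k ** q) *v \<eta> = transpose q *v (transpose p *v \<zeta>)"
        unfolding k(2) transpose_mult_vec ..
      then show ?thesis unfolding transpose_mult_vec using q by simp
    qed
    ultimately show "\<exists>m\<in>H. dist m (mat 1) < e \<and> transpose m *v \<eta> = \<zeta>"
      using matrix_group_mult[OF H kH q(1)] by blast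
  qed
qed

end

section \<open>Measure along orbits and local separation\<close>

lemma borel_measurable_dual_action [measurable]:
  fixes f :: "'a \<Rightarrow> real^'n^'n" and g :: "'a \<Rightarrow> real^'n"
  assumes "f \<in> borel_measurable M" "g \<in> borel_measurable M"
  shows "(\<lambda>x. transpose (f x) *v g x) \<in> borel_measurable M"
  by (rule borel_measurable_continuous_Pair[OF assms]) (intro continuous_intros)

context
  fixes H :: "(real^'n^'n) set" and \<mu> :: "(real^'n^'n) measure"
  assumes H: "closed_matrix_group H" and \<mu>: "left_Haar_measure H \<mu>"
begin

lemma emeasure_Haar_orbit:
  assumes "W \<in> sets borel"
  shows "emeasure \<mu> {h \<in> H. transpose h *v \<xi> \<in> W} = (\<integral>\<^sup>+h. indicator W (transpose h *v \<xi>) \<partial>\<mu>)"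
    and "{h \<in> H. transpose h *v \<xi> \<in> W} \<in> sets \<mu>"
proof -
  note [measurable] = Haar_measurable_id[OF H \<mu>] assms
  have "{h \<in> space \<mu>. transpose h *v \<xi> \<in> W} \<in> sets \<mu>" by measurable
  then show *: "{h \<in> H. transpose h *v \<xi> \<in> W} \<in> sets \<mu>" by (simp only: Haar_space[OF H \<mu>])
  have "(\<integral>\<^sup>+h. indicator W (transpose h *v \<xi>) \<partial>\<mu>) = (\<integral>\<^sup>+h. indicator {h \<in> H. transpose h *v \<xi> \<in> W} h \<partial>\<mu>)"
    by (intro nn_integral_cong) (auto simp: indicator_def Haar_space[OF H \<mu>])
  then show "emeasure \<mu> {h \<in> H. transpose h *v \<xi> \<in> W} = (\<integral>\<^sup>+h. indicator W (transpose h *v \<xi>) \<partial>\<mu>)"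
    using * by simp
qed

text \<open>By Fubini it suffices to fix \<open>h\<close>, and the preimage of a null set under the
  invertible map given by \<open>transpose h\<close> is null.\<close>

lemma AE_Haar_orbit_null:
  assumes N: "N \<in> null_sets lborel"
  shows "AE \<xi> in lborel. emeasure \<mu> {h \<in> H. transpose h *v \<xi> \<in> N} = 0"
proof -
  interpret \<mu>: sigma_finite_measure \<mu> by (rule Haar_sigma_finite[OF H \<mu>])
  interpret pair_sigma_finite lborel \<mu> ..
  have NB: "N \<in> sets borel" using N by auto
  note [measurable] = Haar_measurable_id[OF H \<mu>] NB
  have "(\<integral>\<^sup>+\<xi>. (\<integral>\<^sup>+h. indicator N (transpose h *v \<xi>) \<partial>\<mu>) \<partial>lborel)
      = (\<integral>\<^sup>+h. (\<integral>\<^sup>+\<xi>. indicator N (transpose h *v \<xi>) \<partial>lborel) \<partial>\<mu>)"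
    by (rule Fubini'[symmetric]) measurable
  also have "\<dots> = (\<integral>\<^sup>+h. 0 \<partial>\<mu>)"
  proof (rule nn_integral_cong)
    fix h assume "h \<in> space \<mu>"
    then have "invertible (transpose h)" using matrix_group_invertible[OF H, of h]
      by (simp add: Haar_space[OF H \<mu>] invertible_det_nz)
    then have "{\<xi>. transpose h *v \<xi> \<in> N} \<in> null_sets lborel" using null_sets_linear_vimage N by blast
    then have "(\<integral>\<^sup>+\<xi>. indicator {\<xi>. transpose h *v \<xi> \<in> N} \<xi> \<partial>lborel) = 0" by (simp add: null_setsD1 del: transpose_matrix_vector)
    then show "(\<integral>\<^sup>+\<xi>. indicator N (transpose h *v \<xi>) \<partial>lborel) = 0"
      by (simp add: indicator_def del: transpose_matrix_vector)
  qed
  also have "\<dots> = 0" by simp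
  finally have "AE \<xi> in lborel. (\<integral>\<^sup>+h. indicator N (transpose h *v \<xi>) \<partial>\<mu>) = 0"
    by (subst (asm) nn_integral_0_iff_AE) measurable
  then show ?thesis by (simp only: emeasure_Haar_orbit[OF NB])
qed

text \<open>Up to a null set \<open>W\<close> is a countable union of compact sets. The null part is
  invisible along almost every orbit map, and the preimages of the compact parts are closed, so
  their intersections with the compact exhaustion of \<open>H\<close> are compact and one of them
  has positive measure. A left translation finally moves the base point to
  \<open>\<eta>\<close>.\<close>

lemma compact_in_orbit_preimage:
  assumes O: "open (dual_orbit H \<xi>)" and W: "W \<in> sets borel"
    and pos: "AE \<zeta> in lborel. emeasure \<mu> {h \<in> H. transpose h *v \<zeta> \<in> W} \<noteq> 0"
    and \<eta>: "\<eta> \<in> dual_orbit H \<xi>"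
  obtains K where "compact K" "K \<subseteq> H" "emeasure \<mu> K \<noteq> 0" "\<And>h. h \<in> K \<Longrightarrow> transpose h *v \<eta> \<in> W"
proof -
  obtain C T where CT: "fsigma C" "T \<in> null_sets lebesgue" "C \<union> T = W"
    using lebesgue_set_almost_fsigma[of W] W by (metis sets_completionI_sets sets_lborel)
  obtain F :: "nat \<Rightarrow> (real^'n) set" where F': "range F \<subseteq> Collect compact" "C = \<Union>(F ` UNIV)"
    using CT(1) unfolding fsigma_Union_compact by blast
  then have F: "compact (F i)" "C = (\<Union>i. F i)" for i by auto
  obtain N where N: "N \<in> null_sets lborel" "T \<subseteq> N"
    using CT(2) unfolding null_sets_completion_iff2 by auto
  have "AE \<zeta> in lborel. emeasure \<mu> {h \<in> H. transpose h *v \<zeta> \<in> W} \<noteq> 0 \<and>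
      emeasure \<mu> {h \<in> H. transpose h *v \<zeta> \<in> N} = 0"
    using pos AE_Haar_orbit_null[OF N(1)] by eventually_elim auto
  then obtain Z where Z: "Z \<in> null_sets lborel" "{\<zeta> \<in> space lborel. \<not> (emeasure \<mu> {h \<in> H. transpose h *v \<zeta> \<in> W} \<noteq> 0 \<and>
      emeasure \<mu> {h \<in> H. transpose h *v \<zeta> \<in> N} = 0)} \<subseteq> Z"
    unfolding eventually_ae_filter by blast
  \<comment> \<open>Both properties hold only almost everywhere; a nonempty open orbit is not null
    and so contains a point \<open>\<zeta>\<close> that has them.\<close>
  have "\<not> dual_orbit H \<xi> \<subseteq> Z"
  proof
    assume "dual_orbit H \<xi> \<subseteq> Z"
    then have "dual_orbit H \<xi> \<in> null_sets lborel" using null_sets_subset[OF Z(1)] O by simp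
    then have "negligible (dual_orbit H \<xi>)" using null_sets_completionI negligible_iff_null_sets by blast
    then show False using open_not_negligible O dual_orbit_mem[OF H] by blast
  qed
  then obtain \<zeta> where \<zeta>: "\<zeta> \<in> dual_orbit H \<xi>" "emeasure \<mu> {h \<in> H. transpose h *v \<zeta> \<in> W} \<noteq> 0"
      "emeasure \<mu> {h \<in> H. transpose h *v \<zeta> \<in> N} = 0" using Z(2) by auto
  define E where "E i j = {h \<in> H. norm h \<le> real j \<and> \<bar>det h\<bar> \<ge> inverse (real (Suc j))} \<inter> {h. transpose h *v \<zeta> \<in> F i}" for i j :: nat
  have E: "compact (E i j)" "E i j \<subseteq> H" for i j
  proof -
    have "closed ((\<lambda>h :: real^'n^'n. transpose h *v \<zeta>) -` F i)"
      by (rule closed_vimage) (auto intro!: compact_imp_closed F continuous_intros simp del: transpose_matrix_vector)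
    then show "compact (E i j)" unfolding E_def
      by (intro compact_Int_closed compact_exhaustion[OF H]) (simp add: vimage_def del: transpose_matrix_vector)
  qed (auto simp: E_def)
  have "\<exists>i j. emeasure \<mu> (E i j) \<noteq> 0"
  proof (rule ccontr)
    assume "\<not> ?thesis"
    then have "(\<Union>p\<in>UNIV. E (fst p) (snd p)) \<in> null_sets \<mu>"
      by (intro null_sets_UN') (auto simp: null_sets_def Haar_compact_sets[OF H \<mu> E(2,1)])
    moreover have "{h \<in> H. transpose h *v \<zeta> \<in> N} \<in> null_sets \<mu>"
      using \<zeta>(3) emeasure_Haar_orbit(2)[of N] N by (auto simp: null_sets_def)
    ultimately have "(\<Union>p\<in>UNIV. E (fst p) (snd p)) \<union> {h \<in> H. transpose h *v \<zeta> \<in> N} \<in> null_sets \<mu>" by blast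
    moreover have "{h \<in> H. transpose h *v \<zeta> \<in> W} \<subseteq> (\<Union>p\<in>UNIV. E (fst p) (snd p)) \<union> {h \<in> H. transpose h *v \<zeta> \<in> N}"
    proof
      fix h assume h: "h \<in> {h \<in> H. transpose h *v \<zeta> \<in> W}"
      then have hH: "h \<in> H" by simp
      obtain j :: nat where j: "norm h \<le> real j" "\<bar>det h\<bar> \<ge> inverse (real (Suc j))"
        by (rule exhaustion_cover[OF H hH])
      show "h \<in> (\<Union>p\<in>UNIV. E (fst p) (snd p)) \<union> {h \<in> H. transpose h *v \<zeta> \<in> N}"
      proof (cases "transpose h *v \<zeta> \<in> C")
        case True
        then obtain i where "transpose h *v \<zeta> \<in> F i" using F by auto
        then have "h \<in> E i j" using j hH by (simp add: E_def del: transpose_matrix_vector)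
        then show ?thesis by force
      next
        case False
        then show ?thesis using h CT(3) N by auto
      qed
    qed
    ultimately have "emeasure \<mu> {h \<in> H. transpose h *v \<zeta> \<in> W} = 0"
      using emeasure_Haar_orbit(2)[OF W] null_sets_subset null_setsD1 by blast
    then show False using \<zeta> by simp
  qed
  then obtain i j where ij: "emeasure \<mu> (E i j) \<noteq> 0" by blast
  obtain p where p: "p \<in> H" "\<eta> = transpose p *v \<zeta>" by (rule dual_orbit_transitive[OF H \<zeta>(1) \<eta>])
  show thesis
  proof
    \<comment> \<open>As \<open>\<eta> = transpose p *v \<zeta>\<close>, the elements that act on
      \<open>\<eta>\<close> as those of \<open>E i j\<close> act on \<open>\<zeta>\<close> form the
      translate of \<open>E i j\<close> by the inverse of \<open>p\<close>.\<close>
    have eq: "{h \<in> H. p ** h \<in> E i j} = (\<lambda>h. matrix_inv p ** h) ` E i j"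
    proof (intro Set.set_eqI iffI)
      fix h assume "h \<in> {h \<in> H. p ** h \<in> E i j}"
      then show "h \<in> (\<lambda>h. matrix_inv p ** h) ` E i j"
        using matrix_group_inv_mult[OF H p(1)] by (auto intro!: image_eqI[of _ _ "p ** h"] simp: matrix_mul_assoc)
    next
      fix h assume "h \<in> (\<lambda>h. matrix_inv p ** h) ` E i j"
      then obtain k where k: "k \<in> E i j" "h = matrix_inv p ** k" by auto
      then have "k \<in> H" by (simp add: E_def)
      then show "h \<in> {h \<in> H. p ** h \<in> E i j}" using k p matrix_group_inv_mult[OF H p(1)]
        by (simp add: matrix_mul_assoc matrix_group_mult[OF H] matrix_group_matrix_inv[OF H])
    qed
    show "compact {h \<in> H. p ** h \<in> E i j}" unfolding eq
      by (intro compact_continuous_image E continuous_intros)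
    show "{h \<in> H. p ** h \<in> E i j} \<subseteq> H" by auto
    show "emeasure \<mu> {h \<in> H. p ** h \<in> E i j} \<noteq> 0"
      using Haar_left_translate[OF H \<mu> p(1) Haar_compact_sets[OF H \<mu> E(2,1)]] ij by simp
    fix h assume "h \<in> {h \<in> H. p ** h \<in> E i j}"
    then have "transpose (p ** h) *v \<zeta> \<in> F i" by (auto simp: E_def)
    then show "transpose h *v \<eta> \<in> W" unfolding p(2) transpose_mult_vec using F CT(3) by auto
  qed
qed

text \<open>With \<open>E x = {h \<in> H. transpose h *v x \<in> W}\<close>, integrating the assumption \<open>sep\<close> over \<open>h\<close> shows that
  \<open>E x \<inter> E y\<close> is null for almost every \<open>(x, y) \<in> A \<times> B\<close>. But \<open>E (transpose m *v \<eta>)\<close> is the left translate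
  of \<open>E \<eta>\<close> by the inverse of \<open>m\<close>, so the intersection is not null for \<open>x\<close> and \<open>y\<close> near \<open>\<eta>\<close>.\<close>

lemma locally_separated:
  assumes O: "open (dual_orbit H \<xi>)" and W: "W \<in> sets borel" and A: "A \<in> sets borel" and B: "B \<in> sets borel"
    and pos: "AE \<zeta> in lborel. emeasure \<mu> {h \<in> H. transpose h *v \<zeta> \<in> W} \<noteq> 0"
    and sep: "\<And>h. h \<in> H \<Longrightarrow> {\<zeta> \<in> A. transpose h *v \<zeta> \<in> W} \<in> null_sets lborel \<or>
                            {\<zeta> \<in> B. transpose h *v \<zeta> \<in> W} \<in> null_sets lborel"
    and \<eta>: "\<eta> \<in> dual_orbit H \<xi>"
  obtains U where "open U" "\<eta> \<in> U" "A \<inter> U \<in> null_sets lborel \<or> B \<inter> U \<in> null_sets lborel"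
proof -
  interpret \<mu>: sigma_finite_measure \<mu> by (rule Haar_sigma_finite[OF H \<mu>])
  interpret P: pair_sigma_finite "lborel :: (real^'n) measure" "lborel :: (real^'n) measure" ..
  interpret Q: pair_sigma_finite "lborel \<Otimes>\<^sub>M lborel :: ((real^'n) \<times> (real^'n)) measure" \<mu> ..
  note [measurable] = Haar_measurable_id[OF H \<mu>] W A B
  obtain K where K: "compact K" "K \<subseteq> H" "emeasure \<mu> K \<noteq> 0" "\<And>h. h \<in> K \<Longrightarrow> transpose h *v \<eta> \<in> W"
    using compact_in_orbit_preimage[OF O W pos \<eta>] by blast
  obtain e where e: "e > 0"
    "\<And>m n. m \<in> H \<Longrightarrow> n \<in> H \<Longrightarrow> dist m (mat 1) < e \<Longrightarrow> dist n (mat 1) < e \<Longrightarrow>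
       emeasure \<mu> {h \<in> H. m ** h \<in> K \<and> n ** h \<in> K} \<noteq> 0"
    using Haar_translates_overlap[OF H \<mu> K(1-3)] by blast
  have O': "open (dual_orbit H \<eta>)" using O dual_orbit_eq[OF H \<eta>] by simp
  obtain U where U: "open U" "\<eta> \<in> U"
    "\<And>\<zeta>. \<zeta> \<in> U \<Longrightarrow> \<exists>m\<in>H. dist m (mat 1) < e \<and> transpose m *v \<eta> = \<zeta>"
    using dual_orbit_map_open[OF H O' e(1)] by blast
  have [measurable]: "U \<in> sets borel" using U by auto
  define g :: "real^'n \<Rightarrow> real^'n \<Rightarrow> real^'n^'n \<Rightarrow> ennreal" where
    "g x y h = indicator A x * indicator B y * indicator W (transpose h *v x) * indicator W (transpose h *v y)" for x y h
  have g_meas: "(\<lambda>(p, h). g (fst p) (snd p) h) \<in> borel_measurable ((lborel \<Otimes>\<^sub>M lborel) \<Otimes>\<^sub>M \<mu>)"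
    unfolding g_def split_beta by measurable
  have "(\<integral>\<^sup>+p. (\<integral>\<^sup>+h. g (fst p) (snd p) h \<partial>\<mu>) \<partial>(lborel \<Otimes>\<^sub>M lborel))
      = (\<integral>\<^sup>+h. (\<integral>\<^sup>+p. g (fst p) (snd p) h \<partial>(lborel \<Otimes>\<^sub>M lborel)) \<partial>\<mu>)"
    by (rule Q.Fubini'[symmetric]) (rule g_meas)
  also have "\<dots> = (\<integral>\<^sup>+h. 0 \<partial>\<mu>)"
  proof (rule nn_integral_cong)
    fix h assume "h \<in> space \<mu>"
    then have h: "h \<in> H" by (simp add: Haar_space[OF H \<mu>])
    define A' where "A' = {\<zeta> \<in> A. transpose h *v \<zeta> \<in> W}"
    define B' where "B' = {\<zeta> \<in> B. transpose h *v \<zeta> \<in> W}"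
    have [measurable]: "A' \<in> sets borel" "B' \<in> sets borel" unfolding A'_def B'_def by measurable
    have "(\<integral>\<^sup>+p. g (fst p) (snd p) h \<partial>(lborel \<Otimes>\<^sub>M lborel)) = (\<integral>\<^sup>+p. indicator (A' \<times> B') p \<partial>(lborel \<Otimes>\<^sub>M lborel))"
      by (intro nn_integral_cong) (auto simp: g_def indicator_def A'_def B'_def)
    also have "\<dots> = emeasure lborel A' * emeasure lborel B'"
      by (simp add: lborel.emeasure_pair_measure_Times)
    also have "\<dots> = 0" using sep[OF h] unfolding A'_def B'_def by auto
    finally show "(\<integral>\<^sup>+p. g (fst p) (snd p) h \<partial>(lborel \<Otimes>\<^sub>M lborel)) = 0" .
  qed
  also have "\<dots> = 0" by simp
  finally have "AE p in lborel \<Otimes>\<^sub>M lborel. (\<integral>\<^sup>+h. g (fst p) (snd p) h \<partial>\<mu>) = 0"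
    using \<mu>.borel_measurable_nn_integral[OF g_meas] by (subst (asm) nn_integral_0_iff_AE) simp_all
  then have "AE p in lborel \<Otimes>\<^sub>M lborel. p \<notin> (A \<inter> U) \<times> (B \<inter> U)"
  proof eventually_elim
    fix p assume p: "(\<integral>\<^sup>+h. g (fst p) (snd p) h \<partial>\<mu>) = 0"
    show "p \<notin> (A \<inter> U) \<times> (B \<inter> U)"
    proof
      assume "p \<in> (A \<inter> U) \<times> (B \<inter> U)"
      then obtain x y where xy: "p = (x, y)" "x \<in> A" "x \<in> U" "y \<in> B" "y \<in> U" by auto
      obtain m n where m: "m \<in> H" "dist m (mat 1) < e" "transpose m *v \<eta> = x"
        and n: "n \<in> H" "dist n (mat 1) < e" "transpose n *v \<eta> = y" using U(3) xy by meson
      \<comment> \<open>Every \<open>h\<close> in this set carries both \<open>x\<close> and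
        \<open>y\<close> into \<open>W\<close>, because \<open>m ** h\<close> and
        \<open>n ** h\<close> carry \<open>\<eta>\<close> there. It has positive measure by the
        choice of \<open>e\<close>, so the inner integral at \<open>(x, y)\<close> cannot
        vanish.\<close>
      let ?S = "{h \<in> H. m ** h \<in> K \<and> n ** h \<in> K}"
      have "?S = {h \<in> H. m ** h \<in> K} \<inter> {h \<in> H. n ** h \<in> K}" by auto
      then have S: "?S \<in> sets \<mu>"
        using Haar_left_translate_sets[OF H \<mu> _ Haar_compact_sets[OF H \<mu> K(2,1)]] m n by auto
      have "emeasure \<mu> ?S = (\<integral>\<^sup>+h. indicator ?S h \<partial>\<mu>)" using S by simp
      also have "\<dots> \<le> (\<integral>\<^sup>+h. g x y h \<partial>\<mu>)"
      proof (rule nn_integral_mono)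
        fix h
        have "indicator W (transpose h *v x) = (1::ennreal)" "indicator W (transpose h *v y) = (1::ennreal)" if "h \<in> ?S"
          using that K(4)[of "m ** h"] K(4)[of "n ** h"] m(3) n(3) by (auto simp: transpose_mult_vec simp del: transpose_matrix_vector)
        then show "indicator ?S h \<le> g x y h" using xy by (auto simp: g_def indicator_def simp del: transpose_matrix_vector)
      qed
      finally show False using e(2)[OF m(1) n(1) m(2) n(2)] p xy by simp
    qed
  qed
  moreover have AU: "A \<inter> U \<in> sets lborel" "B \<inter> U \<in> sets lborel" by auto
  ultimately have "emeasure (lborel \<Otimes>\<^sub>M lborel) ((A \<inter> U) \<times> (B \<inter> U)) = 0"
    by (subst (asm) AE_iff_measurable[OF _ refl]) (auto simp: space_pair_measure intro: pair_measureI)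
  \<comment> \<open>A rectangle that is null for the product measure has a null side.\<close>
  then have "emeasure lborel (A \<inter> U) * emeasure lborel (B \<inter> U) = 0"
    using AU by (simp add: lborel.emeasure_pair_measure_Times)
  then show thesis using that[OF U(1,2)] AU by (auto simp: null_sets_def)
qed

end

section \<open>Gaussians and continuity of translations in the mean\<close>

lemma nn_integral_lborel_affine:
  fixes t :: "'a::euclidean_space"
  assumes [measurable]: "f \<in> borel_measurable borel" and c: "c \<noteq> 0"
  shows "(\<integral>\<^sup>+x. f x \<partial>lborel) = ennreal (\<bar>c\<bar> ^ DIM('a)) * (\<integral>\<^sup>+x. f (t + c *\<^sub>R x) \<partial>lborel)"
  by (subst lborel_affine[OF c, of t])
     (simp add: nn_integral_density nn_integral_distr nn_integral_cmult)

lemma nn_integral_lborel_translate: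
  fixes t :: "'a::euclidean_space"
  assumes "f \<in> borel_measurable borel"
  shows "(\<integral>\<^sup>+x. f (x - t) \<partial>lborel) = (\<integral>\<^sup>+x. f x \<partial>lborel)"
  using nn_integral_lborel_affine[OF assms, of 1 "- t"] by simp

text \<open>Reduces Gaussian integrals to one coordinate, Lebesgue measure being the image of a
  product measure.\<close>

lemma lborel_integral_prod_Basis:
  fixes f :: "'a::euclidean_space \<Rightarrow> real \<Rightarrow> complex"
  assumes int: "\<And>b. b \<in> Basis \<Longrightarrow> integrable lborel (f b)"
  shows "integrable lborel (\<lambda>x. \<Prod>b\<in>Basis. f b (x \<bullet> b))"
    and "(LINT x|lborel. (\<Prod>b\<in>Basis. f b (x \<bullet> b))) = (\<Prod>b\<in>Basis. (LINT t|lborel. f b t))"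
proof -
  interpret product_sigma_finite "\<lambda>_::'a. lborel :: real measure" ..
  have [measurable]: "\<And>b. b \<in> Basis \<Longrightarrow> f b \<in> borel_measurable borel"
    using borel_measurable_integrable[OF int] by simp
  have m: "(\<lambda>x. \<Prod>b\<in>Basis. f b (x \<bullet> b)) \<in> borel_measurable borel" by measurable
  have T: "(\<lambda>g. \<Sum>b\<in>Basis. g b *\<^sub>R b) \<in> (\<Pi>\<^sub>M b\<in>Basis. lborel) \<rightarrow>\<^sub>M (borel :: 'a measure)" by measurable
  have eq: "(\<lambda>g. \<Prod>b\<in>Basis. f b ((\<Sum>b\<in>Basis. g b *\<^sub>R b) \<bullet> b)) = (\<lambda>g. \<Prod>b\<in>Basis. f b (g b))"
    by (intro ext prod.cong) (auto simp: inner_sum_left_Basis)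
  show "integrable lborel (\<lambda>x. \<Prod>b\<in>Basis. f b (x \<bullet> b))"
    by (subst lborel_eq, subst integrable_distr_eq[OF T m], subst eq)
      (intro product_integrable_prod int; simp)
  show "(LINT x|lborel. (\<Prod>b\<in>Basis. f b (x \<bullet> b))) = (\<Prod>b\<in>Basis. (LINT t|lborel. f b t))"
    by (subst lborel_eq, subst integral_distr[OF T m], subst eq)
      (intro product_integral_prod int; simp)
qed

section \<open>The Gaussian and its characteristic function\<close>

text \<open>The standard normal density, in product form so that integrals separate by coordinates;
  \<open>gauss_eq\<close> is the radial form.\<close>

definition gauss :: "'a::euclidean_space \<Rightarrow> real" where
  "gauss x = (\<Prod>b\<in>Basis. std_normal_density (x \<bullet> b))"

lemma prod_exp_inner:
  "(\<Prod>b\<in>Basis. exp (- ((x :: 'a::euclidean_space) \<bullet> b)\<^sup>2 / 2)) = exp (- (norm x)\<^sup>2 / 2)"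
proof -
  have "(norm x)\<^sup>2 = (\<Sum>b\<in>Basis. (x \<bullet> b)\<^sup>2)"
    by (subst power2_norm_eq_inner, subst euclidean_inner) (simp add: power2_eq_square)
  then have "- (norm x)\<^sup>2 / 2 = (\<Sum>b\<in>Basis. - (x \<bullet> b)\<^sup>2 / 2)"
    by (simp add: sum_negf sum_divide_distrib)
  then show ?thesis by (simp only: exp_sum[OF finite_Basis])
qed

lemma gauss_eq: "gauss (x :: 'a::euclidean_space) = (1 / sqrt (2 * pi)) ^ DIM('a) * exp (- (norm x)\<^sup>2 / 2)"
  unfolding gauss_def std_normal_density_def prod.distrib prod_constant prod_exp_inner ..

lemma gauss_pos: "gauss x > 0"
  by (simp add: gauss_eq)

lemma borel_measurable_gauss [measurable]: "gauss \<in> borel_measurable borel"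
  unfolding gauss_def by measurable

lemma borel_measurable_cis [measurable]: "cis \<in> borel_measurable borel"
  by (intro borel_measurable_continuous_onI continuous_intros)

lemma borel_measurable_cnj [measurable]: "cnj \<in> borel_measurable borel"
  by (intro borel_measurable_continuous_onI continuous_intros)

text \<open>The characteristic function of the standard normal distribution on the line, multiplied
  over the coordinates.\<close>

lemma integral_gauss_cis:
  fixes t :: "'a::euclidean_space"
  shows "integrable lborel (\<lambda>x. of_real (gauss x) * cis (t \<bullet> x))"
    and "(LINT x|lborel. of_real (gauss x) * cis (t \<bullet> x)) = of_real (exp (- (norm t)\<^sup>2 / 2))"
proof -
  define f where "f b s = of_real (std_normal_density s) * cis ((t \<bullet> b) * s)" for b s
  have int1: "integrable lborel std_normal_density"
    using integrable_std_normal_moment[of 0] by simp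
  have "f b \<in> borel_measurable borel" for b unfolding f_def[abs_def] by measurable
  then have int: "integrable lborel (f b)" for b
    by (intro Bochner_Integration.integrable_bound[OF int1]) (auto simp: f_def norm_mult)
  have If: "(LINT s|lborel. f b s) = of_real (exp (- (t \<bullet> b)\<^sup>2 / 2))" for b
  proof -
    have "char std_normal_distribution (t \<bullet> b) = (LINT s|lborel. std_normal_density s *\<^sub>R iexp ((t \<bullet> b) * s))"
      unfolding char_def by (subst integral_density) auto
    also have "\<dots> = (LINT s|lborel. f b s)" by (simp add: f_def cis_conv_exp scaleR_conv_of_real)
    finally show ?thesis by (simp add: char_std_normal_distribution)
  qed
  have cis_sum: "cis (sum h I) = (\<Prod>b\<in>I. cis (h b))" if "finite I" for h and I :: "'a set"
    using that by (induction I rule: finite_induct) (auto simp: cis_mult[symmetric])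
  have eq: "(\<Prod>b\<in>Basis. f b (x \<bullet> b)) = of_real (gauss x) * cis (t \<bullet> x)" for x
    by (simp add: f_def gauss_def prod.distrib euclidean_inner[of t x] cis_sum)
  show "integrable lborel (\<lambda>x. of_real (gauss x) * cis (t \<bullet> x))"
    using lborel_integral_prod_Basis(1)[of f, OF int] by (simp add: eq)
  have "(LINT x|lborel. of_real (gauss x) * cis (t \<bullet> x)) = (\<Prod>b\<in>Basis. of_real (exp (- (t \<bullet> b)\<^sup>2 / 2)))"
    using lborel_integral_prod_Basis(2)[of f, OF int] by (simp add: eq If)
  also have "\<dots> = of_real (exp (- (norm t)\<^sup>2 / 2))"
    by (simp only: of_real_prod[symmetric] prod_exp_inner)
  finally show "(LINT x|lborel. of_real (gauss x) * cis (t \<bullet> x)) = of_real (exp (- (norm t)\<^sup>2 / 2))" .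
qed

lemma nn_integral_gauss: "(\<integral>\<^sup>+(x::'a::euclidean_space). ennreal (gauss x) \<partial>lborel) = 1"
proof -
  have i: "integrable lborel (\<lambda>x::'a. complex_of_real (gauss x))"
    and e: "(LINT x|lborel. complex_of_real (gauss (x::'a))) = 1"
    using integral_gauss_cis[of "0::'a"] by simp_all
  have "integrable lborel (gauss :: 'a \<Rightarrow> real)" using i by (simp only: complex_of_real_integrable_eq)
  moreover have "(LINT x|lborel. gauss (x :: 'a)) = 1" using e by (simp only: integral_complex_of_real of_real_eq_1_iff)
  ultimately show ?thesis
    by (subst nn_integral_eq_integral) (auto intro: less_imp_le gauss_pos)
qed

section \<open>Continuity of translations in the mean\<close>

text \<open>Points that leave \<open>U\<close> under a short shift lie close to the complement. The
  sets \<open>V n\<close> of such points are open and decrease to the empty set, since every point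
  of an open set has positive distance from the complement; finiteness of the measure makes their
  measures tend to 0.\<close>

lemma translate_continuous_open:
  fixes U :: "'a::euclidean_space set"
  assumes U: "open U" and fin: "emeasure lborel U < \<infinity>" and e: "(0::ennreal) < e"
  obtains d where "d > 0" "\<And>z. norm z < d \<Longrightarrow> emeasure lborel {x \<in> U. x - z \<notin> U} < e"
proof -
  define V where "V n = {x. \<exists>y. y \<notin> U \<and> dist x y < 1 / real (Suc n)} \<inter> U" for n :: nat
  have V_open: "open (V n)" for n
  proof -
    have "{x. \<exists>y. y \<notin> U \<and> dist x y < 1 / real (Suc n)} = (\<Union>y\<in>-U. ball y (1 / real (Suc n)))"
      by (auto simp: dist_commute)
    then show ?thesis unfolding V_def using U by auto
  qed
  have "(\<lambda>n. emeasure lborel (V n)) \<longlonglongrightarrow> emeasure lborel (\<Inter>n. V n)"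
  proof (rule Lim_emeasure_decseq)
    show "range V \<subseteq> sets lborel" using V_open by auto
    show "decseq V"
    proof (rule decseq_SucI)
      fix n
      have "1 / real (Suc (Suc n)) \<le> 1 / real (Suc n)" by (simp add: field_simps)
      then show "V (Suc n) \<subseteq> V n" unfolding V_def by fastforce
    qed
    fix n
    have "emeasure lborel (V n) \<le> emeasure lborel U" using U by (intro emeasure_mono) (auto simp: V_def)
    then show "emeasure lborel (V n) \<noteq> \<infinity>" using fin by auto
  qed
  moreover have "(\<Inter>n. V n) = {}"
  proof (rule ccontr)
    assume "(\<Inter>n. V n) \<noteq> {}"
    then obtain x where x: "\<And>n. x \<in> V n" by auto
    then have "x \<in> U" by (auto simp: V_def)
    then obtain r where r: "r > 0" "ball x r \<subseteq> U" using U open_contains_ball by blast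
    obtain n where n: "inverse (real (Suc n)) < r" using reals_Archimedean r by blast
    show False using x[of n] r n by (force simp: V_def inverse_eq_divide)
  qed
  ultimately have "(\<lambda>n. emeasure lborel (V n)) \<longlonglongrightarrow> 0" by simp
  from order_tendstoD(2)[OF this e] obtain n where n: "emeasure lborel (V n) < e"
    by (auto simp: eventually_sequentially)
  show thesis
  proof
    show "0 < 1 / real (Suc n)" by simp
    fix z :: 'a assume z: "norm z < 1 / real (Suc n)"
    have "{x \<in> U. x - z \<notin> U} \<subseteq> V n" using z by (auto simp: V_def dist_norm intro!: exI[of _ "_ - z"])
    then have "emeasure lborel {x \<in> U. x - z \<notin> U} \<le> emeasure lborel (V n)"
      using V_open by (intro emeasure_mono) auto
    then show "emeasure lborel {x \<in> U. x - z \<notin> U} < e" using n by simp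
  qed
qed

lemma L1_translate_continuous:
  fixes f :: "'a::euclidean_space \<Rightarrow> 'b::{banach, second_countable_topology}"
  assumes "integrable lborel f" and "(0::real) < e"
  shows "\<exists>d>0. \<forall>z. norm z < d \<longrightarrow> (\<integral>\<^sup>+x. ennreal (norm (f x - f (x - z))) \<partial>lborel) < ennreal e"
  using assms
proof (induction arbitrary: e rule: integrable_induct)
  case (base A c)
  then have [measurable]: "A \<in> sets borel" by simp
  \<comment> \<open>Four error terms of size \<open>k\<close> will occur: two from
    \<open>U - A\<close>, two from shifts of \<open>U\<close>. The factor 8 makes their weighted sum
    \<open>e / 2\<close>, and the added 1 keeps the divisor positive for
    \<open>c = 0\<close>.\<close>
  define k where "k = e / (8 * (norm c + 1))"
  have nc: "norm c + 1 > 0" by (simp add: add_nonneg_pos)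
  have "k * (8 * (norm c + 1)) = e" using nc by (simp add: k_def)
  then have "(norm c + 1) * (k + k + k + k) = e / 2" by (simp add: algebra_simps)
  then have k: "k > 0" "(norm c + 1) * (k + k + k + k) < e" using base(3) nc by (auto simp: k_def)
  obtain U where U: "open U" "A \<subseteq> U" "U - A \<in> lmeasurable" "emeasure lebesgue (U - A) < ennreal k"
    using sets_lebesgue_outer_open[of A k] k by auto
  have [measurable]: "U \<in> sets borel" using U by auto
  have UA: "emeasure lborel (U - A) < ennreal k" using U(4) by simp
  have "emeasure lborel U \<le> emeasure lborel (A \<union> (U - A))" using U by (intro emeasure_mono) auto
  also have "\<dots> \<le> emeasure lborel A + emeasure lborel (U - A)" by (intro emeasure_subadditive) auto
  also have "\<dots> < \<infinity>" using base(2) UA by (auto simp: ennreal_add_eq_top less_top[symmetric] top_unique)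
  finally have Ufin: "emeasure lborel U < \<infinity>" .
  obtain d where d: "d > 0" "\<And>z. norm z < d \<Longrightarrow> emeasure lborel {x \<in> U. x - z \<notin> U} < ennreal k"
    using translate_continuous_open[OF U(1) Ufin, of "ennreal k"] k by auto
  show ?case
  proof (intro exI[of _ d] conjI allI impI)
    show "d > 0" by fact
    fix z :: 'a assume z: "norm z < d"
    let ?D1 = "{x \<in> U. x - z \<notin> U}" and ?D2 = "{x \<in> U. x + z \<notin> U}" and ?E = "U - A"
    have [measurable]: "?D1 \<in> sets borel" "?D2 \<in> sets borel" by measurable
    \<comment> \<open>If just one of \<open>x\<close> and \<open>x - z\<close> lies in
      \<open>A\<close>, then either the other one lies in \<open>U - A\<close> or the step between
      them leaves \<open>U\<close>, in one direction or the other.\<close>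
    have pt: "ennreal (norm (indicator A x *\<^sub>R c - indicator A (x - z) *\<^sub>R c))
      \<le> ennreal (norm c) * (indicator ?E x + indicator ?E (x - z) + indicator ?D1 x + indicator ?D2 (x - z))" for x
      using U(2) by (auto simp: indicator_def ennreal_mult[symmetric] ennreal_plus[symmetric] mult_2 simp del: ennreal_plus)
    have "(\<integral>\<^sup>+x. ennreal (norm (indicator A x *\<^sub>R c - indicator A (x - z) *\<^sub>R c)) \<partial>lborel)
      \<le> (\<integral>\<^sup>+x. ennreal (norm c) * (indicator ?E x + indicator ?E (x - z) + indicator ?D1 x + indicator ?D2 (x - z)) \<partial>lborel)"
      by (intro nn_integral_mono pt)
    also have "\<dots> = ennreal (norm c) * ((\<integral>\<^sup>+x. indicator ?E x \<partial>lborel) + (\<integral>\<^sup>+x. indicator ?E (x - z) \<partial>lborel)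
        + (\<integral>\<^sup>+x. indicator ?D1 x \<partial>lborel) + (\<integral>\<^sup>+x. indicator ?D2 (x - z) \<partial>lborel))"
      by (subst nn_integral_cmult, measurable, subst nn_integral_add, measurable,
          subst nn_integral_add, measurable, subst nn_integral_add) auto
    also have "\<dots> = ennreal (norm c) * (emeasure lborel ?E + emeasure lborel ?E + emeasure lborel ?D1 + emeasure lborel ?D2)"
      by (simp add: nn_integral_lborel_translate)
    also have "\<dots> \<le> ennreal (norm c + 1) * (ennreal k + ennreal k + ennreal k + ennreal k)"
      using UA d(2)[OF z] d(2)[of "- z"] z by (intro mult_mono add_mono) (auto intro: less_imp_le)
    also have "\<dots> = ennreal ((norm c + 1) * (k + k + k + k))"
    proof -
      have "ennreal k + ennreal k + ennreal k + ennreal k = ennreal (k + k + k + k)"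
        using k(1) by (simp only: ennreal_plus less_imp_le add_nonneg_nonneg)
      then show ?thesis using k(1) nc by (simp only: ennreal_mult less_imp_le add_nonneg_nonneg)
    qed
    also have "\<dots> < ennreal e"
      using k base(3) by (intro ennreal_lessI) auto
    finally show "(\<integral>\<^sup>+x. ennreal (norm (indicator A x *\<^sub>R c - indicator A (x - z) *\<^sub>R c)) \<partial>lborel) < ennreal e" .
  qed
next
  case (add f g)
  have [measurable]: "f \<in> borel_measurable borel" "g \<in> borel_measurable borel"
    using add.hyps by auto
  have e2: "0 < e / 2" using add.prems by simp
  obtain d1 d2 where d: "d1 > 0" "d2 > 0"
    "\<And>z. norm z < d1 \<Longrightarrow> (\<integral>\<^sup>+x. ennreal (norm (f x - f (x - z))) \<partial>lborel) < ennreal (e / 2)"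
    "\<And>z. norm z < d2 \<Longrightarrow> (\<integral>\<^sup>+x. ennreal (norm (g x - g (x - z))) \<partial>lborel) < ennreal (e / 2)"
    using add.IH(1)[OF e2] add.IH(2)[OF e2] by blast
  show ?case
  proof (intro exI[of _ "min d1 d2"] conjI allI impI)
    show "min d1 d2 > 0" using d by simp
    fix z :: 'a assume z: "norm z < min d1 d2"
    have "norm (f x + g x - (f (x - z) + g (x - z))) \<le> norm (f x - f (x - z)) + norm (g x - g (x - z))" for x
      using norm_triangle_ineq[of "f x - f (x - z)" "g x - g (x - z)"] by (simp add: algebra_simps)
    then have "(\<integral>\<^sup>+x. ennreal (norm (f x + g x - (f (x - z) + g (x - z)))) \<partial>lborel)
      \<le> (\<integral>\<^sup>+x. ennreal (norm (f x - f (x - z))) + ennreal (norm (g x - g (x - z))) \<partial>lborel)"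
      by (intro nn_integral_mono) (simp flip: ennreal_plus)
    also have "\<dots> = (\<integral>\<^sup>+x. ennreal (norm (f x - f (x - z))) \<partial>lborel) + (\<integral>\<^sup>+x. ennreal (norm (g x - g (x - z))) \<partial>lborel)"
      by (intro nn_integral_add) auto
    also have "\<dots> < ennreal (e / 2) + ennreal (e / 2)" using d z by (intro add_strict_mono) auto
    also have "\<dots> = ennreal e" using add.prems by (simp flip: ennreal_plus)
    finally show "(\<integral>\<^sup>+x. ennreal (norm (f x + g x - (f (x - z) + g (x - z)))) \<partial>lborel) < ennreal e" .
  qed
next
  case (lim f s)
  have [measurable]: "f \<in> borel_measurable borel" "\<And>i. s i \<in> borel_measurable borel"
    using lim.hyps by auto
  have e4: "0 < e / 4" using lim.prems by simp
  have "(\<lambda>i. \<integral>\<^sup>+x. ennreal (norm (s i x - f x)) \<partial>lborel) \<longlonglongrightarrow> (\<integral>\<^sup>+(x::'a). 0 \<partial>lborel)"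
  \<comment> \<open>The factor 3 arises because the approximants of \<open>integrable_induct\<close>
    satisfy \<open>norm (s i x) \<le> 2 * norm (f x)\<close>.\<close>
  proof (rule nn_integral_dominated_convergence[where u' = "\<lambda>_. 0" and w = "\<lambda>x. ennreal (3 * norm (f x))"])
    have "integrable lborel (\<lambda>x. 3 * norm (f x))" using lim.hyps by auto
    then show "(\<integral>\<^sup>+x. ennreal (3 * norm (f x)) \<partial>lborel) < \<infinity>"
      by (subst nn_integral_eq_integral) auto
    show "AE x in lborel. ennreal (norm (s i x - f x)) \<le> ennreal (3 * norm (f x))" for i
    proof (intro AE_I2 ennreal_leI)
      fix x
      show "norm (s i x - f x) \<le> 3 * norm (f x)"
        using norm_triangle_ineq4[of "s i x" "f x"] lim.hyps(3)[of x i] by simp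
    qed
    show "AE x in lborel. (\<lambda>i. ennreal (norm (s i x - f x))) \<longlonglongrightarrow> 0"
    proof (intro AE_I2)
      fix x
      have "(\<lambda>i. norm (s i x - f x)) \<longlonglongrightarrow> 0"
        using lim.hyps(2)[of x] by (simp add: LIM_zero tendsto_norm_zero)
      then show "(\<lambda>i. ennreal (norm (s i x - f x))) \<longlonglongrightarrow> 0" by (metis tendsto_ennrealI ennreal_0)
    qed
  qed auto
  then have "(\<lambda>i. \<integral>\<^sup>+x. ennreal (norm (s i x - f x)) \<partial>lborel) \<longlonglongrightarrow> 0" by simp
  from order_tendstoD(2)[OF this, of "ennreal (e / 4)"] e4 obtain i where i: "(\<integral>\<^sup>+x. ennreal (norm (s i x - f x)) \<partial>lborel) < ennreal (e / 4)"
    by (auto simp: eventually_sequentially)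
  obtain d where d: "d > 0" "\<And>z. norm z < d \<Longrightarrow> (\<integral>\<^sup>+x. ennreal (norm (s i x - s i (x - z))) \<partial>lborel) < ennreal (e / 4)"
    using lim.IH[OF e4, of i] by blast
  show ?case
  proof (intro exI[of _ d] conjI allI impI)
    show "d > 0" by fact
    fix z :: 'a assume z: "norm z < d"
    have tri: "norm (f x - f (x - z)) \<le> norm (s i x - f x) + norm (s i x - s i (x - z)) + norm (s i (x - z) - f (x - z))" for x
    proof -
      have "f x - f (x - z) = (s i x - s i (x - z)) - (s i x - f x) + (s i (x - z) - f (x - z))" by simp
      then show ?thesis
        using norm_triangle_ineq[of "(s i x - s i (x - z)) - (s i x - f x)" "s i (x - z) - f (x - z)"]
          norm_triangle_ineq4[of "s i x - s i (x - z)" "s i x - f x"] by simp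
    qed
    have "(\<integral>\<^sup>+x. ennreal (norm (f x - f (x - z))) \<partial>lborel)
       \<le> (\<integral>\<^sup>+x. ennreal (norm (s i x - f x)) + ennreal (norm (s i x - s i (x - z))) + ennreal (norm (s i (x - z) - f (x - z))) \<partial>lborel)"
      using tri by (intro nn_integral_mono) (simp flip: ennreal_plus)
    also have "\<dots> = (\<integral>\<^sup>+x. ennreal (norm (s i x - f x)) \<partial>lborel) + (\<integral>\<^sup>+x. ennreal (norm (s i x - s i (x - z))) \<partial>lborel)
       + (\<integral>\<^sup>+x. ennreal (norm (s i (x - z) - f (x - z))) \<partial>lborel)"
      by (subst nn_integral_add, measurable, subst nn_integral_add) auto
    also have "(\<integral>\<^sup>+x. ennreal (norm (s i (x - z) - f (x - z))) \<partial>lborel) = (\<integral>\<^sup>+x. ennreal (norm (s i x - f x)) \<partial>lborel)"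
      by (rule nn_integral_lborel_translate[where f = "\<lambda>x. ennreal (norm (s i x - f x))"]) simp
    also have "(\<integral>\<^sup>+x. ennreal (norm (s i x - f x)) \<partial>lborel) + (\<integral>\<^sup>+x. ennreal (norm (s i x - s i (x - z))) \<partial>lborel)
       + (\<integral>\<^sup>+x. ennreal (norm (s i x - f x)) \<partial>lborel) < ennreal (e / 4) + ennreal (e / 4) + ennreal (e / 4)"
      using i d(2)[OF z] by (intro add_strict_mono) auto
    also have "\<dots> \<le> ennreal e" using e4 by (simp add: ennreal_leI flip: ennreal_plus)
    finally show "(\<integral>\<^sup>+x. ennreal (norm (f x - f (x - z))) \<partial>lborel) < ennreal e" .
  qed
qed

lemma power2_norm_sum3:
  fixes a b c :: "'a::real_normed_vector"
  shows "(norm (a + b + c))\<^sup>2 \<le> 3 * ((norm a)\<^sup>2 + (norm b)\<^sup>2 + (norm c)\<^sup>2)"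
proof -
  have "norm (a + b + c) \<le> norm a + norm b + norm c"
    using norm_triangle_ineq[of "a + b" c] norm_triangle_ineq[of a b] by linarith
  then have "(norm (a + b + c))\<^sup>2 \<le> (norm a + norm b + norm c)\<^sup>2" by (intro power_mono) auto
  also have "\<dots> \<le> 3 * ((norm a)\<^sup>2 + (norm b)\<^sup>2 + (norm c)\<^sup>2)"
    using sum_squares_ge_zero[of "norm a - norm b" "norm b - norm c"] zero_le_square[of "norm a - norm c"]
    by (simp add: power2_eq_square algebra_simps)
  finally show ?thesis .
qed

text \<open>Cutting off values above a height \<open>n\<close> changes \<open>f\<close> little in
  mean square. For the bounded remainder the squared increments are at most \<open>2 * n\<close>
  times the increments, which \<open>L1_translate_continuous\<close> controls.\<close>

lemma L2_translate_continuous: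
  fixes f :: "'a::euclidean_space \<Rightarrow> 'b::{banach, second_countable_topology}"
  assumes f: "integrable lborel f" and f2: "integrable lborel (\<lambda>x. (norm (f x))\<^sup>2)" and e: "(0::real) < e"
  shows "\<exists>d>0. \<forall>z. norm z < d \<longrightarrow> (\<integral>\<^sup>+x. ennreal ((norm (f x - f (x - z)))\<^sup>2) \<partial>lborel) < ennreal e"
proof -
  have [measurable]: "f \<in> borel_measurable borel" using f by auto
  define h where "h n x = (if norm (f x) \<le> real n then f x else 0)" for n :: nat and x
  have [measurable]: "h n \<in> borel_measurable borel" for n unfolding h_def by measurable
  have "(\<lambda>n. \<integral>\<^sup>+x. ennreal ((norm (f x - h n x))\<^sup>2) \<partial>lborel) \<longlonglongrightarrow> (\<integral>\<^sup>+(x::'a). 0 \<partial>lborel)"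
  proof (rule nn_integral_dominated_convergence[where u' = "\<lambda>_. 0" and w = "\<lambda>x. ennreal ((norm (f x))\<^sup>2)"])
    show "(\<integral>\<^sup>+x. ennreal ((norm (f x))\<^sup>2) \<partial>lborel) < \<infinity>"
      by (subst nn_integral_eq_integral[OF f2]) auto
    show "AE x in lborel. ennreal ((norm (f x - h n x))\<^sup>2) \<le> ennreal ((norm (f x))\<^sup>2)" for n
      by (intro AE_I2 ennreal_leI) (auto simp: h_def)
    show "AE x in lborel. (\<lambda>n. ennreal ((norm (f x - h n x))\<^sup>2)) \<longlonglongrightarrow> 0"
    proof (intro AE_I2 tendsto_eventually)
      fix x
      obtain N :: nat where "norm (f x) \<le> real N" using real_arch_simple by blast
      then have "ennreal ((norm (f x - h n x))\<^sup>2) = 0" if "n \<ge> N" for n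
        using that by (auto simp: h_def)
      then show "\<forall>\<^sub>F n in sequentially. ennreal ((norm (f x - h n x))\<^sup>2) = 0"
        unfolding eventually_sequentially by blast
    qed
  qed auto
  then have "(\<lambda>n. \<integral>\<^sup>+x. ennreal ((norm (f x - h n x))\<^sup>2) \<partial>lborel) \<longlonglongrightarrow> 0" by simp
  from order_tendstoD(2)[OF this, of "ennreal (e / 12)"] e
  obtain n where n: "(\<integral>\<^sup>+x. ennreal ((norm (f x - h n x))\<^sup>2) \<partial>lborel) < ennreal (e / 12)"
    by (auto simp: eventually_sequentially)
  define g where "g = h n"
  have [measurable]: "g \<in> borel_measurable borel" by (simp add: g_def)
  have gi: "integrable lborel g"
    by (rule Bochner_Integration.integrable_bound[OF f]) (auto simp: g_def h_def)
  have gb: "norm (g x) \<le> real n" for x by (simp add: g_def h_def)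
  \<comment> \<open>The summand 1 keeps the divisor positive for \<open>n = 0\<close>. Since
    \<open>2 * real n * e'\<close> is then at most \<open>e / 12\<close>, each of the three terms
    below is at most \<open>3 * (e / 12)\<close>, which leaves room below \<open>e\<close>.\<close>
  define M where "M = 2 * real n + 1"
  have M: "M > 0" by (simp add: M_def)
  define e' where "e' = e / 12 / M"
  have e': "e' > 0" using e M by (simp add: e'_def)
  obtain d where d: "d > 0" "\<And>z. norm z < d \<Longrightarrow> (\<integral>\<^sup>+x. ennreal (norm (g x - g (x - z))) \<partial>lborel) < ennreal e'"
    using L1_translate_continuous[OF gi e'] by blast
  show ?thesis
  proof (intro exI[of _ d] conjI allI impI)
    show "d > 0" by fact
    fix z :: 'a assume z: "norm z < d"
    have pt: "ennreal ((norm (f x - f (x - z)))\<^sup>2) \<le> 3 * ennreal ((norm (f x - g x))\<^sup>2)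
        + ennreal (6 * real n) * ennreal (norm (g x - g (x - z))) + 3 * ennreal ((norm (f (x - z) - g (x - z)))\<^sup>2)" for x
    proof -
      have "norm (g x - g (x - z)) \<le> 2 * real n"
        using norm_triangle_ineq4[of "g x" "g (x - z)"] gb[of x] gb[of "x - z"] by linarith
      then have "(norm (g x - g (x - z)))\<^sup>2 \<le> 2 * real n * norm (g x - g (x - z))"
        unfolding power2_eq_square by (intro mult_right_mono) auto
      moreover have "(norm (f x - f (x - z)))\<^sup>2
          \<le> 3 * ((norm (f x - g x))\<^sup>2 + (norm (g x - g (x - z)))\<^sup>2 + (norm (f (x - z) - g (x - z)))\<^sup>2)"
        using power2_norm_sum3[of "f x - g x" "g x - g (x - z)" "g (x - z) - f (x - z)"]
        by (simp add: norm_minus_commute)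
      ultimately have "(norm (f x - f (x - z)))\<^sup>2 \<le> 3 * (norm (f x - g x))\<^sup>2
        + (6 * real n) * norm (g x - g (x - z)) + 3 * (norm (f (x - z) - g (x - z)))\<^sup>2" by simp
      then have "ennreal ((norm (f x - f (x - z)))\<^sup>2) \<le> ennreal (3 * (norm (f x - g x))\<^sup>2
        + (6 * real n) * norm (g x - g (x - z)) + 3 * (norm (f (x - z) - g (x - z)))\<^sup>2)" by (rule ennreal_leI)
      then show ?thesis by (simp add: ennreal_mult)
    qed
    have "(\<integral>\<^sup>+x. ennreal ((norm (f x - f (x - z)))\<^sup>2) \<partial>lborel)
      \<le> (\<integral>\<^sup>+x. 3 * ennreal ((norm (f x - g x))\<^sup>2)
        + ennreal (6 * real n) * ennreal (norm (g x - g (x - z))) + 3 * ennreal ((norm (f (x - z) - g (x - z)))\<^sup>2) \<partial>lborel)"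
      by (intro nn_integral_mono pt)
    also have "\<dots> = 3 * (\<integral>\<^sup>+x. ennreal ((norm (f x - g x))\<^sup>2) \<partial>lborel)
        + ennreal (6 * real n) * (\<integral>\<^sup>+x. ennreal (norm (g x - g (x - z))) \<partial>lborel)
        + 3 * (\<integral>\<^sup>+x. ennreal ((norm (f (x - z) - g (x - z)))\<^sup>2) \<partial>lborel)"
      by (subst nn_integral_add, measurable, subst nn_integral_add) (auto simp: nn_integral_cmult)
    also have "(\<integral>\<^sup>+x. ennreal ((norm (f (x - z) - g (x - z)))\<^sup>2) \<partial>lborel) = (\<integral>\<^sup>+x. ennreal ((norm (f x - g x))\<^sup>2) \<partial>lborel)"
      by (rule nn_integral_lborel_translate[where f = "\<lambda>x. ennreal ((norm (f x - g x))\<^sup>2)"]) simp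
    also have "3 * (\<integral>\<^sup>+x. ennreal ((norm (f x - g x))\<^sup>2) \<partial>lborel)
        + ennreal (6 * real n) * (\<integral>\<^sup>+x. ennreal (norm (g x - g (x - z))) \<partial>lborel)
        + 3 * (\<integral>\<^sup>+x. ennreal ((norm (f x - g x))\<^sup>2) \<partial>lborel)
       \<le> 3 * ennreal (e / 12) + ennreal (6 * real n) * ennreal e' + 3 * ennreal (e / 12)"
      using n d(2)[OF z] by (intro add_mono mult_left_mono) (auto simp: g_def intro: less_imp_le)
    also have "\<dots> = ennreal (3 * (e / 12) + (6 * real n) * e' + 3 * (e / 12))"
    proof -
      have 3: "3 * ennreal (e / 12) = ennreal (3 * (e / 12))" using ennreal_mult'[of 3 "e / 12"] by simp
      have "ennreal (6 * real n) * ennreal e' = ennreal (6 * real n * e')" by (rule ennreal_mult'[symmetric]) simp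
      then show ?thesis unfolding 3 using e e' by (subst ennreal_plus; (subst ennreal_plus)?; simp)
    qed
    also have "\<dots> < ennreal e"
    proof (rule ennreal_lessI)
      have "2 * real n * e' \<le> M * e'" using e' by (simp add: M_def)
      also have "\<dots> = e / 12" using M by (simp add: e'_def)
      finally show "3 * (e / 12) + (6 * real n) * e' + 3 * (e / 12) < e" using e by simp
    qed (use e in simp)
    finally show "(\<integral>\<^sup>+x. ennreal ((norm (f x - f (x - z)))\<^sup>2) \<partial>lborel) < ennreal e" .
  qed
qed

section \<open>Gaussian kernels of small width and their transforms\<close>

lemma lebesgue_integral_lborel_affine:
  fixes f :: "'a::euclidean_space \<Rightarrow> 'b::{banach, second_countable_topology}"
  assumes [measurable]: "f \<in> borel_measurable borel" and c: "c \<noteq> 0"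
  shows "(LINT x|lborel. f x) = (\<bar>c\<bar> ^ DIM('a)) *\<^sub>R (LINT x|lborel. f (t + c *\<^sub>R x))"
  by (subst lborel_affine[OF c, of t]) (simp add: integral_density integral_distr)

lemma integrable_lborel_affine:
  fixes f :: "'a::euclidean_space \<Rightarrow> 'b::{banach, second_countable_topology}"
  assumes f: "integrable lborel f" and c: "c \<noteq> 0"
  shows "integrable lborel (\<lambda>x. f (t + c *\<^sub>R x))"
proof -
  have [measurable]: "f \<in> borel_measurable borel" using f by auto
  have "integrable lborel (\<lambda>x. (\<bar>c\<bar> ^ DIM('a)) *\<^sub>R f (t + c *\<^sub>R x))"
    using f by (subst (asm) lborel_affine[OF c, of t]) (simp add: integrable_density integrable_distr_eq)
  from integrable_scaleR_right[OF this, of "inverse (\<bar>c\<bar> ^ DIM('a))"] show ?thesis using c by simp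
qed

text \<open>The centred normal density with standard deviation \<open>\<delta>\<close> in each
  coordinate: an approximate identity as \<open>\<delta>\<close> tends to 0.\<close>

definition gauss_kernel :: "real \<Rightarrow> 'a::euclidean_space \<Rightarrow> real" where
  "gauss_kernel \<delta> z = (1 / \<delta>) ^ DIM('a) * gauss ((1 / \<delta>) *\<^sub>R z)"

lemma borel_measurable_gauss_kernel [measurable]: "gauss_kernel \<delta> \<in> borel_measurable borel"
  unfolding gauss_kernel_def[abs_def] by measurable

lemma gauss_kernel_pos: "\<delta> > 0 \<Longrightarrow> gauss_kernel \<delta> z > 0"
  by (simp add: gauss_kernel_def gauss_pos)

lemma nn_integral_gauss_kernel:
  fixes t :: "'a::euclidean_space"
  assumes [measurable]: "g \<in> borel_measurable borel" and \<delta>: "\<delta> > 0"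
  shows "(\<integral>\<^sup>+y. g y * ennreal (gauss_kernel \<delta> (t - y)) \<partial>lborel)
    = (\<integral>\<^sup>+w. g (t - \<delta> *\<^sub>R w) * ennreal (gauss w) \<partial>lborel)"
proof -
  have "(\<integral>\<^sup>+y. g y * ennreal (gauss_kernel \<delta> (t - y)) \<partial>lborel)
      = ennreal (\<bar>- \<delta>\<bar> ^ DIM('a)) * (\<integral>\<^sup>+w. g (t + (- \<delta>) *\<^sub>R w) * ennreal (gauss_kernel \<delta> (t - (t + (- \<delta>) *\<^sub>R w))) \<partial>lborel)"
    using \<delta> by (intro nn_integral_lborel_affine) auto
  also have "\<dots> = (\<integral>\<^sup>+w. ennreal (\<delta> ^ DIM('a)) * (g (t - \<delta> *\<^sub>R w) * ennreal (gauss_kernel \<delta> (\<delta> *\<^sub>R w))) \<partial>lborel)"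
    using \<delta> by (subst nn_integral_cmult) auto
  also have "\<dots> = (\<integral>\<^sup>+w. g (t - \<delta> *\<^sub>R w) * ennreal (gauss w) \<partial>lborel)"
  proof (intro nn_integral_cong)
    fix w :: 'a
    have "\<delta> ^ DIM('a) * gauss_kernel \<delta> (\<delta> *\<^sub>R w) = gauss w"
      using \<delta> by (simp add: gauss_kernel_def power_one_over)
    then have "ennreal (\<delta> ^ DIM('a)) * ennreal (gauss_kernel \<delta> (\<delta> *\<^sub>R w)) = ennreal (gauss w)"
      using \<delta> by (simp add: ennreal_mult'[symmetric])
    then show "ennreal (\<delta> ^ DIM('a)) * (g (t - \<delta> *\<^sub>R w) * ennreal (gauss_kernel \<delta> (\<delta> *\<^sub>R w))) = g (t - \<delta> *\<^sub>R w) * ennreal (gauss w)"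
      unfolding mult.left_commute[of "ennreal (\<delta> ^ DIM('a))"] by simp
  qed
  finally show ?thesis .
qed

lemma gauss_kernel_fourier:
  fixes z :: "'a::euclidean_space"
  assumes \<delta>: "\<delta> > 0"
  defines "E \<equiv> \<lambda>\<xi>::'a. exp (- (norm ((2 * pi * \<delta>) *\<^sub>R \<xi>))\<^sup>2 / 2)"
  shows "integrable lborel E"
    and "(LINT \<xi>|lborel. of_real (E \<xi>) * cis (- 2 * pi * (z \<bullet> \<xi>))) = complex_of_real (gauss_kernel \<delta> z)"
proof -
  \<comment> \<open>The normalizing constant of \<open>gauss_eq\<close>. It occurs once in
    \<open>gauss (a *\<^sub>R \<xi>)\<close> and once in the kernel; together they cancel the factor
    \<open>(2 * pi) ^ DIM('a)\<close> left by the substitution.\<close>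
  define c where "c = (1 / sqrt (2 * pi)) ^ DIM('a)"
  have "(1 / sqrt (2 * pi)) * (1 / sqrt (2 * pi)) * (2 * pi) = 1" by simp
  then have "((1 / sqrt (2 * pi)) * (1 / sqrt (2 * pi)) * (2 * pi)) ^ DIM('a) = 1" by (simp only: power_one)
  then have c: "c > 0" "c * c * (2 * pi) ^ DIM('a) = 1"
    by (simp_all only: c_def power_mult_distrib) simp
  define a where "a = 2 * pi * \<delta>"
  have a: "a \<noteq> 0" "\<bar>a\<bar> = a" using \<delta> by (auto simp: a_def)
  \<comment> \<open>Chosen so that after the substitution by \<open>a\<close> the phase of
    \<open>integral_gauss_cis\<close> becomes the Fourier phase at \<open>z\<close>.\<close>
  define t where "t = - (1 / \<delta>) *\<^sub>R z"
  have ga: "gauss (a *\<^sub>R \<xi>) = c * E \<xi>" for \<xi> by (simp add: gauss_eq c_def E_def a_def)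
  have ta: "t \<bullet> (a *\<^sub>R \<xi>) = - 2 * pi * (z \<bullet> \<xi>)" for \<xi> using \<delta> by (simp add: t_def a_def)
  have "integrable lborel (\<lambda>x::'a. complex_of_real (gauss x))" using integral_gauss_cis(1)[of "0::'a"] by simp
  from integrable_lborel_affine[OF this a(1), of 0]
  have "integrable lborel (\<lambda>\<xi>. complex_of_real (c * E \<xi>))" by (simp only: add_0 ga)
  then have "integrable lborel (\<lambda>\<xi>. c * E \<xi>)" by (simp only: complex_of_real_integrable_eq)
  then show "integrable lborel E" using c by simp
  have "of_real (exp (- (norm t)\<^sup>2 / 2)) = (LINT x|lborel. of_real (gauss x) * cis (t \<bullet> x))"
    by (rule integral_gauss_cis(2)[symmetric])
  also have "\<dots> = (\<bar>a\<bar> ^ DIM('a)) *\<^sub>R (LINT \<xi>|lborel. of_real (gauss (0 + a *\<^sub>R \<xi>)) * cis (t \<bullet> (0 + a *\<^sub>R \<xi>)))"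
    by (rule lebesgue_integral_lborel_affine[OF _ a(1)]) simp
  also have "\<dots> = (a ^ DIM('a)) *\<^sub>R (LINT \<xi>|lborel. of_real c * (of_real (E \<xi>) * cis (- 2 * pi * (z \<bullet> \<xi>))))"
    by (simp only: add_0 ga ta a(2) of_real_mult mult.assoc)
  also have "\<dots> = of_real (a ^ DIM('a) * c) * (LINT \<xi>|lborel. of_real (E \<xi>) * cis (- 2 * pi * (z \<bullet> \<xi>)))"
    by (simp add: scaleR_conv_of_real)
  finally have eq: "of_real (exp (- (norm t)\<^sup>2 / 2))
    = of_real (a ^ DIM('a) * c) * (LINT \<xi>|lborel. of_real (E \<xi>) * cis (- 2 * pi * (z \<bullet> \<xi>)))" .
  have k: "gauss_kernel \<delta> z * (a ^ DIM('a) * c) = exp (- (norm t)\<^sup>2 / 2)"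
  proof -
    have "gauss_kernel \<delta> z = (1 / \<delta>) ^ DIM('a) * c * exp (- (norm t)\<^sup>2 / 2)"
      by (simp add: gauss_kernel_def gauss_eq c_def t_def)
    moreover have "(1 / \<delta>) ^ DIM('a) * a ^ DIM('a) = (2 * pi) ^ DIM('a)"
    proof -
      have "(1 / \<delta>) * a = 2 * pi" using \<delta> by (simp add: a_def)
      then show ?thesis by (simp only: power_mult_distrib[symmetric])
    qed
    moreover have "gauss_kernel \<delta> z * (a ^ DIM('a) * c)
        = ((1 / \<delta>) ^ DIM('a) * a ^ DIM('a)) * (c * c) * exp (- (norm t)\<^sup>2 / 2)"
      unfolding calculation(1) by (simp only: mult_ac)
    ultimately have "gauss_kernel \<delta> z * (a ^ DIM('a) * c) = (c * c * (2 * pi) ^ DIM('a)) * exp (- (norm t)\<^sup>2 / 2)"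
      by (simp only: mult_ac)
    then show ?thesis unfolding c(2) by (simp only: mult_1)
  qed
  have nz: "complex_of_real (a ^ DIM('a) * c) \<noteq> 0" using a(1) c(1) by simp
  have "of_real (a ^ DIM('a) * c) * (LINT \<xi>|lborel. of_real (E \<xi>) * cis (- 2 * pi * (z \<bullet> \<xi>)))
      = of_real (a ^ DIM('a) * c) * complex_of_real (gauss_kernel \<delta> z)"
    unfolding eq[symmetric] k[symmetric] by simp
  then show "(LINT \<xi>|lborel. of_real (E \<xi>) * cis (- 2 * pi * (z \<bullet> \<xi>))) = complex_of_real (gauss_kernel \<delta> z)"
    by (rule mult_left_cancel[OF nz, THEN iffD1])
qed

lemma (in pair_sigma_finite) integrable_mult_fst_snd:
  fixes f :: "'a \<Rightarrow> complex" and g :: "'b \<Rightarrow> complex"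
  assumes f: "integrable M1 f" and g: "integrable M2 g"
  shows "integrable (M1 \<Otimes>\<^sub>M M2) (\<lambda>p. f (fst p) * g (snd p))"
    and "(LINT p|(M1 \<Otimes>\<^sub>M M2). f (fst p) * g (snd p)) = (LINT x|M1. f x) * (LINT y|M2. g y)"
proof -
  have [measurable]: "f \<in> borel_measurable M1" "g \<in> borel_measurable M2" using f g by auto
  show i: "integrable (M1 \<Otimes>\<^sub>M M2) (\<lambda>p. f (fst p) * g (snd p))"
    by (rule Fubini_integrable) (use f g in \<open>auto simp: norm_mult\<close>)
  have "(LINT p|(M1 \<Otimes>\<^sub>M M2). f (fst p) * g (snd p)) = (LINT x|M1. (LINT y|M2. f x * g y))"
    using integral_fst'[OF i] by simp
  then show "(LINT p|(M1 \<Otimes>\<^sub>M M2). f (fst p) * g (snd p)) = (LINT x|M1. f x) * (LINT y|M2. g y)" by simp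
qed

section \<open>The Plancherel theorem\<close>

lemma borel_measurable_fourier_L1 [measurable]:
  fixes f :: "real^'n \<Rightarrow> complex"
  assumes [measurable]: "f \<in> borel_measurable borel"
  shows "fourier_L1 f \<in> borel_measurable borel"
  unfolding fourier_L1_def[abs_def] by measurable

lemma fourier_L1_integrable:
  fixes f :: "real^'n \<Rightarrow> complex"
  assumes f: "integrable lborel f"
  shows "integrable lborel (\<lambda>x. f x * cis (- 2 * pi * (x \<bullet> \<xi>)))"
proof -
  have [measurable]: "f \<in> borel_measurable borel" using f by auto
  show ?thesis by (rule Bochner_Integration.integrable_bound[OF f]) (auto simp: norm_mult)
qed

text \<open>The identity \<open>2 Re (f x * cnj (f y)) = \<bar>f x\<bar>\<^sup>2 + \<bar>f y\<bar>\<^sup>2 - \<bar>f x - f y\<bar>\<^sup>2\<close> turns the Gaussian mean of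
  the squared transform into the norm of \<open>f\<close> minus a nonnegative remainder \<open>J / 2\<close>.\<close>

lemma gaussian_regularization:
  fixes f :: "real^'n \<Rightarrow> complex"
  assumes f: "integrable lborel f" and f2: "integrable lborel (\<lambda>x. (cmod (f x))\<^sup>2)" and \<delta>: "\<delta> > 0"
  defines "E \<equiv> \<lambda>\<xi>::real^'n. exp (- (norm ((2 * pi * \<delta>) *\<^sub>R \<xi>))\<^sup>2 / 2)"
  obtains J where "J \<ge> 0"
    "ennreal J = (\<integral>\<^sup>+w. (\<integral>\<^sup>+x. ennreal ((cmod (f x - f (x - \<delta> *\<^sub>R w)))\<^sup>2) \<partial>lborel) * ennreal (gauss w) \<partial>lborel)"
    "(\<integral>\<^sup>+\<xi>. ennreal (E \<xi> * (cmod (fourier_L1 f \<xi>))\<^sup>2) \<partial>lborel)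
      = ennreal ((LINT x|lborel. (cmod (f x))\<^sup>2) - J / 2)"
proof -
  let ?M = "lborel \<Otimes>\<^sub>M lborel :: ((real^'n) \<times> (real^'n)) measure"
  interpret Q: pair_sigma_finite ?M "lborel :: (real^'n) measure" ..
  have [measurable]: "f \<in> borel_measurable borel" using f by auto
  define N where "N = (LINT x|lborel. (cmod (f x))\<^sup>2)"
  have N: "(\<integral>\<^sup>+x. ennreal ((cmod (f x))\<^sup>2) \<partial>lborel) = ennreal N"
    unfolding N_def by (rule nn_integral_eq_integral[OF f2]) simp
  define k where "k p = gauss_kernel \<delta> (fst p - snd p)" for p :: "(real^'n) \<times> (real^'n)"
  have [measurable]: "k \<in> borel_measurable ?M" unfolding k_def[abs_def] by measurable
  have k_pos: "k p \<ge> 0" for p unfolding k_def by (rule less_imp_le[OF gauss_kernel_pos[OF \<delta>]])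
  define F where "F p = f (fst p) * cnj (f (snd p))" for p :: "(real^'n) \<times> (real^'n)"
  have [measurable]: "F \<in> borel_measurable ?M" unfolding F_def[abs_def] by measurable
  have Fi: "integrable ?M F"
    unfolding F_def[abs_def] by (rule lborel_pair.integrable_mult_fst_snd) (use f in auto)
  have Ei: "integrable lborel E" unfolding E_def by (rule gauss_kernel_fourier(1)[OF \<delta>])
  have [measurable]: "E \<in> borel_measurable borel" using Ei by auto
  have E_pos: "E \<xi> \<ge> 0" for \<xi> by (simp add: E_def)
  \<comment> \<open>Integrating this function over the frequency \<open>snd q\<close> produces the
    Gaussian kernel, integrating it over the pair \<open>fst q\<close> produces the squared
    transform. Fubini equates the two iterated integrals.\<close>
  define G where "G q = F (fst q) * of_real (E (snd q)) * cis (- 2 * pi * ((fst (fst q) - snd (fst q)) \<bullet> snd q))"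
    for q :: "((real^'n) \<times> (real^'n)) \<times> (real^'n)"
  have Gi: "integrable (?M \<Otimes>\<^sub>M lborel) G"
  proof -
    have "integrable (?M \<Otimes>\<^sub>M lborel) (\<lambda>q. F (fst q) * of_real (E (snd q)))"
      by (rule Q.integrable_mult_fst_snd[OF Fi]) (simp add: Ei)
    then show ?thesis
      by (rule Bochner_Integration.integrable_bound) (auto simp: G_def[abs_def] norm_mult)
  qed
  have inner1: "(LINT \<xi>|lborel. G (p, \<xi>)) = F p * of_real (k p)" for p
  proof -
    have "(LINT \<xi>|lborel. G (p, \<xi>)) = F p * (LINT \<xi>|lborel. of_real (E \<xi>) * cis (- 2 * pi * ((fst p - snd p) \<bullet> \<xi>)))"
      by (simp add: G_def mult.assoc)
    also have "\<dots> = F p * of_real (k p)"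
      unfolding E_def k_def gauss_kernel_fourier(2)[OF \<delta>] ..
    finally show ?thesis .
  qed
  have inner2: "(LINT p|?M. G (p, \<xi>)) = of_real (E \<xi> * (cmod (fourier_L1 f \<xi>))\<^sup>2)" for \<xi>
  proof -
    let ?a = "\<lambda>x. f x * cis (- 2 * pi * (x \<bullet> \<xi>))"
    have cisd: "cis (- 2 * pi * ((x - y) \<bullet> \<xi>)) = cis (- 2 * pi * (x \<bullet> \<xi>)) * cnj (cis (- 2 * pi * (y \<bullet> \<xi>)))" for x y
      by (simp add: cis_cnj cis_mult inner_diff_left algebra_simps)
    have "(LINT p|?M. G (p, \<xi>)) = (LINT p|?M. of_real (E \<xi>) * (?a (fst p) * cnj (?a (snd p))))"
      unfolding G_def F_def fst_conv snd_conv cisd complex_cnj_mult by (simp only: mult_ac)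
    also have "\<dots> = of_real (E \<xi>) * (LINT p|?M. ?a (fst p) * cnj (?a (snd p)))" by simp
    also have "(LINT p|?M. ?a (fst p) * cnj (?a (snd p))) = (LINT x|lborel. ?a x) * (LINT x|lborel. cnj (?a x))"
      by (intro lborel_pair.integrable_mult_fst_snd(2) integrable_cnj fourier_L1_integrable f)
    also have "\<dots> = fourier_L1 f \<xi> * cnj (fourier_L1 f \<xi>)"
      unfolding fourier_L1_def by (subst Bochner_Integration.integral_cnj) simp
    also have "\<dots> = of_real ((cmod (fourier_L1 f \<xi>))\<^sup>2)" by (simp only: complex_norm_square)
    finally show ?thesis by simp
  qed
  have Gi': "integrable (?M \<Otimes>\<^sub>M lborel) (\<lambda>(p, \<xi>). G (p, \<xi>))" using Gi by simp
  have "integrable lborel (\<lambda>\<xi>. complex_of_real (E \<xi> * (cmod (fourier_L1 f \<xi>))\<^sup>2))"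
    using Q.integrable_snd[OF Gi'] by (simp only: inner2)
  then have ihat: "integrable lborel (\<lambda>\<xi>. E \<xi> * (cmod (fourier_L1 f \<xi>))\<^sup>2)"
    by (simp only: complex_of_real_integrable_eq)
  have Fk: "integrable ?M (\<lambda>p. F p * of_real (k p))"
    using Q.integrable_fst'[OF Gi] by (simp only: inner1)
  have eqC: "of_real (LINT \<xi>|lborel. E \<xi> * (cmod (fourier_L1 f \<xi>))\<^sup>2) = (LINT p|?M. F p * of_real (k p))"
  proof -
    have "(LINT \<xi>|lborel. (LINT p|?M. G (p, \<xi>))) = (LINT p|?M. (LINT \<xi>|lborel. G (p, \<xi>)))"
      by (rule Q.Fubini_integral[OF Gi'])
    then show ?thesis by (simp only: inner1 inner2 integral_complex_of_real)
  qed
  have ReFk: "integrable ?M (\<lambda>p. Re (F p) * k p)" using integrable_Re[OF Fk] by simp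
  have eqR: "(LINT \<xi>|lborel. E \<xi> * (cmod (fourier_L1 f \<xi>))\<^sup>2) = (LINT p|?M. Re (F p) * k p)"
    using arg_cong[OF eqC, of Re] integral_Re[OF Fk] by simp
  have nn1: "(\<integral>\<^sup>+p. ennreal ((cmod (f (fst p)))\<^sup>2 * k p) \<partial>?M) = ennreal N"
  proof -
    have "(\<integral>\<^sup>+p. ennreal ((cmod (f (fst p)))\<^sup>2 * k p) \<partial>?M)
        = (\<integral>\<^sup>+x. (\<integral>\<^sup>+y. ennreal ((cmod (f x))\<^sup>2 * k (x, y)) \<partial>lborel) \<partial>lborel)"
      by (subst lborel.nn_integral_fst[symmetric]) auto
    also have "\<dots> = (\<integral>\<^sup>+x. (\<integral>\<^sup>+y. ennreal ((cmod (f x))\<^sup>2) * ennreal (gauss_kernel \<delta> (x - y)) \<partial>lborel) \<partial>lborel)"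
      by (intro nn_integral_cong) (simp add: k_def ennreal_mult')
    also have "\<dots> = (\<integral>\<^sup>+x. ennreal ((cmod (f x))\<^sup>2) \<partial>lborel)"
      by (subst nn_integral_gauss_kernel[OF _ \<delta>]) (auto simp: nn_integral_cmult nn_integral_gauss)
    finally show ?thesis by (simp add: N)
  qed
  have nn2: "(\<integral>\<^sup>+p. ennreal ((cmod (f (snd p)))\<^sup>2 * k p) \<partial>?M) = ennreal N"
  proof -
    have k_sym: "k (x, y) = k (y, x)" for x y
    proof -
      have "norm ((1 / \<delta>) *\<^sub>R (x - y)) = norm ((1 / \<delta>) *\<^sub>R (y - x))" by (simp add: norm_minus_commute)
      then show ?thesis by (simp add: k_def gauss_kernel_def gauss_eq)
    qed
    have "(\<integral>\<^sup>+p. ennreal ((cmod (f (snd p)))\<^sup>2 * k p) \<partial>?M)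
        = (\<integral>\<^sup>+y. (\<integral>\<^sup>+x. ennreal ((cmod (f y))\<^sup>2 * k (x, y)) \<partial>lborel) \<partial>lborel)"
      by (subst lborel_pair.nn_integral_snd[symmetric]) (auto simp: split_beta')
    also have "\<dots> = (\<integral>\<^sup>+y. (\<integral>\<^sup>+x. ennreal ((cmod (f y))\<^sup>2) * ennreal (gauss_kernel \<delta> (y - x)) \<partial>lborel) \<partial>lborel)"
      unfolding k_sym by (intro nn_integral_cong) (simp add: k_def ennreal_mult')
    also have "\<dots> = (\<integral>\<^sup>+x. ennreal ((cmod (f x))\<^sup>2) \<partial>lborel)"
      by (subst nn_integral_gauss_kernel[OF _ \<delta>]) (auto simp: nn_integral_cmult nn_integral_gauss)
    finally show ?thesis by (simp add: N)
  qed
  have i1: "integrable ?M (\<lambda>p. (cmod (f (fst p)))\<^sup>2 * k p)" and l1: "(LINT p|?M. (cmod (f (fst p)))\<^sup>2 * k p) = N"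
   and i2: "integrable ?M (\<lambda>p. (cmod (f (snd p)))\<^sup>2 * k p)" and l2: "(LINT p|?M. (cmod (f (snd p)))\<^sup>2 * k p) = N"
  proof -
    have N0: "N \<ge> 0" by (simp add: N_def)
    show "integrable ?M (\<lambda>p. (cmod (f (fst p)))\<^sup>2 * k p)" "integrable ?M (\<lambda>p. (cmod (f (snd p)))\<^sup>2 * k p)"
      using k_pos nn1 nn2 by (auto intro!: integrableI_nonneg)
    show "(LINT p|?M. (cmod (f (fst p)))\<^sup>2 * k p) = N" "(LINT p|?M. (cmod (f (snd p)))\<^sup>2 * k p) = N"
      using k_pos nn1 nn2 N0 by (auto simp: integral_eq_nn_integral)
  qed
  define D where "D p = (cmod (f (fst p) - f (snd p)))\<^sup>2 * k p" for p
  have D: "D p = (cmod (f (fst p)))\<^sup>2 * k p + (cmod (f (snd p)))\<^sup>2 * k p - 2 * (Re (F p) * k p)" for p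
  proof -
    have *: "(cmod (a - b))\<^sup>2 = (cmod a)\<^sup>2 + (cmod b)\<^sup>2 - 2 * Re (a * cnj b)" for a b
      unfolding cmod_power2 by (simp add: power2_eq_square algebra_simps)
    show ?thesis unfolding D_def F_def * by (simp only: left_diff_distrib distrib_right mult.assoc)
  qed
  have Di: "integrable ?M D"
    unfolding D by (intro Bochner_Integration.integrable_diff Bochner_Integration.integrable_add i1 i2 integrable_mult_right ReFk)
  have DI: "(LINT p|?M. D p) = 2 * N - 2 * (LINT p|?M. Re (F p) * k p)"
    unfolding D using i1 i2 ReFk l1 l2 by (simp add: Bochner_Integration.integral_diff Bochner_Integration.integral_add)
  show thesis
  proof
    show "(LINT p|?M. D p) \<ge> 0" unfolding D_def by (intro Bochner_Integration.integral_nonneg) (simp add: k_pos)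
    have "ennreal (LINT p|?M. D p) = (\<integral>\<^sup>+p. ennreal (D p) \<partial>?M)"
      by (rule nn_integral_eq_integral[symmetric, OF Di]) (simp add: D_def k_pos)
    also have "\<dots> = (\<integral>\<^sup>+x. (\<integral>\<^sup>+y. ennreal (D (x, y)) \<partial>lborel) \<partial>lborel)"
      using Di by (subst lborel.nn_integral_fst[symmetric]) auto
    also have "\<dots> = (\<integral>\<^sup>+x. (\<integral>\<^sup>+y. ennreal ((cmod (f x - f y))\<^sup>2) * ennreal (gauss_kernel \<delta> (x - y)) \<partial>lborel) \<partial>lborel)"
      by (intro nn_integral_cong) (simp add: D_def k_def ennreal_mult')
    also have "\<dots> = (\<integral>\<^sup>+x. (\<integral>\<^sup>+w. ennreal ((cmod (f x - f (x - \<delta> *\<^sub>R w)))\<^sup>2) * ennreal (gauss w) \<partial>lborel) \<partial>lborel)"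
      by (subst nn_integral_gauss_kernel[OF _ \<delta>]) auto
    also have "\<dots> = (\<integral>\<^sup>+w. (\<integral>\<^sup>+x. ennreal ((cmod (f x - f (x - \<delta> *\<^sub>R w)))\<^sup>2) * ennreal (gauss w) \<partial>lborel) \<partial>lborel)"
      by (rule lborel_pair.Fubini') measurable
    also have "\<dots> = (\<integral>\<^sup>+w. (\<integral>\<^sup>+x. ennreal ((cmod (f x - f (x - \<delta> *\<^sub>R w)))\<^sup>2) \<partial>lborel) * ennreal (gauss w) \<partial>lborel)"
      by (intro nn_integral_cong nn_integral_multc) measurable
    finally show "ennreal (LINT p|?M. D p) = (\<integral>\<^sup>+w. (\<integral>\<^sup>+x. ennreal ((cmod (f x - f (x - \<delta> *\<^sub>R w)))\<^sup>2) \<partial>lborel) * ennreal (gauss w) \<partial>lborel)" .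
    have "(\<integral>\<^sup>+\<xi>. ennreal (E \<xi> * (cmod (fourier_L1 f \<xi>))\<^sup>2) \<partial>lborel) = ennreal (LINT \<xi>|lborel. E \<xi> * (cmod (fourier_L1 f \<xi>))\<^sup>2)"
      by (rule nn_integral_eq_integral[OF ihat]) (simp add: E_pos)
    then show "(\<integral>\<^sup>+\<xi>. ennreal (E \<xi> * (cmod (fourier_L1 f \<xi>))\<^sup>2) \<partial>lborel)
      = ennreal ((LINT x|lborel. (cmod (f x))\<^sup>2) - (LINT p|?M. D p) / 2)"
      unfolding eqR DI N_def[symmetric] by (simp add: diff_divide_distrib)
  qed
qed

text \<open>\<open>\<delta>\<close> tends to 0 in \<open>gaussian_regularization\<close>. The
  weights increase to 1, so the left side converges monotonically; the remainder \<open>J\<close>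
  tends to 0 by continuity of translations in mean square, dominated by \<open>4 * N\<close> times
  the Gaussian.\<close>

lemma plancherel_L1:
  fixes f :: "real^'n \<Rightarrow> complex"
  assumes f: "integrable lborel f" and f2: "integrable lborel (\<lambda>x. (cmod (f x))\<^sup>2)"
  shows "(\<integral>\<^sup>+\<xi>. ennreal ((cmod (fourier_L1 f \<xi>))\<^sup>2) \<partial>lborel) = (\<integral>\<^sup>+x. ennreal ((cmod (f x))\<^sup>2) \<partial>lborel)"
proof -
  have [measurable]: "f \<in> borel_measurable borel" using f by auto
  define N where "N = (LINT x|lborel. (cmod (f x))\<^sup>2)"
  have N: "(\<integral>\<^sup>+x. ennreal ((cmod (f x))\<^sup>2) \<partial>lborel) = ennreal N" "N \<ge> 0"
    unfolding N_def by (rule nn_integral_eq_integral[OF f2]) simp_all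
  define \<delta> where "\<delta> m = 1 / real (Suc m)" for m
  have \<delta>: "\<delta> m > 0" for m by (simp add: \<delta>_def)
  define E where "E m \<xi> = exp (- (norm ((2 * pi * \<delta> m) *\<^sub>R \<xi>))\<^sup>2 / 2)" for m and \<xi> :: "real^'n"
  define D where "D z = (\<integral>\<^sup>+x. ennreal ((cmod (f x - f (x - z)))\<^sup>2) \<partial>lborel)" for z
  have "\<forall>m. \<exists>J\<ge>0. ennreal J = (\<integral>\<^sup>+w. D (\<delta> m *\<^sub>R w) * ennreal (gauss w) \<partial>lborel) \<and>
    (\<integral>\<^sup>+\<xi>. ennreal (E m \<xi> * (cmod (fourier_L1 f \<xi>))\<^sup>2) \<partial>lborel) = ennreal (N - J / 2)"
  proof
    fix m
    show "\<exists>J\<ge>0. ennreal J = (\<integral>\<^sup>+w. D (\<delta> m *\<^sub>R w) * ennreal (gauss w) \<partial>lborel) \<and>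
      (\<integral>\<^sup>+\<xi>. ennreal (E m \<xi> * (cmod (fourier_L1 f \<xi>))\<^sup>2) \<partial>lborel) = ennreal (N - J / 2)"
      using gaussian_regularization[OF f f2 \<delta>[of m]] unfolding D_def E_def N_def by blast
  qed
  from choice[OF this] obtain J where J: "\<And>m. J m \<ge> 0"
    "\<And>m. ennreal (J m) = (\<integral>\<^sup>+w. D (\<delta> m *\<^sub>R w) * ennreal (gauss w) \<partial>lborel)"
    "\<And>m. (\<integral>\<^sup>+\<xi>. ennreal (E m \<xi> * (cmod (fourier_L1 f \<xi>))\<^sup>2) \<partial>lborel) = ennreal (N - J m / 2)" by blast
  have [measurable]: "D \<in> borel_measurable borel" unfolding D_def[abs_def] by measurable
  have D_le: "D z \<le> ennreal (4 * N)" for z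
  proof -
    have "(cmod (a - b))\<^sup>2 \<le> 2 * (cmod a)\<^sup>2 + 2 * (cmod b)\<^sup>2" for a b
    proof -
      have "(cmod (a - b))\<^sup>2 \<le> (cmod a + cmod b)\<^sup>2" by (intro power_mono norm_triangle_ineq4) simp
      also have "\<dots> \<le> 2 * (cmod a)\<^sup>2 + 2 * (cmod b)\<^sup>2"
        using zero_le_power2[of "cmod a - cmod b"] by (simp add: power2_eq_square algebra_simps)
      finally show ?thesis .
    qed
    then have "D z \<le> (\<integral>\<^sup>+x. ennreal (2 * (cmod (f x))\<^sup>2 + 2 * (cmod (f (x - z)))\<^sup>2) \<partial>lborel)"
      unfolding D_def by (intro nn_integral_mono ennreal_leI)
    also have "\<dots> = (\<integral>\<^sup>+x. 2 * ennreal ((cmod (f x))\<^sup>2) + 2 * ennreal ((cmod (f (x - z)))\<^sup>2) \<partial>lborel)"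
      by (intro nn_integral_cong) (simp add: ennreal_mult)
    also have "\<dots> = 2 * ennreal N + 2 * (\<integral>\<^sup>+x. ennreal ((cmod (f (x - z)))\<^sup>2) \<partial>lborel)"
      by (subst nn_integral_add) (auto simp: nn_integral_cmult N)
    also have "(\<integral>\<^sup>+x. ennreal ((cmod (f (x - z)))\<^sup>2) \<partial>lborel) = ennreal N"
      unfolding N(1)[symmetric] by (rule nn_integral_lborel_translate[where f = "\<lambda>x. ennreal ((cmod (f x))\<^sup>2)"]) simp
    also have "2 * ennreal N + 2 * ennreal N = ennreal (2 * N + 2 * N)"
      using N(2) ennreal_mult'[of 2 N] by (subst ennreal_plus) simp_all
    also have "2 * N + 2 * N = 4 * N" by simp
    finally show ?thesis .
  qed
  have \<delta>0: "\<delta> \<longlonglongrightarrow> 0" unfolding \<delta>_def[abs_def] using LIMSEQ_inverse_real_of_nat by (simp add: inverse_eq_divide)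
  have Dlim: "(\<lambda>m. D (\<delta> m *\<^sub>R w)) \<longlonglongrightarrow> 0" for w
  proof (rule order_tendstoI)
    fix a :: ennreal assume "0 < a"
    then obtain b where b: "0 < b" "b < a" using dense by blast
    then obtain e where "b = ennreal e" "e \<ge> 0" by (cases b) auto
    with b have e: "e > 0" "ennreal e < a" by (cases "e = 0", auto)
    obtain d where d: "d > 0" "\<And>z. norm z < d \<Longrightarrow> D z < ennreal e"
      using L2_translate_continuous[OF f f2 e(1)] unfolding D_def by blast
    have "(\<lambda>m. \<delta> m *\<^sub>R w) \<longlonglongrightarrow> 0" using tendsto_scaleR[OF \<delta>0 tendsto_const, of w] by simp
    then have "\<forall>\<^sub>F m in sequentially. norm (\<delta> m *\<^sub>R w) < d"
      using d(1) by (auto dest: tendstoD simp: dist_norm)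
    then show "\<forall>\<^sub>F m in sequentially. D (\<delta> m *\<^sub>R w) < a"
      by (rule eventually_mono) (use e(2) d(2) less_trans in blast)
  qed simp
  have "(\<lambda>m. ennreal (J m)) \<longlonglongrightarrow> (\<integral>\<^sup>+(w::real^'n). 0 \<partial>lborel)"
    unfolding J(2)
  proof (rule nn_integral_dominated_convergence[where u' = "\<lambda>_. 0" and w = "\<lambda>w. ennreal (4 * N) * ennreal (gauss w)"])
    show "(\<integral>\<^sup>+w. ennreal (4 * N) * ennreal (gauss (w :: real^'n)) \<partial>lborel) < \<infinity>"
      by (subst nn_integral_cmult) (auto simp: nn_integral_gauss)
    show "AE w in lborel. D (\<delta> m *\<^sub>R w) * ennreal (gauss w) \<le> ennreal (4 * N) * ennreal (gauss w)" for m
      by (intro AE_I2 mult_right_mono D_le) simp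
    show "AE w in lborel. (\<lambda>m. D (\<delta> m *\<^sub>R w) * ennreal (gauss w)) \<longlonglongrightarrow> 0"
    proof (intro AE_I2)
      fix w :: "real^'n"
      show "(\<lambda>m. D (\<delta> m *\<^sub>R w) * ennreal (gauss w)) \<longlonglongrightarrow> 0"
        using ennreal_tendsto_cmult[OF _ Dlim, of "ennreal (gauss w)" w] by (simp add: mult.commute)
    qed
  qed measurable
  then have "(\<lambda>m. ennreal (J m)) \<longlonglongrightarrow> ennreal 0" by simp
  then have "J \<longlonglongrightarrow> 0" using J(1) by (subst (asm) tendsto_ennreal_iff) auto
  then have "(\<lambda>m. N - J m / 2) \<longlonglongrightarrow> N - 0 / 2" by (intro tendsto_intros) auto
  then have lim1: "(\<lambda>m. ennreal (N - J m / 2)) \<longlonglongrightarrow> ennreal N" by (intro tendsto_ennrealI) simp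
  have "(\<lambda>m. \<integral>\<^sup>+\<xi>. ennreal (E m \<xi> * (cmod (fourier_L1 f \<xi>))\<^sup>2) \<partial>lborel) \<longlonglongrightarrow> (\<integral>\<^sup>+\<xi>. ennreal ((cmod (fourier_L1 f \<xi>))\<^sup>2) \<partial>lborel)"
  proof (rule nn_integral_LIMSEQ)
    have E_mono: "E m \<xi> \<le> E m' \<xi>" if "m \<le> m'" for m m' \<xi>
    proof -
      have "\<delta> m' \<le> \<delta> m" using that by (simp add: \<delta>_def field_simps)
      then have "norm ((2 * pi * \<delta> m') *\<^sub>R \<xi>) \<le> norm ((2 * pi * \<delta> m) *\<^sub>R \<xi>)"
        using \<delta>[of m] \<delta>[of m'] by (auto intro!: mult_right_mono)
      then have "(norm ((2 * pi * \<delta> m') *\<^sub>R \<xi>))\<^sup>2 \<le> (norm ((2 * pi * \<delta> m) *\<^sub>R \<xi>))\<^sup>2" by (intro power_mono) auto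
      then show ?thesis by (simp add: E_def)
    qed
    show "incseq (\<lambda>m \<xi>. ennreal (E m \<xi> * (cmod (fourier_L1 f \<xi>))\<^sup>2))"
      unfolding incseq_def le_fun_def by (auto intro!: ennreal_leI mult_right_mono E_mono)
    show "(\<lambda>\<xi>. ennreal (E m \<xi> * (cmod (fourier_L1 f \<xi>))\<^sup>2)) \<in> borel_measurable lborel" for m
      unfolding E_def by measurable
    fix \<xi> :: "real^'n"
    have "(\<lambda>m. E m \<xi> * (cmod (fourier_L1 f \<xi>))\<^sup>2) \<longlonglongrightarrow> exp (- (norm ((2 * pi * 0) *\<^sub>R \<xi>))\<^sup>2 / 2) * (cmod (fourier_L1 f \<xi>))\<^sup>2"
      unfolding E_def by (intro tendsto_intros \<delta>0) simp
    then show "(\<lambda>m. ennreal (E m \<xi> * (cmod (fourier_L1 f \<xi>))\<^sup>2)) \<longlonglongrightarrow> ennreal ((cmod (fourier_L1 f \<xi>))\<^sup>2)"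
      by (intro tendsto_ennrealI) simp
  qed
  then show ?thesis using LIMSEQ_unique lim1 unfolding J(3) N(1) by blast
qed

section \<open>Convergence and completeness in mean square\<close>

text \<open>The squared distance, so that its triangle inequality carries factors 2. Values in
  \<open>ennreal\<close> give a difference that is not square-integrable the distance
  \<open>\<infinity>\<close>.\<close>

definition L2dist :: "(real^'n \<Rightarrow> complex) \<Rightarrow> (real^'n \<Rightarrow> complex) \<Rightarrow> ennreal" where
  "L2dist f g = (\<integral>\<^sup>+x. ennreal ((cmod (f x - g x))\<^sup>2) \<partial>lborel)"

lemma is_fourier_L2_iff:
  "is_fourier_L2 f F \<longleftrightarrow> square_integrable F \<and>
     (\<lambda>n. L2dist F (fourier_L1 (\<lambda>x. indicator (ball 0 (real n)) x * f x))) \<longlonglongrightarrow> 0"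
  by (simp add: is_fourier_L2_def L2dist_def)

lemma power2_cmod_add_le: "(cmod (a + b))\<^sup>2 \<le> 2 * (cmod a)\<^sup>2 + 2 * (cmod b)\<^sup>2"
proof -
  have "(cmod (a + b))\<^sup>2 \<le> (cmod a + cmod b)\<^sup>2" by (intro power_mono norm_triangle_ineq) simp
  also have "\<dots> \<le> 2 * (cmod a)\<^sup>2 + 2 * (cmod b)\<^sup>2"
    using zero_le_power2[of "cmod a - cmod b"] by (simp add: power2_eq_square algebra_simps)
  finally show ?thesis .
qed

lemma L2dist_sym: "L2dist f g = L2dist g f"
  by (simp add: L2dist_def norm_minus_commute)

lemma L2dist_triangle:
  assumes [measurable]: "f \<in> borel_measurable borel" "g \<in> borel_measurable borel" "h \<in> borel_measurable borel"
  shows "L2dist f h \<le> 2 * L2dist f g + 2 * L2dist g h"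
proof -
  have "L2dist f h \<le> (\<integral>\<^sup>+x. 2 * ennreal ((cmod (f x - g x))\<^sup>2) + 2 * ennreal ((cmod (g x - h x))\<^sup>2) \<partial>lborel)"
    unfolding L2dist_def
  proof (rule nn_integral_mono)
    fix x
    have "(cmod (f x - h x))\<^sup>2 \<le> 2 * (cmod (f x - g x))\<^sup>2 + 2 * (cmod (g x - h x))\<^sup>2"
      using power2_cmod_add_le[of "f x - g x" "g x - h x"] by simp
    then have "ennreal ((cmod (f x - h x))\<^sup>2) \<le> ennreal (2 * (cmod (f x - g x))\<^sup>2 + 2 * (cmod (g x - h x))\<^sup>2)"
      by (rule ennreal_leI)
    then show "ennreal ((cmod (f x - h x))\<^sup>2) \<le> 2 * ennreal ((cmod (f x - g x))\<^sup>2) + 2 * ennreal ((cmod (g x - h x))\<^sup>2)"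
      by (simp add: ennreal_mult)
  qed
  also have "\<dots> = 2 * L2dist f g + 2 * L2dist g h"
    unfolding L2dist_def by (subst nn_integral_add) (auto simp: nn_integral_cmult)
  finally show ?thesis .
qed

lemma square_integrable_iff:
  "square_integrable (f :: real^'n \<Rightarrow> complex) \<longleftrightarrow> f \<in> borel_measurable borel \<and> L2dist f (\<lambda>_. 0) < \<infinity>"
  unfolding square_integrable_def L2dist_def
  by (auto simp: integrable_iff_bounded)

lemma square_integrable_measurable [measurable_dest]:
  "square_integrable f \<Longrightarrow> f \<in> borel_measurable borel"
  by (simp add: square_integrable_def)

lemma square_integrable_close:
  assumes g: "square_integrable g" and f: "f \<in> borel_measurable borel" and fin: "L2dist f g < \<infinity>"
  shows "square_integrable f"
proof -
  have "L2dist f (\<lambda>_. 0) \<le> 2 * L2dist f g + 2 * L2dist g (\<lambda>_. 0)"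
    using g f by (intro L2dist_triangle) auto
  also have "\<dots> < \<infinity>" using fin g by (simp add: square_integrable_iff ennreal_mult_less_top)
  finally show ?thesis using f by (simp add: square_integrable_iff)
qed

lemma square_integrable_add:
  fixes f g :: "real^'n \<Rightarrow> complex"
  assumes f: "square_integrable f" and g: "square_integrable g"
  shows "square_integrable (\<lambda>x. f x + c * g x)"
proof -
  have [measurable]: "f \<in> borel_measurable borel" "g \<in> borel_measurable borel" using f g by auto
  have "integrable lborel (\<lambda>x. 2 * (cmod (f x))\<^sup>2 + 2 * ((cmod c)\<^sup>2 * (cmod (g x))\<^sup>2))"
    using f g by (auto simp: square_integrable_def)
  then have "integrable lborel (\<lambda>x. (cmod (f x + c * g x))\<^sup>2)"
  proof (rule Bochner_Integration.integrable_bound)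
    show "AE x in lborel. norm ((cmod (f x + c * g x))\<^sup>2) \<le> norm (2 * (cmod (f x))\<^sup>2 + 2 * ((cmod c)\<^sup>2 * (cmod (g x))\<^sup>2))"
      using power2_cmod_add_le[of "f _" "c * g _"] by (auto simp: norm_mult power_mult_distrib)
  qed measurable
  then show ?thesis by (simp add: square_integrable_def)
qed

lemma square_integrable_inner:
  fixes f g :: "real^'n \<Rightarrow> complex"
  assumes f: "square_integrable f" and g: "square_integrable g"
  shows "integrable lborel (\<lambda>x. f x * cnj (g x))"
proof -
  have [measurable]: "f \<in> borel_measurable borel" "g \<in> borel_measurable borel" using f g by auto
  have "integrable lborel (\<lambda>x. (cmod (f x))\<^sup>2 + (cmod (g x))\<^sup>2)"
    using f g by (auto simp: square_integrable_def)
  then show ?thesis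
  proof (rule Bochner_Integration.integrable_bound)
    have "a * b \<le> a\<^sup>2 + b\<^sup>2" if "a \<ge> 0" "b \<ge> 0" for a b :: real
    proof -
      have "2 * (a * b) \<le> a\<^sup>2 + b\<^sup>2" using zero_le_power2[of "a - b"] by (simp add: power2_eq_square algebra_simps)
      moreover have "0 \<le> a * b" using that by simp
      ultimately show ?thesis by linarith
    qed
    then show "AE x in lborel. norm (f x * cnj (g x)) \<le> norm ((cmod (f x))\<^sup>2 + (cmod (g x))\<^sup>2)"
      by (auto simp: norm_mult)
  qed measurable
qed

text \<open>Riesz--Fischer: a rapidly converging subsequence converges almost everywhere, and
  Fatou's lemma carries the Cauchy estimate over to its limit.\<close>

lemma L2_complete:
  fixes F :: "nat \<Rightarrow> real^'n \<Rightarrow> complex"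
  assumes [measurable]: "\<And>n. F n \<in> borel_measurable borel"
    and cauchy: "\<And>e. e > 0 \<Longrightarrow> \<exists>N. \<forall>m\<ge>N. \<forall>n\<ge>N. L2dist (F m) (F n) < ennreal e"
  obtains G where "G \<in> borel_measurable borel" "(\<lambda>n. L2dist G (F n)) \<longlonglongrightarrow> 0"
proof -
  have "\<forall>k. \<exists>N. \<forall>m\<ge>N. \<forall>n\<ge>N. L2dist (F m) (F n) < ennreal ((1/8) ^ k)" using cauchy by simp
  from choice[OF this] obtain N where N: "\<And>k m n. m \<ge> N k \<Longrightarrow> n \<ge> N k \<Longrightarrow> L2dist (F m) (F n) < ennreal ((1/8) ^ k)"
    by blast
  \<comment> \<open>The running maximum makes \<open>r\<close> nondecreasing while
    \<open>r k\<close> stays beyond \<open>N k\<close>.\<close>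
  define r where "r k = Max (N ` {..k}) + k" for k
  have rN: "r k \<ge> N k" for k unfolding r_def by (intro trans_le_add1 Max_ge) auto
  have r_mono: "r k \<le> r (Suc k)" for k unfolding r_def by (intro add_mono Max_mono) auto
  have r_ge: "r k \<ge> k" for k by (simp add: r_def)
  have mono: "j \<le> k \<Longrightarrow> r j \<le> r k" for j k using r_mono by (rule lift_Suc_mono_le)
  define d where "d k x = cmod (F (r (Suc k)) x - F (r k) x)" for k x
  have [measurable]: "d k \<in> borel_measurable borel" for k unfolding d_def by measurable
  \<comment> \<open>The weights \<open>4 ^ k\<close> still leave the summable bound
    \<open>(1/2) ^ k\<close> against the distances \<open>(1/8) ^ k\<close>. Pointwise, a finite
    weighted sum forces \<open>d k x\<close> to decay like \<open>(1/2) ^ k\<close>, so the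
    increments of the subsequence are summable.\<close>
  have "(\<integral>\<^sup>+x. (\<Sum>k. ennreal (4 ^ k * (d k x)\<^sup>2)) \<partial>lborel) = (\<Sum>k. \<integral>\<^sup>+x. ennreal (4 ^ k * (d k x)\<^sup>2) \<partial>lborel)"
    by (rule nn_integral_suminf) measurable
  also have "\<dots> \<le> (\<Sum>k. ennreal ((1/2) ^ k))"
  proof (rule suminf_le)
    fix k
    have "(\<integral>\<^sup>+x. ennreal (4 ^ k * (d k x)\<^sup>2) \<partial>lborel) = ennreal (4 ^ k) * L2dist (F (r (Suc k))) (F (r k))"
      unfolding L2dist_def d_def by (subst nn_integral_cmult[symmetric]) (auto simp: ennreal_mult')
    also have "\<dots> \<le> ennreal (4 ^ k) * ennreal ((1/8) ^ k)"
      using N[of k "r (Suc k)" "r k"] rN[of k] r_mono[of k] by (intro mult_left_mono) auto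
    also have "\<dots> = ennreal (4 ^ k * (1/8) ^ k)" by (rule ennreal_mult'[symmetric]) simp
    also have "4 ^ k * (1/8) ^ k = (4 * (1/8) :: real) ^ k" by (rule power_mult_distrib[symmetric])
    finally show "(\<integral>\<^sup>+x. ennreal (4 ^ k * (d k x)\<^sup>2) \<partial>lborel) \<le> ennreal ((1/2) ^ k)" by simp
  qed auto
  also have "\<dots> = ennreal (\<Sum>k. (1/2) ^ k)" by (rule suminf_ennreal2) auto
  also have "\<dots> < \<infinity>" by simp
  finally have "AE x in lborel. (\<Sum>k. ennreal (4 ^ k * (d k x)\<^sup>2)) \<noteq> \<infinity>"
    by (intro nn_integral_noteq_infinite) auto
  then have conv: "AE x in lborel. convergent (\<lambda>k. F (r k) x)"
  proof eventually_elim
    fix x assume fin: "(\<Sum>k. ennreal (4 ^ k * (d k x)\<^sup>2)) \<noteq> \<infinity>"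
    define S where "S = (\<Sum>k. ennreal (4 ^ k * (d k x)\<^sup>2))"
    have "S \<noteq> \<infinity>" using fin by (simp only: S_def not_False_eq_True)
    then obtain C where C: "S = ennreal C" "C \<ge> 0" by (cases S) auto
    have dle: "d k x \<le> sqrt C * (1/2) ^ k" for k
    proof -
      have "sum (\<lambda>k. ennreal (4 ^ k * (d k x)\<^sup>2)) {k} \<le> S"
        unfolding S_def by (rule sum_le_suminf) auto
      then have "ennreal (4 ^ k * (d k x)\<^sup>2) \<le> ennreal C" using C by simp
      then have "4 ^ k * (d k x)\<^sup>2 \<le> C" using C by simp
      moreover have "4 ^ k * (d k x)\<^sup>2 = (2 ^ k * d k x)\<^sup>2"
      proof -
        have "(4::real) ^ k = (2 * 2) ^ k" by simp
        also have "\<dots> = 2 ^ k * 2 ^ k" by (rule power_mult_distrib)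
        finally show ?thesis by (simp only: power2_eq_square mult_ac)
      qed
      ultimately have "2 ^ k * d k x \<le> sqrt C" by (simp add: real_le_rsqrt)
      then show ?thesis by (simp add: power_one_over field_simps)
    qed
    have "summable (\<lambda>k. d k x)"
      by (rule summable_comparison_test'[where g = "\<lambda>k. sqrt C * (1/2) ^ k" and N = 0])
        (use dle in \<open>auto simp: d_def intro!: summable_mult summable_geometric\<close>)
    then have "summable (\<lambda>k. F (r (Suc k)) x - F (r k) x)" unfolding d_def by (rule summable_norm_cancel)
    then have "convergent (\<lambda>n. \<Sum>k<n. F (r (Suc k)) x - F (r k) x)" by (simp add: summable_iff_convergent)
    then have "convergent (\<lambda>n. F (r n) x - F (r 0) x)" by (simp only: sum_lessThan_telescope[of "\<lambda>n. F (r n) x"])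
    then have "convergent (\<lambda>n. (F (r n) x - F (r 0) x) + F (r 0) x)"
      by (intro convergent_add convergent_const)
    then show "convergent (\<lambda>k. F (r k) x)" by simp
  qed
  define G where "G x = lim (\<lambda>k. F (r k) x)" for x
  have [measurable]: "G \<in> borel_measurable borel"
    unfolding G_def[abs_def] by measurable
  have lim: "AE x in lborel. (\<lambda>k. F (r k) x) \<longlonglongrightarrow> G x"
    using conv by eventually_elim (simp add: G_def convergent_LIMSEQ_iff)
  have close: "L2dist G (F n) \<le> ennreal ((1/8) ^ k)" if n: "n \<ge> N k" for n k
  proof -
    have "L2dist G (F n) = (\<integral>\<^sup>+x. liminf (\<lambda>j. ennreal ((cmod (F (r j) x - F n x))\<^sup>2)) \<partial>lborel)"
      unfolding L2dist_def
    proof (rule nn_integral_cong_AE)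
      show "AE x in lborel. ennreal ((cmod (G x - F n x))\<^sup>2) = liminf (\<lambda>j. ennreal ((cmod (F (r j) x - F n x))\<^sup>2))"
        using lim
      proof eventually_elim
        fix x assume "(\<lambda>k. F (r k) x) \<longlonglongrightarrow> G x"
        then have "(\<lambda>j. ennreal ((cmod (F (r j) x - F n x))\<^sup>2)) \<longlonglongrightarrow> ennreal ((cmod (G x - F n x))\<^sup>2)"
          by (intro tendsto_intros)
        then show "ennreal ((cmod (G x - F n x))\<^sup>2) = liminf (\<lambda>j. ennreal ((cmod (F (r j) x - F n x))\<^sup>2))"
          by (intro lim_imp_Liminf[symmetric]) simp_all
      qed
    qed
    also have "\<dots> \<le> liminf (\<lambda>j. L2dist (F (r j)) (F n))"
      unfolding L2dist_def by (rule nn_integral_liminf) measurable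
    also have "\<dots> \<le> liminf (\<lambda>j. ennreal ((1/8) ^ k))"
    proof (rule Liminf_mono)
      show "\<forall>\<^sub>F j in sequentially. L2dist (F (r j)) (F n) \<le> ennreal ((1/8) ^ k)"
        unfolding eventually_sequentially
      proof (intro exI[of _ k] allI impI)
        fix j assume "k \<le> j"
        then have "r j \<ge> N k" using mono[of k j] rN[of k] by linarith
        then show "L2dist (F (r j)) (F n) \<le> ennreal ((1/8) ^ k)" using N[of k "r j" n] n by simp
      qed
    qed
    also have "\<dots> = ennreal ((1/8) ^ k)" by (simp add: Liminf_const)
    finally show ?thesis .
  qed
  have "(\<lambda>n. L2dist G (F n)) \<longlonglongrightarrow> 0"
  proof (rule order_tendstoI)
    fix a :: ennreal assume a: "0 < a"
    have "(\<lambda>k. ennreal ((1/8) ^ k)) \<longlonglongrightarrow> ennreal 0"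
      by (intro tendsto_ennrealI LIMSEQ_power_zero) simp
    from order_tendstoD(2)[OF this, of a] a obtain k where k: "ennreal ((1/8) ^ k) < a"
      by (auto simp: eventually_sequentially)
    show "\<forall>\<^sub>F n in sequentially. L2dist G (F n) < a"
      unfolding eventually_sequentially using close[of k] k by (meson le_less_trans)
  qed simp
  then show thesis by (intro that[of G]) measurable
qed

text \<open>Cauchy--Schwarz. The bound on \<open>v\<close> is asked only eventually, because in
  \<open>L2_inner_tendsto\<close> it is applied with an error term as \<open>v\<close>, which
  becomes small only for large \<open>n\<close>.\<close>

lemma nn_integral_mult_tendsto_0:
  fixes u v :: "nat \<Rightarrow> 'a \<Rightarrow> ennreal"
  assumes [measurable]: "\<And>n. u n \<in> borel_measurable M" "\<And>n. v n \<in> borel_measurable M"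
    and u: "(\<lambda>n. \<integral>\<^sup>+x. (u n x)\<^sup>2 \<partial>M) \<longlonglongrightarrow> 0" and v: "\<forall>\<^sub>F n in sequentially. (\<integral>\<^sup>+x. (v n x)\<^sup>2 \<partial>M) \<le> C" and C: "C < \<infinity>"
  shows "(\<lambda>n. \<integral>\<^sup>+x. u n x * v n x \<partial>M) \<longlonglongrightarrow> 0"
proof (rule order_tendstoI)
  fix a :: ennreal assume a: "0 < a"
  have "(\<lambda>n. C * (\<integral>\<^sup>+x. (u n x)\<^sup>2 \<partial>M)) \<longlonglongrightarrow> C * 0"
    using C u by (intro ennreal_tendsto_cmult) auto
  moreover have "0 < a\<^sup>2" using a by (simp add: power2_eq_square ennreal_zero_less_mult_iff)
  ultimately have "\<forall>\<^sub>F n in sequentially. C * (\<integral>\<^sup>+x. (u n x)\<^sup>2 \<partial>M) < a\<^sup>2" by (auto dest: order_tendstoD(2))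
  then show "\<forall>\<^sub>F n in sequentially. (\<integral>\<^sup>+x. u n x * v n x \<partial>M) < a"
    using v
  proof eventually_elim
    fix n assume 1: "C * (\<integral>\<^sup>+x. (u n x)\<^sup>2 \<partial>M) < a\<^sup>2" and 2: "(\<integral>\<^sup>+x. (v n x)\<^sup>2 \<partial>M) \<le> C"
    have "(\<integral>\<^sup>+x. u n x * v n x \<partial>M)\<^sup>2 \<le> (\<integral>\<^sup>+x. (u n x)\<^sup>2 \<partial>M) * (\<integral>\<^sup>+x. (v n x)\<^sup>2 \<partial>M)"
      by (rule Cauchy_Schwarz_nn_integral) measurable
    also have "\<dots> \<le> (\<integral>\<^sup>+x. (u n x)\<^sup>2 \<partial>M) * C" using 2 by (intro mult_left_mono) auto
    also have "\<dots> < a\<^sup>2" using 1 by (simp add: mult.commute)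
    finally show "(\<integral>\<^sup>+x. u n x * v n x \<partial>M) < a" by (meson not_le power_mono zero_le)
  qed
qed simp

text \<open>The difference of the products is expanded into a product of two errors and two products
  of an error with a limit function. In this form no uniform bound on the norms of
  \<open>a n\<close> and \<open>b n\<close> is required.\<close>

lemma L2_inner_tendsto:
  fixes a b :: "nat \<Rightarrow> real^'n \<Rightarrow> complex" and A B :: "real^'n \<Rightarrow> complex"
  assumes sq: "\<And>n. square_integrable (a n)" "\<And>n. square_integrable (b n)" "square_integrable A" "square_integrable B"
    and a: "(\<lambda>n. L2dist A (a n)) \<longlonglongrightarrow> 0" and b: "(\<lambda>n. L2dist B (b n)) \<longlonglongrightarrow> 0"
  shows "(\<lambda>n. LINT x|lborel. a n x * cnj (b n x)) \<longlonglongrightarrow> (LINT x|lborel. A x * cnj (B x))"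
proof -
  have [measurable]: "a n \<in> borel_measurable borel" "b n \<in> borel_measurable borel"
    "A \<in> borel_measurable borel" "B \<in> borel_measurable borel" for n
    using sq by auto
  define s1 where "s1 n = (\<integral>\<^sup>+x. ennreal (cmod (A x - a n x)) * ennreal (cmod (B x - b n x)) \<partial>lborel)" for n
  define s2 where "s2 n = (\<integral>\<^sup>+x. ennreal (cmod (A x - a n x)) * ennreal (cmod (B x)) \<partial>lborel)" for n
  define s3 where "s3 n = (\<integral>\<^sup>+x. ennreal (cmod (B x - b n x)) * ennreal (cmod (A x)) \<partial>lborel)" for n
  have a': "(\<lambda>n. \<integral>\<^sup>+x. (ennreal (cmod (A x - a n x)))\<^sup>2 \<partial>lborel) \<longlonglongrightarrow> 0"
    and b': "(\<lambda>n. \<integral>\<^sup>+x. (ennreal (cmod (B x - b n x)))\<^sup>2 \<partial>lborel) \<longlonglongrightarrow> 0"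
    using a b by (simp_all add: L2dist_def ennreal_power)
  have "s1 \<longlonglongrightarrow> 0" unfolding s1_def
  proof (rule nn_integral_mult_tendsto_0[OF _ _ a', where C = 1])
    show "\<forall>\<^sub>F n in sequentially. (\<integral>\<^sup>+x. (ennreal (cmod (B x - b n x)))\<^sup>2 \<partial>lborel) \<le> 1"
      using order_tendstoD(2)[OF b', of 1] by (auto elim: eventually_mono)
  qed auto
  moreover have "s2 \<longlonglongrightarrow> 0" unfolding s2_def
    by (rule nn_integral_mult_tendsto_0[OF _ _ a', where C = "L2dist B (\<lambda>_. 0)"])
      (use sq(4) in \<open>auto simp: square_integrable_iff L2dist_def ennreal_power\<close>)
  moreover have "s3 \<longlonglongrightarrow> 0" unfolding s3_def
    by (rule nn_integral_mult_tendsto_0[OF _ _ b', where C = "L2dist A (\<lambda>_. 0)"])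
      (use sq(3) in \<open>auto simp: square_integrable_iff L2dist_def ennreal_power\<close>)
  ultimately have s: "(\<lambda>n. s1 n + s2 n + s3 n) \<longlonglongrightarrow> 0 + 0 + 0" by (intro tendsto_add)
  have bound: "ennreal (cmod ((LINT x|lborel. A x * cnj (B x)) - (LINT x|lborel. a n x * cnj (b n x)))) \<le> s1 n + s2 n + s3 n" for n
  proof -
    have i: "integrable lborel (\<lambda>x. A x * cnj (B x) - a n x * cnj (b n x))"
      by (intro Bochner_Integration.integrable_diff square_integrable_inner sq)
    have pt: "cmod (A x * cnj (B x) - a n x * cnj (b n x)) \<le>
        cmod (A x - a n x) * cmod (B x - b n x) + cmod (A x - a n x) * cmod (B x) + cmod (B x - b n x) * cmod (A x)" for x
    proof -
      have "A x * cnj (B x) - a n x * cnj (b n x)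
        = (- ((A x - a n x) * cnj (B x - b n x)) + (A x - a n x) * cnj (B x)) + cnj (B x - b n x) * A x"
        by (simp add: algebra_simps)
      then have "cmod (A x * cnj (B x) - a n x * cnj (b n x)) \<le> cmod (- ((A x - a n x) * cnj (B x - b n x)))
         + cmod ((A x - a n x) * cnj (B x)) + cmod (cnj (B x - b n x) * A x)"
        by (simp only:) (intro order_trans[OF norm_triangle_ineq] add_right_mono norm_triangle_ineq)
      then show ?thesis by (simp only: norm_mult norm_minus_cancel complex_mod_cnj)
    qed
    have "ennreal (cmod ((LINT x|lborel. A x * cnj (B x)) - (LINT x|lborel. a n x * cnj (b n x))))
        = ennreal (cmod (LINT x|lborel. A x * cnj (B x) - a n x * cnj (b n x)))"
      by (subst Bochner_Integration.integral_diff) (auto intro: square_integrable_inner sq)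
    also have "\<dots> \<le> (\<integral>\<^sup>+x. ennreal (cmod (A x * cnj (B x) - a n x * cnj (b n x))) \<partial>lborel)"
      by (rule integral_norm_bound_ennreal[OF i])
    also have "\<dots> \<le> (\<integral>\<^sup>+x. ennreal (cmod (A x - a n x)) * ennreal (cmod (B x - b n x))
        + ennreal (cmod (A x - a n x)) * ennreal (cmod (B x)) + ennreal (cmod (B x - b n x)) * ennreal (cmod (A x)) \<partial>lborel)"
      using ennreal_leI[OF pt] by (intro nn_integral_mono) (simp add: ennreal_mult)
    also have "\<dots> = s1 n + s2 n + s3 n"
      unfolding s1_def s2_def s3_def
      by (subst nn_integral_add, measurable, subst nn_integral_add) auto
    finally show ?thesis .
  qed
  have "(\<lambda>n. ennreal (cmod ((LINT x|lborel. A x * cnj (B x)) - (LINT x|lborel. a n x * cnj (b n x))))) \<longlonglongrightarrow> 0"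
    by (rule tendsto_sandwich[OF _ _ tendsto_const s[simplified]]) (use bound in auto)
  then have "(\<lambda>n. ennreal (cmod ((LINT x|lborel. A x * cnj (B x)) - (LINT x|lborel. a n x * cnj (b n x))))) \<longlonglongrightarrow> ennreal 0" by simp
  then have "(\<lambda>n. cmod ((LINT x|lborel. A x * cnj (B x)) - (LINT x|lborel. a n x * cnj (b n x)))) \<longlonglongrightarrow> 0"
    by (subst (asm) tendsto_ennreal_iff) auto
  then have "(\<lambda>n. (LINT x|lborel. A x * cnj (B x)) - (LINT x|lborel. a n x * cnj (b n x))) \<longlonglongrightarrow> 0"
    by (rule tendsto_norm_zero_cancel)
  then show ?thesis using tendsto_diff[OF tendsto_const[of "LINT x|lborel. A x * cnj (B x)"]] by fastforce
qed

section \<open>The transform of square-integrable functions through truncations\<close>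

definition trunc :: "nat \<Rightarrow> (real^'n \<Rightarrow> complex) \<Rightarrow> real^'n \<Rightarrow> complex" where
  "trunc n f x = indicator (ball 0 (real n)) x * f x"

lemma is_fourier_L2_trunc:
  "is_fourier_L2 f F \<longleftrightarrow> square_integrable F \<and> (\<lambda>n. L2dist F (fourier_L1 (trunc n f))) \<longlonglongrightarrow> 0"
  unfolding is_fourier_L2_iff trunc_def[abs_def] ..

lemma borel_measurable_trunc [measurable]:
  assumes [measurable]: "f \<in> borel_measurable borel"
  shows "trunc n f \<in> borel_measurable borel"
proof -
  have [measurable]: "ball 0 (real n) \<in> sets (borel :: (real^'a) measure)" by simp
  show ?thesis unfolding trunc_def[abs_def] by measurable
qed

lemma trunc_square_integrable:
  assumes f: "square_integrable f"
  shows "square_integrable (trunc n f)"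
proof -
  have [measurable]: "f \<in> borel_measurable borel" using f by auto
  have "integrable lborel (\<lambda>x. (cmod (f x))\<^sup>2)" using f by (simp add: square_integrable_def)
  then have "integrable lborel (\<lambda>x. (cmod (trunc n f x))\<^sup>2)"
    by (rule Bochner_Integration.integrable_bound) (auto simp: trunc_def indicator_def)
  then show ?thesis by (simp add: square_integrable_def)
qed

lemma trunc_integrable:
  fixes f :: "real^'n \<Rightarrow> complex"
  assumes f: "square_integrable f"
  shows "integrable lborel (trunc n f)"
proof -
  have [measurable]: "f \<in> borel_measurable borel" using f by auto
  have "integrable lborel (indicator (ball 0 (real n)) :: real^'n \<Rightarrow> real)"
    by (rule integrable_real_indicator) (use emeasure_bounded_finite[OF bounded_ball] in auto)
  then have "integrable lborel (\<lambda>x. indicator (ball 0 (real n)) x + (cmod (f x))\<^sup>2)"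
    using f by (auto simp: square_integrable_def)
  then show ?thesis
  proof (rule Bochner_Integration.integrable_bound)
    have "t \<le> 1 + t\<^sup>2" for t :: real
      using zero_le_power2[of "t - 1/2"] by (simp add: power2_eq_square algebra_simps)
    then show "AE x in lborel. cmod (trunc n f x) \<le> norm (indicator (ball 0 (real n)) x + (cmod (f x))\<^sup>2)"
      by (auto simp: trunc_def indicator_def)
  qed measurable
qed

lemma trunc_tendsto:
  fixes f :: "real^'n \<Rightarrow> complex"
  assumes f: "square_integrable f"
  shows "(\<lambda>n. L2dist f (trunc n f)) \<longlonglongrightarrow> 0"
proof -
  have [measurable]: "f \<in> borel_measurable borel" using f by auto
  have "(\<lambda>n. L2dist f (trunc n f)) \<longlonglongrightarrow> (\<integral>\<^sup>+(x::real^'n). 0 \<partial>lborel)"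
    unfolding L2dist_def
  proof (rule nn_integral_dominated_convergence[where u' = "\<lambda>_. 0" and w = "\<lambda>x. ennreal ((cmod (f x))\<^sup>2)"])
    show "(\<integral>\<^sup>+x. ennreal ((cmod (f x))\<^sup>2) \<partial>lborel) < \<infinity>"
      using f by (simp add: square_integrable_iff L2dist_def)
    show "AE x in lborel. ennreal ((cmod (f x - trunc n f x))\<^sup>2) \<le> ennreal ((cmod (f x))\<^sup>2)" for n
      by (intro AE_I2 ennreal_leI) (auto simp: trunc_def indicator_def)
    show "AE x in lborel. (\<lambda>n. ennreal ((cmod (f x - trunc n f x))\<^sup>2)) \<longlonglongrightarrow> 0"
    proof (intro AE_I2 tendsto_eventually)
      fix x :: "real^'n"
      obtain N :: nat where "norm x < real N" using reals_Archimedean2 by blast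
      then have "ennreal ((cmod (f x - trunc n f x))\<^sup>2) = 0" if "n \<ge> N" for n
        using that by (auto simp: trunc_def indicator_def)
      then show "\<forall>\<^sub>F n in sequentially. ennreal ((cmod (f x - trunc n f x))\<^sup>2) = 0"
        unfolding eventually_sequentially by blast
    qed
  qed measurable
  then show ?thesis by simp
qed

lemma fourier_L1_add:
  fixes f g :: "real^'n \<Rightarrow> complex"
  assumes f: "integrable lborel f" and g: "integrable lborel g"
  shows "fourier_L1 (\<lambda>x. f x + c * g x) \<xi> = fourier_L1 f \<xi> + c * fourier_L1 g \<xi>"
proof -
  have "fourier_L1 (\<lambda>x. f x + c * g x) \<xi>
      = (LINT x|lborel. f x * cis (- 2 * pi * (x \<bullet> \<xi>)) + c * (g x * cis (- 2 * pi * (x \<bullet> \<xi>))))"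
    unfolding fourier_L1_def by (simp only: distrib_right mult.assoc)
  also have "\<dots> = fourier_L1 f \<xi> + c * fourier_L1 g \<xi>"
    unfolding fourier_L1_def using fourier_L1_integrable[OF f, of \<xi>] fourier_L1_integrable[OF g, of \<xi>]
    by (subst Bochner_Integration.integral_add) auto
  finally show ?thesis .
qed

lemma plancherel_L1_dist:
  fixes f g :: "real^'n \<Rightarrow> complex"
  assumes f: "integrable lborel f" "square_integrable f" and g: "integrable lborel g" "square_integrable g"
  shows "L2dist (fourier_L1 f) (fourier_L1 g) = L2dist f g"
proof -
  have i: "integrable lborel (\<lambda>x. f x + (-1) * g x)" using f g by auto
  have "square_integrable (\<lambda>x. f x + (-1) * g x)" by (rule square_integrable_add) fact+
  then have "integrable lborel (\<lambda>x. (cmod (f x + (-1) * g x))\<^sup>2)" unfolding square_integrable_def by blast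
  from plancherel_L1[OF i this] show ?thesis
    unfolding L2dist_def fourier_L1_add[OF f(1) g(1)] by simp
qed

lemma fourier_L1_square_integrable:
  fixes f :: "real^'n \<Rightarrow> complex"
  assumes f: "integrable lborel f" "square_integrable f"
  shows "square_integrable (fourier_L1 f)"
proof -
  have [measurable]: "f \<in> borel_measurable borel" using f by auto
  have "(\<integral>\<^sup>+\<xi>. ennreal ((cmod (fourier_L1 f \<xi>))\<^sup>2) \<partial>lborel) = (\<integral>\<^sup>+x. ennreal ((cmod (f x))\<^sup>2) \<partial>lborel)"
    using f by (intro plancherel_L1) (auto simp: square_integrable_def)
  then show ?thesis using f(2) by (simp add: square_integrable_iff L2dist_def)
qed

text \<open>Polarization: Plancherel for \<open>f + c * g\<close> yields the real part of the inner
  product with \<open>c * g\<close>; \<open>c = 1\<close> gives the real part of the claim and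
  \<open>c = \<i>\<close> the imaginary part.\<close>

lemma parseval_L1:
  fixes f g :: "real^'n \<Rightarrow> complex"
  assumes f: "integrable lborel f" "square_integrable f" and g: "integrable lborel g" "square_integrable g"
  shows "(LINT x|lborel. f x * cnj (g x)) = (LINT \<xi>|lborel. fourier_L1 f \<xi> * cnj (fourier_L1 g \<xi>))"
proof -
  have S: "(LINT \<xi>|lborel. (cmod (fourier_L1 u \<xi>))\<^sup>2) = (LINT x|lborel. (cmod (u x))\<^sup>2)"
    if "integrable lborel u" "square_integrable u" for u :: "real^'n \<Rightarrow> complex"
  proof -
    have [measurable]: "u \<in> borel_measurable borel" using that by auto
    show ?thesis
      using that plancherel_L1[of u] by (simp add: square_integrable_def integral_eq_nn_integral)
  qed
  have expand: "(LINT x|lborel. (cmod (u x + v x))\<^sup>2)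
      = (LINT x|lborel. (cmod (u x))\<^sup>2) + (LINT x|lborel. (cmod (v x))\<^sup>2) + 2 * Re (LINT x|lborel. u x * cnj (v x))"
    if u: "square_integrable u" and v: "square_integrable v" for u v :: "real^'n \<Rightarrow> complex"
  proof -
    have uv: "integrable lborel (\<lambda>x. u x * cnj (v x))" by (rule square_integrable_inner[OF u v])
    have "(cmod (a + b))\<^sup>2 = (cmod a)\<^sup>2 + (cmod b)\<^sup>2 + 2 * Re (a * cnj b)" for a b
      unfolding cmod_power2 by (simp add: power2_eq_square algebra_simps)
    then have "(LINT x|lborel. (cmod (u x + v x))\<^sup>2) = (LINT x|lborel. (cmod (u x))\<^sup>2 + (cmod (v x))\<^sup>2 + 2 * Re (u x * cnj (v x)))"
      by (simp only:)
    also have "\<dots> = (LINT x|lborel. (cmod (u x))\<^sup>2) + (LINT x|lborel. (cmod (v x))\<^sup>2) + 2 * (LINT x|lborel. Re (u x * cnj (v x)))"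
    proof -
      have iu: "integrable lborel (\<lambda>x. (cmod (u x))\<^sup>2)" and iv: "integrable lborel (\<lambda>x. (cmod (v x))\<^sup>2)"
        using u v by (auto simp: square_integrable_def)
      show ?thesis
        by (subst Bochner_Integration.integral_add[OF Bochner_Integration.integrable_add[OF iu iv] integrable_mult_right[OF integrable_Re[OF uv]]],
            subst Bochner_Integration.integral_add[OF iu iv], subst integral_mult_right_zero) (rule refl)
    qed
    also have "(LINT x|lborel. Re (u x * cnj (v x))) = Re (LINT x|lborel. u x * cnj (v x))"
      by (rule integral_Re[OF uv])
    finally show ?thesis .
  qed
  have Re: "Re (LINT x|lborel. f x * cnj (c * g x)) = Re (LINT \<xi>|lborel. fourier_L1 f \<xi> * cnj (c * fourier_L1 g \<xi>))" for c
  proof -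
    have sg: "square_integrable (\<lambda>x. c * g x)" "integrable lborel (\<lambda>x. c * g x)"
      using square_integrable_add[of "\<lambda>_. 0" g c] g by (auto simp: square_integrable_def)
    have sG: "square_integrable (\<lambda>\<xi>. c * fourier_L1 g \<xi>)"
      using square_integrable_add[of "\<lambda>_. 0" "fourier_L1 g" c] fourier_L1_square_integrable[OF g] by (auto simp: square_integrable_def)
    have Fg: "fourier_L1 (\<lambda>x. c * g x) = (\<lambda>\<xi>. c * fourier_L1 g \<xi>)"
      using fourier_L1_add[of "\<lambda>_. 0" g c] g by (auto simp: fourier_L1_def)
    have ss: "square_integrable (\<lambda>x. f x + c * g x)" "integrable lborel (\<lambda>x. f x + c * g x)"
      using square_integrable_add[OF f(2) g(2)] f g by auto
    have "fourier_L1 (\<lambda>x. f x + c * g x) = (\<lambda>\<xi>. fourier_L1 f \<xi> + c * fourier_L1 g \<xi>)"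
      using fourier_L1_add[OF f(1) g(1)] by blast
    with S[OF ss(2,1)] have "(LINT \<xi>|lborel. (cmod (fourier_L1 f \<xi> + c * fourier_L1 g \<xi>))\<^sup>2) = (LINT x|lborel. (cmod (f x + c * g x))\<^sup>2)"
      by simp
    then show ?thesis
      using S[OF f] S[OF sg(2,1)]
      unfolding expand[OF f(2) sg(1)] expand[OF fourier_L1_square_integrable[OF f] sG] Fg by simp
  qed
  have Re1: "Re (LINT x|lborel. f x * cnj (g x)) = Re (LINT \<xi>|lborel. fourier_L1 f \<xi> * cnj (fourier_L1 g \<xi>))"
    using Re[of 1] by simp
  have *: "(LINT x|lborel. u x * cnj (\<i> * v x)) = - \<i> * (LINT x|lborel. u x * cnj (v x))" for u v :: "real^'n \<Rightarrow> complex"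
  proof -
    have "(LINT x|lborel. u x * cnj (\<i> * v x)) = (LINT x|lborel. - \<i> * (u x * cnj (v x)))"
      by (intro Bochner_Integration.integral_cong) auto
    then show ?thesis by simp
  qed
  have "Im (LINT x|lborel. f x * cnj (g x)) = Im (LINT \<xi>|lborel. fourier_L1 f \<xi> * cnj (fourier_L1 g \<xi>))"
    using Re[of \<i>] unfolding * by simp
  with Re1 show ?thesis by (simp add: complex_eq_iff)
qed

text \<open>The transform is isometric on truncations, which form a Cauchy sequence; the tolerance
  \<open>e / 4\<close> absorbs the factors 2 of \<open>L2dist_triangle\<close>. The limit is
  square-integrable because it has finite distance from a transformed truncation.\<close>

lemma fourier_L2_exists:
  fixes f :: "real^'n \<Rightarrow> complex"
  assumes f: "square_integrable f"
  shows "\<exists>F. is_fourier_L2 f F"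
proof -
  have [measurable]: "f \<in> borel_measurable borel" using f by auto
  define F where "F n = fourier_L1 (trunc n f)" for n
  have [measurable]: "F n \<in> borel_measurable borel" for n unfolding F_def by measurable
  obtain G where G: "G \<in> borel_measurable borel" "(\<lambda>n. L2dist G (F n)) \<longlonglongrightarrow> 0"
  proof (rule L2_complete[of F])
    fix e :: real assume e: "e > 0"
    from order_tendstoD(2)[OF trunc_tendsto[OF f], of "ennreal (e / 4)"] e
    obtain N where N: "\<And>n. n \<ge> N \<Longrightarrow> L2dist f (trunc n f) < ennreal (e / 4)"
      by (auto simp: eventually_sequentially)
    show "\<exists>N. \<forall>m\<ge>N. \<forall>n\<ge>N. L2dist (F m) (F n) < ennreal e"
    proof (intro exI[of _ N] allI impI)
      fix m n assume mn: "m \<ge> N" "n \<ge> N"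
      have "L2dist (F m) (F n) = L2dist (trunc m f) (trunc n f)"
        unfolding F_def by (intro plancherel_L1_dist trunc_integrable trunc_square_integrable f)
      also have "\<dots> \<le> 2 * L2dist (trunc m f) f + 2 * L2dist f (trunc n f)"
        by (intro L2dist_triangle) measurable
      also have "\<dots> < 2 * ennreal (e / 4) + 2 * ennreal (e / 4)"
        using N[OF mn(1)] N[OF mn(2)] by (intro add_strict_mono ennreal_mult_strict_left_mono) (auto simp: L2dist_sym)
      also have "\<dots> = ennreal e"
      proof -
        have "2 * ennreal (e / 4) = ennreal (e / 2)" using ennreal_mult'[of 2 "e / 4"] by simp
        then show ?thesis using e by (simp flip: ennreal_plus)
      qed
      finally show "L2dist (F m) (F n) < ennreal e" .
    qed
  qed measurable
  from order_tendstoD(2)[OF G(2), of 1] obtain n where "L2dist G (F n) < 1"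
    by (auto simp: eventually_sequentially)
  then have "L2dist G (F n) < \<infinity>" by (rule less_trans) simp
  moreover have "square_integrable (F n)"
    unfolding F_def by (intro fourier_L1_square_integrable trunc_integrable trunc_square_integrable f)
  ultimately have "square_integrable G" using G(1) square_integrable_close by blast
  then show ?thesis using G(2) unfolding is_fourier_L2_trunc F_def by blast
qed

lemma parseval_L2:
  assumes f: "square_integrable f" "is_fourier_L2 f F" and g: "square_integrable g" "is_fourier_L2 g G"
  shows "(LINT x|lborel. f x * cnj (g x)) = (LINT \<xi>|lborel. F \<xi> * cnj (G \<xi>))"
proof -
  have "(\<lambda>n. LINT x|lborel. trunc n f x * cnj (trunc n g x)) \<longlonglongrightarrow> (LINT x|lborel. f x * cnj (g x))"
    by (intro L2_inner_tendsto trunc_square_integrable trunc_tendsto f g)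
  moreover have "(\<lambda>n. LINT \<xi>|lborel. fourier_L1 (trunc n f) \<xi> * cnj (fourier_L1 (trunc n g) \<xi>)) \<longlonglongrightarrow> (LINT \<xi>|lborel. F \<xi> * cnj (G \<xi>))"
    using f g by (intro L2_inner_tendsto fourier_L1_square_integrable trunc_square_integrable trunc_integrable)
      (auto simp: is_fourier_L2_trunc)
  moreover have "(LINT x|lborel. trunc n f x * cnj (trunc n g x))
      = (LINT \<xi>|lborel. fourier_L1 (trunc n f) \<xi> * cnj (fourier_L1 (trunc n g) \<xi>))" for n
    by (intro parseval_L1 trunc_square_integrable trunc_integrable f g)
  ultimately show ?thesis using LIMSEQ_unique by simp
qed

text \<open>\<open>fourier_L2\<close> is a choice of representatives and need not be linear
  pointwise; linearity is available for the relation \<open>is_fourier_L2\<close>.\<close>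

lemma fourier_L2_add:
  assumes f: "square_integrable f" "is_fourier_L2 f F" and g: "square_integrable g" "is_fourier_L2 g G"
  shows "is_fourier_L2 (\<lambda>x. f x + c * g x) (\<lambda>\<xi>. F \<xi> + c * G \<xi>)"
proof -
  let ?Fn = "\<lambda>n. fourier_L1 (trunc n f)" and ?Gn = "\<lambda>n. fourier_L1 (trunc n g)"
  have F: "square_integrable F" "(\<lambda>n. L2dist F (?Fn n)) \<longlonglongrightarrow> 0" and G: "square_integrable G" "(\<lambda>n. L2dist G (?Gn n)) \<longlonglongrightarrow> 0"
    using f g by (auto simp: is_fourier_L2_trunc)
  have [measurable]: "F \<in> borel_measurable borel" "G \<in> borel_measurable borel"
    "f \<in> borel_measurable borel" "g \<in> borel_measurable borel" using F G f g by auto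
  have tr: "trunc n (\<lambda>x. f x + c * g x) = (\<lambda>x. trunc n f x + c * trunc n g x)" for n
    by (auto simp: trunc_def algebra_simps)
  have Fn: "fourier_L1 (trunc n (\<lambda>x. f x + c * g x)) = (\<lambda>\<xi>. ?Fn n \<xi> + c * ?Gn n \<xi>)" for n
    unfolding tr by (intro ext fourier_L1_add trunc_integrable f g)
  have le: "L2dist (\<lambda>\<xi>. F \<xi> + c * G \<xi>) (\<lambda>\<xi>. ?Fn n \<xi> + c * ?Gn n \<xi>)
      \<le> 2 * L2dist F (?Fn n) + ennreal (2 * (cmod c)\<^sup>2) * L2dist G (?Gn n)" for n
  proof -
    have "L2dist (\<lambda>\<xi>. F \<xi> + c * G \<xi>) (\<lambda>\<xi>. ?Fn n \<xi> + c * ?Gn n \<xi>)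
        \<le> (\<integral>\<^sup>+\<xi>. 2 * ennreal ((cmod (F \<xi> - ?Fn n \<xi>))\<^sup>2) + ennreal (2 * (cmod c)\<^sup>2) * ennreal ((cmod (G \<xi> - ?Gn n \<xi>))\<^sup>2) \<partial>lborel)"
      unfolding L2dist_def
    proof (rule nn_integral_mono)
      fix \<xi>
      have eq: "F \<xi> + c * G \<xi> - (?Fn n \<xi> + c * ?Gn n \<xi>) = (F \<xi> - ?Fn n \<xi>) + c * (G \<xi> - ?Gn n \<xi>)"
        by (simp add: algebra_simps)
      have "(cmod (F \<xi> + c * G \<xi> - (?Fn n \<xi> + c * ?Gn n \<xi>)))\<^sup>2
          \<le> 2 * (cmod (F \<xi> - ?Fn n \<xi>))\<^sup>2 + (2 * (cmod c)\<^sup>2) * (cmod (G \<xi> - ?Gn n \<xi>))\<^sup>2"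
        unfolding eq using power2_cmod_add_le[of "F \<xi> - ?Fn n \<xi>" "c * (G \<xi> - ?Gn n \<xi>)"]
        by (simp only: norm_mult power_mult_distrib mult.assoc)
      from ennreal_leI[OF this]
      show "ennreal ((cmod (F \<xi> + c * G \<xi> - (?Fn n \<xi> + c * ?Gn n \<xi>)))\<^sup>2)
          \<le> 2 * ennreal ((cmod (F \<xi> - ?Fn n \<xi>))\<^sup>2) + ennreal (2 * (cmod c)\<^sup>2) * ennreal ((cmod (G \<xi> - ?Gn n \<xi>))\<^sup>2)"
        by (simp add: ennreal_mult)
    qed
    also have "\<dots> = 2 * L2dist F (?Fn n) + ennreal (2 * (cmod c)\<^sup>2) * L2dist G (?Gn n)"
      unfolding L2dist_def by (subst nn_integral_add) (auto simp: nn_integral_cmult)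
    finally show ?thesis .
  qed
  have "(\<lambda>n. 2 * L2dist F (?Fn n) + ennreal (2 * (cmod c)\<^sup>2) * L2dist G (?Gn n)) \<longlonglongrightarrow> 2 * 0 + ennreal (2 * (cmod c)\<^sup>2) * 0"
    by (intro tendsto_add ennreal_tendsto_cmult F G) auto
  then have "(\<lambda>n. 2 * L2dist F (?Fn n) + ennreal (2 * (cmod c)\<^sup>2) * L2dist G (?Gn n)) \<longlonglongrightarrow> 0" by simp
  from tendsto_sandwich[OF _ _ tendsto_const this]
  have "(\<lambda>n. L2dist (\<lambda>\<xi>. F \<xi> + c * G \<xi>) (\<lambda>\<xi>. ?Fn n \<xi> + c * ?Gn n \<xi>)) \<longlonglongrightarrow> 0"
    using le by auto
  then show ?thesis
    unfolding is_fourier_L2_trunc Fn using square_integrable_add[OF F(1) G(1)] by blast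
qed

text \<open>Injectivity of the transform: Parseval for \<open>f\<close> against itself makes its
  norm vanish.\<close>

lemma fourier_L2_eq_0:
  assumes f: "square_integrable f" "is_fourier_L2 f F" and F: "AE \<xi> in lborel. F \<xi> = 0"
  shows "AE x in lborel. f x = 0"
proof -
  have "(LINT x|lborel. f x * cnj (f x)) = (LINT \<xi>|lborel. F \<xi> * cnj (F \<xi>))"
    by (rule parseval_L2[OF f f])
  also have "\<dots> = 0"
    by (rule integral_eq_zero_AE) (use F in eventually_elim, simp)
  finally have "(LINT x|lborel. complex_of_real ((cmod (f x))\<^sup>2)) = 0"
    by (simp only: complex_norm_square)
  then have "(LINT x|lborel. (cmod (f x))\<^sup>2) = 0" by (simp only: integral_complex_of_real of_real_eq_0_iff)
  then show ?thesis
    using f(1) by (subst (asm) integral_nonneg_eq_0_iff_AE) (auto simp: square_integrable_def)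
qed

lemma square_integrable_of_real:
  assumes f: "square_integrable (f :: real^'n \<Rightarrow> real)"
  shows "square_integrable (\<lambda>x. complex_of_real (f x))"
  using f by (auto simp: square_integrable_def)

lemma is_fourier_L2_fourier_L2:
  assumes f: "square_integrable (f :: real^'n \<Rightarrow> real)"
  shows "is_fourier_L2 (\<lambda>x. complex_of_real (f x)) (fourier_L2 f)"
  unfolding fourier_L2_def using fourier_L2_exists[OF square_integrable_of_real[OF f]] by (rule someI_ex)

section \<open>Correlations with dilates\<close>

lemma linear_substitution:
  fixes A :: "real^'n^'n"
  assumes A: "invertible A"
  obtains c :: real where "c > 0"
    "\<And>f :: real^'n \<Rightarrow> ennreal. f \<in> borel_measurable borel \<Longrightarrow> (\<integral>\<^sup>+x. f (A *v x) \<partial>lborel) = ennreal c * (\<integral>\<^sup>+x. f x \<partial>lborel)"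
    "\<And>f :: real^'n \<Rightarrow> complex. f \<in> borel_measurable borel \<Longrightarrow> (LINT x|lborel. f (A *v x)) = of_real c * (LINT x|lborel. f x)"
proof -
  have m [measurable]: "(\<lambda>x. A *v x) \<in> borel \<rightarrow>\<^sub>M borel"
    by (intro borel_measurable_continuous_onI continuous_intros)
  obtain c where c: "c > 0" "distr lborel borel (\<lambda>x. A *v x) = density lborel (\<lambda>_. ennreal c)"
    by (rule distr_lborel_linear[OF A])
  show thesis
  proof
    show "c > 0" by fact
    fix f :: "real^'n \<Rightarrow> ennreal" assume [measurable]: "f \<in> borel_measurable borel"
    have "(\<integral>\<^sup>+x. f (A *v x) \<partial>lborel) = (\<integral>\<^sup>+x. f x \<partial>distr lborel borel (\<lambda>x. A *v x))"
      by (subst nn_integral_distr) auto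
    then show "(\<integral>\<^sup>+x. f (A *v x) \<partial>lborel) = ennreal c * (\<integral>\<^sup>+x. f x \<partial>lborel)"
      unfolding c by (simp add: nn_integral_density nn_integral_cmult)
  next
    fix f :: "real^'n \<Rightarrow> complex" assume [measurable]: "f \<in> borel_measurable borel"
    have "(LINT x|lborel. f (A *v x)) = (LINT x|distr lborel borel (\<lambda>x. A *v x). f x)"
      by (subst integral_distr) auto
    also have "\<dots> = (LINT x|lborel. c *\<^sub>R f x)"
      unfolding c(2) using c(1) by (subst integral_density) auto
    finally show "(LINT x|lborel. f (A *v x)) = of_real c * (LINT x|lborel. f x)"
      by (simp add: scaleR_conv_of_real)
  qed
qed

text \<open>Parseval pairs \<open>f\<close> with the translated dilate. The transform of the dilate
  is computed for truncations, where it is an honest integral, and both sides then pass to the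
  limit. Since \<open>\<kappa>\<close> depends on neither \<open>f\<close> nor \<open>x\<close>, one
  value serves both signals, and its positivity allows it to be cancelled.\<close>

lemma correlation_fourier:
  fixes \<psi> :: "real^'n \<Rightarrow> real" and h :: "real^'n^'n"
  assumes h: "invertible h" and \<psi>: "square_integrable \<psi>"
  obtains \<kappa> where "\<kappa> > 0"
    "\<And>f x. square_integrable f \<Longrightarrow> complex_of_real (Defs.convolution f (involution (dilate h \<psi>)) x)
       = of_real \<kappa> * (LINT \<xi>|lborel. fourier_L2 f \<xi> * cnj (fourier_L2 \<psi> (transpose h *v \<xi>)) * cis (2 * pi * (x \<bullet> \<xi>)))"
proof -
  let ?\<psi> = "\<lambda>x. complex_of_real (\<psi> x)"
  have P: "square_integrable ?\<psi>" "is_fourier_L2 ?\<psi> (fourier_L2 \<psi>)"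
    using square_integrable_of_real is_fourier_L2_fourier_L2 \<psi> by auto
  define \<Psi> where "\<Psi> = fourier_L2 \<psi>"
  have P': "square_integrable \<Psi>" "(\<lambda>n. L2dist \<Psi> (fourier_L1 (trunc n ?\<psi>))) \<longlonglongrightarrow> 0"
    using P by (auto simp: is_fourier_L2_trunc \<Psi>_def)
  have [measurable]: "?\<psi> \<in> borel_measurable borel" "\<Psi> \<in> borel_measurable borel"
    using P P' by auto
  define A where "A = matrix_inv h"
  have cancel: "A ** h = mat 1" "h ** A = mat 1" using matrix_inv_cancel[OF h] by (auto simp: A_def)
  have Ainv: "invertible A" using cancel by (auto simp: invertible_def)
  have hT: "invertible (transpose h)" using h by (simp add: invertible_det_nz)
  have [measurable]: "(\<lambda>x. A *v x) \<in> borel \<rightarrow>\<^sub>M borel" "(\<lambda>x. transpose h *v x) \<in> borel \<rightarrow>\<^sub>M borel"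
    by (intro borel_measurable_continuous_onI continuous_intros)+
  obtain c where c: "c > 0"
    "\<And>f :: real^'n \<Rightarrow> ennreal. f \<in> borel_measurable borel \<Longrightarrow> (\<integral>\<^sup>+x. f (A *v x) \<partial>lborel) = ennreal c * (\<integral>\<^sup>+x. f x \<partial>lborel)"
    "\<And>f :: real^'n \<Rightarrow> complex. f \<in> borel_measurable borel \<Longrightarrow> (LINT x|lborel. f (A *v x)) = of_real c * (LINT x|lborel. f x)"
    by (rule linear_substitution[OF Ainv]) (rule that)
  obtain c' where c': "c' > 0"
    "\<And>f :: real^'n \<Rightarrow> ennreal. f \<in> borel_measurable borel \<Longrightarrow> (\<integral>\<^sup>+x. f (transpose h *v x) \<partial>lborel) = ennreal c' * (\<integral>\<^sup>+x. f x \<partial>lborel)"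
    by (rule linear_substitution[OF hT]) (rule that)
  \<comment> \<open>\<open>c\<close> is the volume factor of the inverse of \<open>h\<close>; the
    division comes from the normalization in \<open>dilate\<close>.\<close>
  define \<kappa> where "\<kappa> = c / \<bar>det h\<bar>"
  have \<kappa>: "\<kappa> > 0" using c(1) h by (simp add: \<kappa>_def invertible_det_nz)
  have main: "complex_of_real (Defs.convolution f (involution (dilate h \<psi>)) x)
       = of_real \<kappa> * (LINT \<xi>|lborel. fourier_L2 f \<xi> * cnj (\<Psi> (transpose h *v \<xi>)) * cis (2 * pi * (x \<bullet> \<xi>)))"
    if f: "square_integrable f" for f x
  proof -
    let ?f = "\<lambda>x. complex_of_real (f x)"
    have F: "square_integrable ?f" "is_fourier_L2 ?f (fourier_L2 f)"
      using square_integrable_of_real is_fourier_L2_fourier_L2 f by auto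
    have F': "square_integrable (fourier_L2 f)" "(\<lambda>n. L2dist (fourier_L2 f) (fourier_L1 (trunc n ?f))) \<longlonglongrightarrow> 0"
      using F by (auto simp: is_fourier_L2_trunc)
    have [measurable]: "?f \<in> borel_measurable borel" using F by auto
    \<comment> \<open>Applied to \<open>\<psi>\<close>, this is, up to the factor
      \<open>1 / \<bar>det h\<bar>\<close>, the convolution kernel at \<open>x - y\<close>, whose
      argument the involution turns into \<open>y - x\<close>.\<close>
    define s where "s g y = g (A *v (y - x))" for g :: "real^'n \<Rightarrow> complex" and y
    have s_meas: "s g \<in> borel_measurable borel" if [measurable]: "g \<in> borel_measurable borel" for g
    proof -
      have "(\<lambda>y. A *v (y - x)) \<in> borel \<rightarrow>\<^sub>M borel"
        by (intro borel_measurable_continuous_onI continuous_intros)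
      from measurable_compose[OF this that] show ?thesis by (simp add: s_def[abs_def])
    qed
    have s_dist: "L2dist (s g) (s g') = ennreal c * L2dist g g'"
      if [measurable]: "g \<in> borel_measurable borel" "g' \<in> borel_measurable borel" for g g'
    proof -
      have "L2dist (s g) (s g') = (\<integral>\<^sup>+y. ennreal ((cmod (g (A *v y) - g' (A *v y)))\<^sup>2) \<partial>lborel)"
        unfolding L2dist_def s_def
        by (rule nn_integral_lborel_translate[where f = "\<lambda>y. ennreal ((cmod (g (A *v y) - g' (A *v y)))\<^sup>2)"]) measurable
      also have "\<dots> = ennreal c * L2dist g g'"
        unfolding L2dist_def by (rule c(2)[of "\<lambda>y. ennreal ((cmod (g y - g' y))\<^sup>2)"]) measurable
      finally show ?thesis .
    qed
    have s0: "s (\<lambda>_. 0) = (\<lambda>_. 0)" by (auto simp: s_def)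
    have s_sq: "square_integrable (s g)" if "square_integrable g" for g
    proof -
      have [measurable]: "g \<in> borel_measurable borel" using that by auto
      show ?thesis using that s_dist[of g "\<lambda>_. 0"] s_meas[of g]
        by (simp add: square_integrable_iff s0 ennreal_mult_less_top)
    qed
    have s_int: "integrable lborel (s g)" if "integrable lborel g" for g
    proof -
      have [measurable]: "g \<in> borel_measurable borel" using that by auto
      have "(\<integral>\<^sup>+y. ennreal (cmod (s g y)) \<partial>lborel) = (\<integral>\<^sup>+y. ennreal (cmod (g (A *v y))) \<partial>lborel)"
        unfolding s_def by (rule nn_integral_lborel_translate[where f = "\<lambda>y. ennreal (cmod (g (A *v y)))"]) measurable
      also have "\<dots> = ennreal c * (\<integral>\<^sup>+y. ennreal (cmod (g y)) \<partial>lborel)"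
        by (rule c(2)[of "\<lambda>y. ennreal (cmod (g y))"]) measurable
      also have "\<dots> < \<infinity>" using that by (simp add: integrable_iff_bounded ennreal_mult_less_top)
      finally show ?thesis using s_meas[of g] by (simp add: integrable_iff_bounded)
    qed
    have s_fourier: "fourier_L1 (s g) \<xi> = of_real c * (cis (- 2 * pi * (x \<bullet> \<xi>)) * fourier_L1 g (transpose h *v \<xi>))"
      if [measurable]: "g \<in> borel_measurable borel" for g \<xi>
    proof -
      have "fourier_L1 (s g) \<xi> = (LINT y|lborel. s g (x + 1 *\<^sub>R y) * cis (- 2 * pi * ((x + 1 *\<^sub>R y) \<bullet> \<xi>)))"
        unfolding fourier_L1_def using s_meas[of g]
        by (subst lebesgue_integral_lborel_affine[where c = 1 and t = x]) auto
      also have "\<dots> = (LINT y|lborel. cis (- 2 * pi * (x \<bullet> \<xi>)) * (g (A *v y) * cis (- 2 * pi * ((A *v y) \<bullet> (transpose h *v \<xi>)))))"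
      proof (rule Bochner_Integration.integral_cong[OF refl])
        fix y
        have "(A *v y) \<bullet> (transpose h *v \<xi>) = (h *v (A *v y)) \<bullet> \<xi>"
          by (metis dot_lmul_matrix inner_commute transpose_matrix_vector transpose_transpose)
        also have "h *v (A *v y) = y" by (simp add: matrix_vector_mul_assoc cancel)
        finally have "(A *v y) \<bullet> (transpose h *v \<xi>) = y \<bullet> \<xi>" .
        moreover have "cis (- 2 * pi * ((x + y) \<bullet> \<xi>)) = cis (- 2 * pi * (x \<bullet> \<xi>)) * cis (- 2 * pi * (y \<bullet> \<xi>))"
          by (simp add: cis_mult inner_add_left algebra_simps)
        ultimately show "s g (x + 1 *\<^sub>R y) * cis (- 2 * pi * ((x + 1 *\<^sub>R y) \<bullet> \<xi>))
           = cis (- 2 * pi * (x \<bullet> \<xi>)) * (g (A *v y) * cis (- 2 * pi * ((A *v y) \<bullet> (transpose h *v \<xi>))))"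
          by (simp only: s_def scaleR_one add_diff_cancel_left' mult_ac)
      qed
      also have "\<dots> = cis (- 2 * pi * (x \<bullet> \<xi>)) * (LINT y|lborel. g (A *v y) * cis (- 2 * pi * ((A *v y) \<bullet> (transpose h *v \<xi>))))"
        by (rule integral_mult_right_zero)
      also have "(LINT y|lborel. g (A *v y) * cis (- 2 * pi * ((A *v y) \<bullet> (transpose h *v \<xi>)))) = of_real c * fourier_L1 g (transpose h *v \<xi>)"
        unfolding fourier_L1_def by (rule c(3)[of "\<lambda>y. g y * cis (- 2 * pi * (y \<bullet> (transpose h *v \<xi>)))"]) measurable
      finally show ?thesis by (simp only: mult_ac)
    qed
    \<comment> \<open>What \<open>s\<close> becomes under the transform, up to the factor
      \<open>c\<close>: the translation by \<open>x\<close> turns into a phase and the inverse of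
      \<open>h\<close> into \<open>transpose h\<close>.\<close>
    define t where "t G \<xi> = G (transpose h *v \<xi>) * cis (- 2 * pi * (x \<bullet> \<xi>))" for G :: "real^'n \<Rightarrow> complex" and \<xi>
    have t_meas [measurable]: "t G \<in> borel_measurable borel" if [measurable]: "G \<in> borel_measurable borel" for G
      unfolding t_def[abs_def] by measurable
    have t_dist: "L2dist (t G) (t G') = ennreal c' * L2dist G G'"
      if [measurable]: "G \<in> borel_measurable borel" "G' \<in> borel_measurable borel" for G G'
    proof -
      have "L2dist (t G) (t G') = (\<integral>\<^sup>+\<xi>. ennreal ((cmod (G (transpose h *v \<xi>) - G' (transpose h *v \<xi>)))\<^sup>2) \<partial>lborel)"
        unfolding L2dist_def t_def by (simp only: left_diff_distrib[symmetric] norm_mult norm_cis mult_1_right)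
      also have "\<dots> = ennreal c' * L2dist G G'"
        unfolding L2dist_def by (rule c'(2)[of "\<lambda>\<xi>. ennreal ((cmod (G \<xi> - G' \<xi>))\<^sup>2)"]) measurable
      finally show ?thesis .
    qed
    have t0: "t (\<lambda>_. 0) = (\<lambda>_. 0)" by (auto simp: t_def)
    have t_sq: "square_integrable (t G)" if "square_integrable G" for G
    proof -
      have [measurable]: "G \<in> borel_measurable borel" using that by auto
      show ?thesis using that t_dist[of G "\<lambda>_. 0"] t_meas[of G]
        by (simp add: square_integrable_iff t0 ennreal_mult_less_top)
    qed
    let ?a = "\<lambda>n. trunc n ?f" and ?b = "\<lambda>n. trunc n ?\<psi>"
    have ba: "square_integrable (?b n)" "integrable lborel (?b n)" "square_integrable (?a n)" "integrable lborel (?a n)" for n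
      by (intro trunc_square_integrable trunc_integrable F P)+
    have lim1: "(\<lambda>n. LINT y|lborel. ?a n y * cnj (s (?b n) y)) \<longlonglongrightarrow> (LINT y|lborel. ?f y * cnj (s ?\<psi> y))"
    proof (intro L2_inner_tendsto ba s_sq F P trunc_tendsto)
      have "(\<lambda>n. ennreal c * L2dist ?\<psi> (?b n)) \<longlonglongrightarrow> ennreal c * 0"
        by (intro ennreal_tendsto_cmult trunc_tendsto P) simp
      then show "(\<lambda>n. L2dist (s ?\<psi>) (s (?b n))) \<longlonglongrightarrow> 0" by (simp add: s_dist)
    qed
    have lim2: "(\<lambda>n. LINT \<xi>|lborel. fourier_L1 (?a n) \<xi> * cnj (t (fourier_L1 (?b n)) \<xi>)) \<longlonglongrightarrow> (LINT \<xi>|lborel. fourier_L2 f \<xi> * cnj (t \<Psi> \<xi>))"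
    proof (intro L2_inner_tendsto ba fourier_L1_square_integrable t_sq F' P')
      have "(\<lambda>n. ennreal c' * L2dist \<Psi> (fourier_L1 (?b n))) \<longlonglongrightarrow> ennreal c' * 0"
        by (intro ennreal_tendsto_cmult P') simp
      then show "(\<lambda>n. L2dist (t \<Psi>) (t (fourier_L1 (?b n)))) \<longlonglongrightarrow> 0" by (simp add: t_dist)
    qed
    have eq: "(LINT y|lborel. ?a n y * cnj (s (?b n) y)) = of_real c * (LINT \<xi>|lborel. fourier_L1 (?a n) \<xi> * cnj (t (fourier_L1 (?b n)) \<xi>))" for n
    proof -
      have bm: "?b n \<in> borel_measurable borel" by measurable
      have "(LINT y|lborel. ?a n y * cnj (s (?b n) y)) = (LINT \<xi>|lborel. fourier_L1 (?a n) \<xi> * cnj (fourier_L1 (s (?b n)) \<xi>))"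
        by (intro parseval_L1 ba s_sq s_int)
      also have "\<dots> = (LINT \<xi>|lborel. of_real c * (fourier_L1 (?a n) \<xi> * cnj (t (fourier_L1 (?b n)) \<xi>)))"
        unfolding s_fourier[OF bm] t_def complex_cnj_mult complex_cnj_complex_of_real by (simp only: mult_ac)
      finally show ?thesis by (simp only: integral_mult_right_zero)
    qed
    have "(LINT y|lborel. ?f y * cnj (s ?\<psi> y)) = of_real c * (LINT \<xi>|lborel. fourier_L2 f \<xi> * cnj (t \<Psi> \<xi>))"
      using LIMSEQ_unique[OF lim1[unfolded eq] tendsto_mult_left[OF lim2]] .
    moreover have "complex_of_real (Defs.convolution f (involution (dilate h \<psi>)) x) = of_real (1 / \<bar>det h\<bar>) * (LINT y|lborel. ?f y * cnj (s ?\<psi> y))"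
    proof -
      have "Defs.convolution f (involution (dilate h \<psi>)) x = (LINT y|lborel. (1 / \<bar>det h\<bar>) * (f y * \<psi> (A *v (y - x))))"
        unfolding Defs.convolution_def involution_def dilate_def A_def
        by (intro Bochner_Integration.integral_cong) (auto simp: inverse_eq_divide)
      also have "\<dots> = (1 / \<bar>det h\<bar>) * (LINT y|lborel. f y * \<psi> (A *v (y - x)))"
        by (rule integral_mult_right_zero)
      finally show ?thesis unfolding s_def
        by (simp only: of_real_mult integral_complex_of_real[symmetric] complex_cnj_complex_of_real)
    qed
    moreover have "cnj (t \<Psi> \<xi>) = cnj (\<Psi> (transpose h *v \<xi>)) * cis (2 * pi * (x \<bullet> \<xi>))" for \<xi>
      by (simp add: t_def cis_cnj)
    ultimately show ?thesis by (simp add: \<kappa>_def mult.assoc)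
  qed
  show thesis by (rule that[OF \<kappa> main[unfolded \<Psi>_def]])
qed

section \<open>Band-limited functions\<close>

text \<open>The exponential series is integrated term by term. Bounded support makes the
  \<open>n\<close>-th coefficient at most \<open>K ^ n / fact n\<close> times the integral of
  \<open>cmod (G \<xi>)\<close>, so the series converges for all \<open>t\<close>, and the
  restriction to the line extends to an entire function.\<close>

lemma band_limited_power_series:
  fixes G :: "real^'n \<Rightarrow> complex" and a d :: "real^'n"
  assumes G: "integrable lborel G" and supp: "\<And>\<xi>. norm \<xi> > R \<Longrightarrow> G \<xi> = 0"
  obtains c where "\<And>t::real. (\<lambda>n. c n * complex_of_real t ^ n) sums (LINT \<xi>|lborel. G \<xi> * cis (2 * pi * ((a + t *\<^sub>R d) \<bullet> \<xi>)))"
proof -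
  have [measurable]: "G \<in> borel_measurable borel" using G by auto
  define f where "f n \<xi> = G \<xi> * cis (2 * pi * (a \<bullet> \<xi>)) * ((\<i> * of_real (2 * pi * (d \<bullet> \<xi>))) ^ n / fact n)" for n \<xi>
  have [measurable]: "f n \<in> borel_measurable borel" for n unfolding f_def by measurable
  \<comment> \<open>The absolute value covers a negative \<open>R\<close>, for which
    \<open>G\<close> vanishes identically.\<close>
  define K where "K = 2 * pi * norm d * \<bar>R\<bar>"
  have K: "K \<ge> 0" by (simp add: K_def)
  have bound: "cmod (f n \<xi>) \<le> cmod (G \<xi>) * (K ^ n / fact n)" for n \<xi>
  proof (cases "norm \<xi> > R")
    case False
    have "\<bar>2 * pi * (d \<bullet> \<xi>)\<bar> \<le> 2 * pi * (norm d * norm \<xi>)"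
      using Cauchy_Schwarz_ineq2[of d \<xi>] by (simp add: abs_mult)
    also have "\<dots> \<le> K" using False by (auto simp: K_def intro!: mult_left_mono)
    finally have "\<bar>2 * pi * (d \<bullet> \<xi>)\<bar> ^ n \<le> K ^ n" by (intro power_mono) auto
    then show ?thesis
      by (auto simp: f_def norm_mult norm_divide norm_power abs_mult intro!: mult_left_mono divide_right_mono)
  qed (simp add: f_def supp)
  have fi: "integrable lborel (f n)" for n
  proof (rule Bochner_Integration.integrable_bound)
    show "integrable lborel (\<lambda>\<xi>. cmod (G \<xi>) * (K ^ n / fact n))" using G by auto
    show "AE \<xi> in lborel. cmod (f n \<xi>) \<le> norm (cmod (G \<xi>) * (K ^ n / fact n))"
      using bound[of n] K by (intro AE_I2) simp
  qed measurable
  define c where "c n = (LINT \<xi>|lborel. f n \<xi>)" for n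
  have "(\<lambda>n. c n * complex_of_real t ^ n) sums (LINT \<xi>|lborel. G \<xi> * cis (2 * pi * ((a + t *\<^sub>R d) \<bullet> \<xi>)))" for t :: real
  proof -
    have exps: "summable (\<lambda>n. x ^ n / fact n)" for x :: real
      using summable_exp[of x] by (simp add: divide_inverse mult.commute)
    have nb: "cmod (f n \<xi> * complex_of_real t ^ n) \<le> cmod (G \<xi>) * ((K * \<bar>t\<bar>) ^ n / fact n)" for n \<xi>
      using mult_right_mono[OF bound[of n \<xi>], of "\<bar>t\<bar> ^ n"]
      by (simp add: norm_mult norm_power power_mult_distrib)
    have "(\<lambda>n. LINT \<xi>|lborel. f n \<xi> * complex_of_real t ^ n) sums (LINT \<xi>|lborel. (\<Sum>n. f n \<xi> * complex_of_real t ^ n))"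
    proof (rule sums_integral)
      show "integrable lborel (\<lambda>\<xi>. f n \<xi> * complex_of_real t ^ n)" for n using fi by auto
      show "AE \<xi> in lborel. summable (\<lambda>n. norm (f n \<xi> * complex_of_real t ^ n))"
      proof (rule AE_I2)
        fix \<xi>
        have "summable (\<lambda>n. cmod (G \<xi>) * ((K * \<bar>t\<bar>) ^ n / fact n))" by (intro summable_mult exps)
        then show "summable (\<lambda>n. norm (f n \<xi> * complex_of_real t ^ n))"
          by (rule summable_comparison_test'[where N = 0]) (use nb in auto)
      qed
      have "summable (\<lambda>n. (LINT \<xi>|lborel. cmod (G \<xi>)) * ((K * \<bar>t\<bar>) ^ n / fact n))" by (intro summable_mult exps)
      then show "summable (\<lambda>n. LINT \<xi>|lborel. norm (f n \<xi> * complex_of_real t ^ n))"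
      proof (rule summable_comparison_test'[where N = 0])
        fix n
        have "(LINT \<xi>|lborel. norm (f n \<xi> * complex_of_real t ^ n)) \<le> (LINT \<xi>|lborel. cmod (G \<xi>) * ((K * \<bar>t\<bar>) ^ n / fact n))"
          using fi G nb by (intro integral_mono) auto
        also have "\<dots> = (LINT \<xi>|lborel. cmod (G \<xi>)) * ((K * \<bar>t\<bar>) ^ n / fact n)" by (rule integral_mult_left_zero)
        finally show "norm (LINT \<xi>|lborel. norm (f n \<xi> * complex_of_real t ^ n)) \<le> (LINT \<xi>|lborel. cmod (G \<xi>)) * ((K * \<bar>t\<bar>) ^ n / fact n)"
          by (subst real_norm_def, subst abs_of_nonneg) (auto intro: Bochner_Integration.integral_nonneg)
      qed
    qed
    moreover have "(\<Sum>n. f n \<xi> * complex_of_real t ^ n) = G \<xi> * cis (2 * pi * ((a + t *\<^sub>R d) \<bullet> \<xi>))" for \<xi>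
    proof -
      let ?w = "\<i> * of_real (2 * pi * (d \<bullet> \<xi>)) * complex_of_real t"
      have "(\<lambda>n. ?w ^ n /\<^sub>R fact n) sums exp ?w" by (rule exp_converges)
      then have "(\<lambda>n. G \<xi> * cis (2 * pi * (a \<bullet> \<xi>)) * (?w ^ n /\<^sub>R fact n)) sums (G \<xi> * cis (2 * pi * (a \<bullet> \<xi>)) * exp ?w)"
        by (rule sums_mult)
      moreover have "G \<xi> * cis (2 * pi * (a \<bullet> \<xi>)) * (?w ^ n /\<^sub>R fact n) = f n \<xi> * complex_of_real t ^ n" for n
        unfolding f_def power_mult_distrib[of _ "complex_of_real t"] by (simp add: scaleR_conv_of_real divide_inverse mult_ac)
      moreover have "exp ?w = cis (2 * pi * ((t *\<^sub>R d) \<bullet> \<xi>))"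
        by (simp add: cis_conv_exp mult_ac)
      ultimately have "(\<lambda>n. f n \<xi> * complex_of_real t ^ n) sums (G \<xi> * cis (2 * pi * (a \<bullet> \<xi>)) * cis (2 * pi * ((t *\<^sub>R d) \<bullet> \<xi>)))"
        by simp
      then show ?thesis by (simp add: sums_unique[symmetric] mult.assoc cis_mult inner_add_left distrib_left)
    qed
    ultimately show ?thesis by (simp add: c_def)
  qed
  then show thesis by (rule that)
qed

text \<open>Entire functions on a line form an integral domain; any two points lie on a common line.\<close>

lemma band_limited_product_zero:
  fixes G1 G2 :: "real^'n \<Rightarrow> complex"
  assumes G1: "integrable lborel G1" "\<And>\<xi>. norm \<xi> > R1 \<Longrightarrow> G1 \<xi> = 0"
    and G2: "integrable lborel G2" "\<And>\<xi>. norm \<xi> > R2 \<Longrightarrow> G2 \<xi> = 0"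
  defines "u1 \<equiv> \<lambda>x. LINT \<xi>|lborel. G1 \<xi> * cis (2 * pi * (x \<bullet> \<xi>))"
    and "u2 \<equiv> \<lambda>x. LINT \<xi>|lborel. G2 \<xi> * cis (2 * pi * (x \<bullet> \<xi>))"
  assumes prod: "\<And>x. u1 x * u2 x = 0"
  shows "(\<forall>x. u1 x = 0) \<or> (\<forall>x. u2 x = 0)"
proof (rule ccontr)
  assume "\<not> ?thesis"
  then obtain a b where ab: "u1 a \<noteq> 0" "u2 b \<noteq> 0" by blast
  \<comment> \<open>The line passes through \<open>a\<close> at parameter 0 and through
    \<open>b\<close> at parameter 1: the first series is nonzero at 0, and the second would have to
    be nonzero at 1.\<close>
  define d where "d = b - a"
  obtain c1 where c1: "\<And>t::real. (\<lambda>n. c1 n * complex_of_real t ^ n) sums u1 (a + t *\<^sub>R d)"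
    unfolding u1_def using band_limited_power_series[OF G1] by blast
  obtain c2 where c2: "\<And>t::real. (\<lambda>n. c2 n * complex_of_real t ^ n) sums u2 (a + t *\<^sub>R d)"
    unfolding u2_def using band_limited_power_series[OF G2] by blast
  \<comment> \<open>Convergence at a real point beyond \<open>norm z\<close> forces convergence at
    \<open>z\<close>, so convergence on the real line gives an entire function.\<close>
  have ent: "summable (\<lambda>n. c n * z ^ n)" if c: "\<And>t::real. summable (\<lambda>n. c n * complex_of_real t ^ n)" for c :: "nat \<Rightarrow> complex" and z
  proof -
    have "norm z < norm (complex_of_real (norm z + 1))" by simp
    from powser_inside[OF c this] show ?thesis .
  qed
  define e1 where "e1 z = (\<Sum>n. c1 n * z ^ n)" for z
  define e2 where "e2 z = (\<Sum>n. c2 n * z ^ n)" for z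
  have s1: "summable (\<lambda>n. c1 n * z ^ n)" and s2: "summable (\<lambda>n. c2 n * z ^ n)" for z
    by (rule ent; use c1 c2 in \<open>blast intro: sums_summable\<close>)+
  have e1: "e1 (complex_of_real t) = u1 (a + t *\<^sub>R d)" and e2: "e2 (complex_of_real t) = u2 (a + t *\<^sub>R d)" for t
    unfolding e1_def e2_def using c1[of t] c2[of t] by (auto simp: sums_iff)
  have "isCont e1 0" unfolding e1_def[abs_def] by (rule isCont_powser_converges_everywhere) (rule s1)
  moreover have "e1 0 \<noteq> 0" using e1[of 0] ab by simp
  ultimately obtain r where r: "r > 0" "\<And>z. dist 0 z < r \<Longrightarrow> e1 z \<noteq> 0"
    using continuous_at_avoid[of 0 e1 0] by auto
  have z2: "e2 (complex_of_real t) = 0" if "\<bar>t\<bar> < r" for t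
    using r(2)[of "complex_of_real t"] that prod[of "a + t *\<^sub>R d"] by (simp add: e1 e2 dist_norm)
  have e20: "e2 0 = 0" using z2[of 0] r by simp
  have c20: "c2 0 = 0"
    using powser_zero[of c2] e20 by (simp add: e2_def)
  have "c2 m = 0" for m
  proof (rule ccontr)
    assume m: "c2 m \<noteq> 0"
    then have "m > 0" using c20 by (cases m) auto
    \<comment> \<open>A power series that vanishes at 0 but has a nonzero coefficient has an
      isolated zero there, whereas \<open>e2\<close> vanishes at all real points within
      \<open>r\<close> of 0.\<close>
    obtain s where s: "0 < s" "\<And>z. z \<in> cball 0 s - {0} \<Longrightarrow> e2 z \<noteq> 0"
    proof (rule powser_0_nonzero[of 1 0 c2 e2 m])
      show "(\<lambda>n. c2 n * (x - 0) ^ n) sums e2 x" for x unfolding e2_def using s2[of x] by (simp add: summable_sums)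
    qed (use m \<open>m > 0\<close> e20 in auto)
    have "complex_of_real (min s (r / 2)) \<in> cball 0 s - {0}" using s r by simp
    moreover have "\<bar>min s (r / 2)\<bar> < r" using s(1) r(1) by (auto simp: min_def)
    ultimately show False using s(2) z2 by blast
  qed
  then have "u2 (a + 1 *\<^sub>R d) = 0" using e2[of 1] by (simp add: e2_def)
  then show False using ab by (simp add: d_def)
qed

section \<open>Uniqueness of transforms of compactly supported functions\<close>

text \<open>By hypothesis \<open>G\<close> annihilates all trigonometric functions. On the ball
  these lie in a uniformly dense ring of functions that \<open>G\<close> annihilates too, so it
  annihilates continuous functions, then indicators of closed sets as their limits, and finite
  measures are determined on closed sets.\<close>

lemma fourier_uniqueness_compact:
  fixes G :: "real^'n \<Rightarrow> complex"
  assumes G: "integrable lborel G" "\<And>\<xi>. norm \<xi> > R \<Longrightarrow> G \<xi> = 0"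
    and zero: "\<And>x. (LINT \<xi>|lborel. G \<xi> * cis (2 * pi * (x \<bullet> \<xi>))) = 0"
  shows "AE \<xi> in lborel. G \<xi> = 0"
proof -
  have [measurable]: "G \<in> borel_measurable borel" using G by auto
  define S where "S = cball (0::real^'n) R"
  define HH where "HH = {H :: real^'n \<Rightarrow> complex. integrable lborel H \<and> (\<forall>\<xi>. norm \<xi> > R \<longrightarrow> H \<xi> = 0) \<and>
     (\<forall>x. (LINT \<xi>|lborel. H \<xi> * cis (2 * pi * (x \<bullet> \<xi>))) = 0)}"
  text \<open>The multipliers of \<open>HH\<close> form a ring for trivial reasons, and they contain the
    trigonometric functions, hence Stone--Weierstrass applies to them.\<close>
  define RR where "RR = {\<phi> :: real^'n \<Rightarrow> real. continuous_on UNIV \<phi> \<and> (\<forall>H\<in>HH. (\<lambda>\<xi>. of_real (\<phi> \<xi>) * H \<xi>) \<in> HH)}"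
  have GH: "G \<in> HH" using G zero by (simp add: HH_def)
  have HH_cis: "(LINT \<xi>|lborel. H \<xi> * cis (2 * pi * (x \<bullet> \<xi>))) = 0" and HH_int: "integrable lborel (\<lambda>\<xi>. H \<xi> * cis (2 * pi * (x \<bullet> \<xi>)))"
    if "H \<in> HH" for H x
  proof -
    show "(LINT \<xi>|lborel. H \<xi> * cis (2 * pi * (x \<bullet> \<xi>))) = 0" using that by (auto simp: HH_def)
    have [measurable]: "H \<in> borel_measurable borel" using that by (auto simp: HH_def)
    show "integrable lborel (\<lambda>\<xi>. H \<xi> * cis (2 * pi * (x \<bullet> \<xi>)))"
      by (rule Bochner_Integration.integrable_bound[of lborel H]) (use that in \<open>auto simp: HH_def norm_mult\<close>)
  qed
  have bounded_mult: "integrable lborel (\<lambda>\<xi>. of_real (\<phi> \<xi>) * H \<xi>)" if "continuous_on UNIV \<phi>" "H \<in> HH" for \<phi> :: "real^'n \<Rightarrow> real" and H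
  proof -
    have [measurable]: "\<phi> \<in> borel_measurable borel" using that(1) by (rule borel_measurable_continuous_onI)
    have H: "integrable lborel H" "\<And>\<xi>. norm \<xi> > R \<Longrightarrow> H \<xi> = 0" using that(2) by (auto simp: HH_def)
    then have [measurable]: "H \<in> borel_measurable borel" by auto
    have "compact (\<phi> ` S)" unfolding S_def by (intro compact_continuous_image continuous_on_subset[OF that(1)]) auto
    then obtain B where B: "\<And>\<xi>. \<xi> \<in> S \<Longrightarrow> \<bar>\<phi> \<xi>\<bar> \<le> B" by (force dest!: compact_imp_bounded simp: bounded_iff)
    have bd: "cmod (of_real (\<phi> \<xi>) * H \<xi>) \<le> norm (\<bar>B\<bar> * cmod (H \<xi>))" for \<xi>
    proof (cases "norm \<xi> > R")
      case False
      then have "\<bar>\<phi> \<xi>\<bar> \<le> \<bar>B\<bar>" using B[of \<xi>] by (auto simp: S_def)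
      then show ?thesis by (simp add: norm_mult mult_right_mono)
    qed (simp add: H)
    have "integrable lborel (\<lambda>\<xi>. \<bar>B\<bar> * cmod (H \<xi>))" using H(1) by (intro integrable_mult_right integrable_norm)
    then show ?thesis
    proof (rule Bochner_Integration.integrable_bound)
      show "AE \<xi> in lborel. norm (of_real (\<phi> \<xi>) * H \<xi>) \<le> norm (\<bar>B\<bar> * cmod (H \<xi>))"
        by (intro AE_I2 bd)
    qed measurable
  qed
  \<comment> \<open>The real part of a modulation is the mean of two opposite ones, which only shift
    \<open>x\<close> to \<open>x + y\<close> and \<open>x - y\<close>. Vanishing for every
    \<open>x\<close> is therefore inherited by the product.\<close>
  have trig: "(\<lambda>\<xi>. Re (w * cis (2 * pi * (y \<bullet> \<xi>)))) \<in> RR" for w :: complex and y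
    unfolding RR_def
  proof (intro CollectI conjI ballI)
    show cont: "continuous_on UNIV (\<lambda>\<xi>. Re (w * cis (2 * pi * (y \<bullet> \<xi>))))" by (intro continuous_intros)
    fix H assume H: "H \<in> HH"
    show "(\<lambda>\<xi>. of_real (Re (w * cis (2 * pi * (y \<bullet> \<xi>)))) * H \<xi>) \<in> HH"
      unfolding HH_def
    proof (intro CollectI conjI allI impI)
      show "integrable lborel (\<lambda>\<xi>. of_real (Re (w * cis (2 * pi * (y \<bullet> \<xi>)))) * H \<xi>)" by (rule bounded_mult[OF cont H])
      show "of_real (Re (w * cis (2 * pi * (y \<bullet> \<xi>)))) * H \<xi> = 0" if "norm \<xi> > R" for \<xi>
        using that H by (simp add: HH_def)
      fix x
      have "of_real (Re (w * cis (2 * pi * (y \<bullet> \<xi>)))) * H \<xi> * cis (2 * pi * (x \<bullet> \<xi>))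
        = (w / 2) * (H \<xi> * cis (2 * pi * ((x + y) \<bullet> \<xi>))) + (cnj w / 2) * (H \<xi> * cis (2 * pi * ((x - y) \<bullet> \<xi>)))" for \<xi>
      proof -
        let ?z = "w * cis (2 * pi * (y \<bullet> \<xi>))"
        have R: "complex_of_real (Re z) = (z + cnj z) / 2" for z by (simp add: complex_add_cnj)
        have p: "cis (2 * pi * ((x + y) \<bullet> \<xi>)) = cis (2 * pi * (x \<bullet> \<xi>)) * cis (2 * pi * (y \<bullet> \<xi>))"
          by (simp add: cis_mult inner_add_left distrib_left)
        have m: "cis (2 * pi * ((x - y) \<bullet> \<xi>)) = cis (2 * pi * (x \<bullet> \<xi>)) * cnj (cis (2 * pi * (y \<bullet> \<xi>)))"
          by (simp add: cis_cnj cis_mult inner_diff_left right_diff_distrib)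
        show ?thesis unfolding R[of ?z] p m complex_cnj_mult by (simp add: field_simps)
      qed
      then show "(LINT \<xi>|lborel. of_real (Re (w * cis (2 * pi * (y \<bullet> \<xi>)))) * H \<xi> * cis (2 * pi * (x \<bullet> \<xi>))) = 0"
        using HH_int[OF H, of "x + y"] HH_int[OF H, of "x - y"] HH_cis[OF H, of "x + y"] HH_cis[OF H, of "x - y"]
        by (simp add: Bochner_Integration.integral_add)
    qed
  qed
  interpret function_ring_on RR S
  proof
    show "compact S" by (simp add: S_def)
    show "continuous_on S f" if "f \<in> RR" for f using that continuous_on_subset by (auto simp: RR_def)
    show "(\<lambda>x. f x * g x) \<in> RR" if "f \<in> RR" "g \<in> RR" for f g
    proof -
      have "(\<lambda>\<xi>. of_real (f \<xi>) * (of_real (g \<xi>) * H \<xi>)) \<in> HH" if "H \<in> HH" for H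
        using that \<open>f \<in> RR\<close> \<open>g \<in> RR\<close> by (simp add: RR_def)
      then show ?thesis using that by (auto simp: RR_def mult.assoc intro!: continuous_intros)
    qed
    show "(\<lambda>x. f x + g x) \<in> RR" if "f \<in> RR" "g \<in> RR" for f g
    proof -
      have "(\<lambda>\<xi>. of_real (f \<xi> + g \<xi>) * H \<xi>) \<in> HH" if H: "H \<in> HH" for H
      proof -
        have fH: "(\<lambda>\<xi>. of_real (f \<xi>) * H \<xi>) \<in> HH" and gH: "(\<lambda>\<xi>. of_real (g \<xi>) * H \<xi>) \<in> HH"
          using H \<open>f \<in> RR\<close> \<open>g \<in> RR\<close> by (auto simp: RR_def)
        have "(LINT \<xi>|lborel. of_real (f \<xi>) * H \<xi> * cis (2 * pi * (x \<bullet> \<xi>)) + of_real (g \<xi>) * H \<xi> * cis (2 * pi * (x \<bullet> \<xi>))) = 0" for x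
          using HH_int[OF fH] HH_int[OF gH] HH_cis[OF fH] HH_cis[OF gH] by (subst Bochner_Integration.integral_add) auto
        then show ?thesis using fH gH by (auto simp: HH_def distrib_right)
      qed
      then show ?thesis using that by (auto simp: RR_def intro!: continuous_intros)
    qed
    show "(\<lambda>_. c) \<in> RR" for c using trig[of "of_real c" 0] by simp
    show "\<exists>f\<in>RR. f x \<noteq> f y" if "x \<in> S" "y \<in> S" "x \<noteq> y" for x y
    proof -
      \<comment> \<open>With this \<open>z\<close> the phases at \<open>x\<close> and
        \<open>y\<close> differ by half a period; the rotation \<open>w\<close> then turns the two
        values into -1 and 1.\<close>
      define z where "z = (1 / (2 * (norm (x - y))\<^sup>2)) *\<^sub>R (x - y)"
      have "z \<bullet> (x - y) = 1 / 2" using \<open>x \<noteq> y\<close> by (simp add: z_def power2_norm_eq_inner)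
      then have zz: "z \<bullet> x = z \<bullet> y + 1/2" by (simp add: inner_diff_right)
      define w where "w = cnj (cis (2 * pi * (z \<bullet> y)))"
      have "w * cis (2 * pi * (z \<bullet> y)) = 1" by (simp add: w_def cis_cnj cis_mult)
      moreover have "w * cis (2 * pi * (z \<bullet> x)) = - 1"
        unfolding zz w_def by (simp add: cis_cnj cis_mult distrib_left)
      ultimately show ?thesis using trig[of w z] by (intro bexI[OF _ trig[of w z]]) simp
    qed
  qed
  have cont0: "(LINT \<xi>|lborel. of_real (\<phi> \<xi>) * G \<xi>) = 0" if \<phi>: "continuous_on UNIV \<phi>" for \<phi> :: "real^'n \<Rightarrow> real"
  proof (rule ccontr)
    assume ne: "(LINT \<xi>|lborel. of_real (\<phi> \<xi>) * G \<xi>) \<noteq> 0"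
    define N where "N = (LINT \<xi>|lborel. cmod (G \<xi>))"
    have N: "N \<ge> 0" unfolding N_def by (rule Bochner_Integration.integral_nonneg) simp
    \<comment> \<open>The divisor \<open>N + 1\<close> is positive even for \<open>N = 0\<close>,
      and it makes the assumed nonzero modulus equal to \<open>e * N + e\<close>, in conflict with
      the bound \<open>e * N\<close>.\<close>
    define e where "e = cmod (LINT \<xi>|lborel. of_real (\<phi> \<xi>) * G \<xi>) / (N + 1)"
    have e: "e > 0" using ne N by (simp add: e_def)
    obtain g where g: "g \<in> RR" "\<And>x. x \<in> S \<Longrightarrow> \<bar>\<phi> x - g x\<bar> < e"
      using Stone_Weierstrass_basic[OF continuous_on_subset[OF \<phi>] e] by blast
    have gG: "(\<lambda>\<xi>. of_real (g \<xi>) * G \<xi>) \<in> HH" using g GH by (simp add: RR_def)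
    have "(LINT \<xi>|lborel. of_real (g \<xi>) * G \<xi>) = 0" using HH_cis[OF gG, of 0] by simp
    then have "(LINT \<xi>|lborel. of_real (\<phi> \<xi>) * G \<xi>) = (LINT \<xi>|lborel. of_real (\<phi> \<xi>) * G \<xi> - of_real (g \<xi>) * G \<xi>)"
      using bounded_mult[OF \<phi> GH] gG by (subst Bochner_Integration.integral_diff) (auto simp: HH_def)
    also have "cmod \<dots> \<le> (LINT \<xi>|lborel. cmod (of_real (\<phi> \<xi>) * G \<xi> - of_real (g \<xi>) * G \<xi>))"
      by (rule integral_norm_bound)
    also have "\<dots> \<le> (LINT \<xi>|lborel. e * cmod (G \<xi>))"
    proof (rule integral_mono)
      show "integrable lborel (\<lambda>\<xi>. cmod (of_real (\<phi> \<xi>) * G \<xi> - of_real (g \<xi>) * G \<xi>))"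
        using bounded_mult[OF \<phi> GH] gG by (auto simp: HH_def)
      show "integrable lborel (\<lambda>\<xi>. e * cmod (G \<xi>))" using G by auto
      fix \<xi>
      have eq: "of_real (\<phi> \<xi>) * G \<xi> - of_real (g \<xi>) * G \<xi> = of_real (\<phi> \<xi> - g \<xi>) * G \<xi>" by (simp add: left_diff_distrib)
      show "cmod (of_real (\<phi> \<xi>) * G \<xi> - of_real (g \<xi>) * G \<xi>) \<le> e * cmod (G \<xi>)"
      proof (cases "norm \<xi> > R")
        case False
        then have "\<bar>\<phi> \<xi> - g \<xi>\<bar> < e" using g(2)[of \<xi>] by (auto simp: S_def)
        then show ?thesis unfolding eq norm_mult norm_of_real by (intro mult_right_mono) auto
      qed (simp add: G)
    qed
    also have "\<dots> = e * N" unfolding N_def by (rule integral_mult_right_zero)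
    finally have "cmod (LINT \<xi>|lborel. of_real (\<phi> \<xi>) * G \<xi>) \<le> e * N" .
    moreover have "cmod (LINT \<xi>|lborel. of_real (\<phi> \<xi>) * G \<xi>) = e * N + e"
      using N by (simp add: e_def field_simps add_nonneg_eq_0_iff)
    ultimately show False using e by simp
  qed
  have closed0: "(LINT \<xi>|lborel. indicator T \<xi> * G \<xi>) = 0" if T: "closed T" for T
  \<comment> \<open>\<open>infdist\<close> to the empty set is 0 by convention, so for
    \<open>T = {}\<close> the functions below would be constantly 1 and not approximate the
    indicator.\<close>
  proof (cases "T = {}")
    case False
    define \<phi> where "\<phi> k \<xi> = max 0 (1 - real k * infdist \<xi> T)" for k :: nat and \<xi>
    have cont: "continuous_on UNIV (\<phi> k)" for k unfolding \<phi>_def by (intro continuous_intros)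
    have [measurable]: "\<phi> k \<in> borel_measurable borel" for k using cont by (rule borel_measurable_continuous_onI)
    have [measurable]: "T \<in> sets borel" using T by auto
    have lim: "(\<lambda>k. \<phi> k \<xi>) \<longlonglongrightarrow> indicator T \<xi>" for \<xi>
    proof (cases "\<xi> \<in> T")
      case True then show ?thesis by (simp add: \<phi>_def)
    next
      case False
      then have p: "infdist \<xi> T > 0"
        using T \<open>T \<noteq> {}\<close> in_closed_iff_infdist_zero infdist_nonneg by (metis less_le)
      obtain k0 :: nat where k0: "1 / infdist \<xi> T < real k0" using reals_Archimedean2 by blast
      have "\<phi> k \<xi> = 0" if "k \<ge> k0" for k
      proof -
        have "1 < real k0 * infdist \<xi> T" using k0 p by (simp add: divide_less_eq)
        also have "\<dots> \<le> real k * infdist \<xi> T" using that p by (intro mult_right_mono) auto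
        finally show ?thesis by (simp add: \<phi>_def)
      qed
      then show ?thesis using False by (intro tendsto_eventually) (auto simp: eventually_sequentially)
    qed
    have "(\<lambda>k. LINT \<xi>|lborel. of_real (\<phi> k \<xi>) * G \<xi>) \<longlonglongrightarrow> (LINT \<xi>|lborel. of_real (indicator T \<xi>) * G \<xi>)"
    proof (rule integral_dominated_convergence[where w = "\<lambda>\<xi>. cmod (G \<xi>)"])
      show "AE \<xi> in lborel. (\<lambda>k. of_real (\<phi> k \<xi>) * G \<xi>) \<longlonglongrightarrow> of_real (indicator T \<xi>) * G \<xi>"
        by (intro AE_I2 tendsto_mult tendsto_of_real lim tendsto_const)
      show "AE \<xi> in lborel. cmod (of_real (\<phi> k \<xi>) * G \<xi>) \<le> cmod (G \<xi>)" for k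
      proof (intro AE_I2)
        fix \<xi>
        have "\<bar>\<phi> k \<xi>\<bar> \<le> 1" by (auto simp: \<phi>_def infdist_nonneg)
        then show "cmod (of_real (\<phi> k \<xi>) * G \<xi>) \<le> cmod (G \<xi>)" by (simp add: norm_mult mult_left_le_one_le)
      qed
    qed (use G in auto)
    then have "(\<lambda>k. 0) \<longlonglongrightarrow> (LINT \<xi>|lborel. of_real (indicator T \<xi>) * G \<xi>)" by (simp only: cont0[OF cont])
    then have "(LINT \<xi>|lborel. complex_of_real (indicator T \<xi>) * G \<xi>) = 0" using LIMSEQ_const_iff by metis
    moreover have "complex_of_real (indicator T \<xi>) = indicator T \<xi>" for \<xi> :: "real^'n" by (simp add: indicator_def)
    ultimately show ?thesis by simp
  qed simp
  have real_part: "AE \<xi> in lborel. p \<xi> = 0" if p: "integrable lborel p" and p0: "\<And>T. closed T \<Longrightarrow> (LINT \<xi>|lborel. indicator T \<xi> * p \<xi>) = 0" for p :: "real^'n \<Rightarrow> real"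
  proof -
    have [measurable]: "p \<in> borel_measurable borel" using p by auto
    \<comment> \<open>\<open>ennreal\<close> sends negative reals to 0, so the two densities are the
      positive and the negative part of \<open>p\<close>.\<close>
    define m1 where "m1 = density lborel (\<lambda>\<xi>. ennreal (p \<xi>))"
    define m2 where "m2 = density lborel (\<lambda>\<xi>. ennreal (- p \<xi>))"
    have em: "emeasure m1 T = ennreal (LINT \<xi>|lborel. indicator T \<xi> * max 0 (p \<xi>))"
      "emeasure m2 T = ennreal (LINT \<xi>|lborel. indicator T \<xi> * max 0 (- p \<xi>))" if [measurable]: "T \<in> sets borel" for T
    proof -
      have i: "integrable lborel (\<lambda>\<xi>. indicator T \<xi> * max 0 (p \<xi>))" "integrable lborel (\<lambda>\<xi>. indicator T \<xi> * max 0 (- p \<xi>))"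
        by (rule Bochner_Integration.integrable_bound[OF p]; auto simp: indicator_def)+
      show "emeasure m1 T = ennreal (LINT \<xi>|lborel. indicator T \<xi> * max 0 (p \<xi>))"
        unfolding m1_def by (subst nn_integral_eq_integral[OF i(1), symmetric])
          (auto simp: emeasure_density max_def ennreal_neg indicator_def intro!: nn_integral_cong)
      show "emeasure m2 T = ennreal (LINT \<xi>|lborel. indicator T \<xi> * max 0 (- p \<xi>))"
        unfolding m2_def by (subst nn_integral_eq_integral[OF i(2), symmetric])
          (auto simp: emeasure_density max_def ennreal_neg indicator_def intro!: nn_integral_cong)
    qed
    \<comment> \<open>Both measures are finite and agree on closed sets, which are stable under
      intersection and generate the Borel sets.\<close>
    have "m1 = m2"
    proof (rule measure_eqI_generator_eq[where E = "Collect closed" and \<Omega> = UNIV and A = "\<lambda>_. UNIV"])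
      show "Int_stable (Collect closed :: (real^'n) set set)" by (auto simp: Int_stable_def)
      show "sets m1 = sigma_sets UNIV (Collect closed)" "sets m2 = sigma_sets UNIV (Collect closed)"
        by (simp_all add: m1_def m2_def borel_eq_closed)
      show "emeasure m1 T = emeasure m2 T" if "T \<in> Collect closed" for T
      proof -
        have [measurable]: "T \<in> sets borel" using that by auto
        have i: "integrable lborel (\<lambda>\<xi>. indicator T \<xi> * max 0 (p \<xi>))" "integrable lborel (\<lambda>\<xi>. indicator T \<xi> * max 0 (- p \<xi>))"
          by (rule Bochner_Integration.integrable_bound[OF p]; auto simp: indicator_def)+
        have "(LINT \<xi>|lborel. indicator T \<xi> * max 0 (p \<xi>)) - (LINT \<xi>|lborel. indicator T \<xi> * max 0 (- p \<xi>))
            = (LINT \<xi>|lborel. indicator T \<xi> * max 0 (p \<xi>) - indicator T \<xi> * max 0 (- p \<xi>))"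
          by (rule Bochner_Integration.integral_diff[OF i, symmetric])
        also have "\<dots> = (LINT \<xi>|lborel. indicator T \<xi> * p \<xi>)"
          by (intro Bochner_Integration.integral_cong) (auto simp: indicator_def max_def)
        also have "\<dots> = 0" using p0 that by simp
        finally show ?thesis using em by simp
      qed
      show "emeasure m1 UNIV \<noteq> \<infinity>" for i :: nat using em(1)[of UNIV] by simp
    qed auto
    then have "AE \<xi> in lborel. ennreal (p \<xi>) = ennreal (- p \<xi>)"
      unfolding m1_def m2_def by (subst (asm) sigma_finite_measure.density_unique_iff[OF sigma_finite_lborel]) auto
    then show ?thesis
    proof eventually_elim
      fix \<xi> assume "ennreal (p \<xi>) = ennreal (- p \<xi>)"
      then show "p \<xi> = 0" by (cases "p \<xi> \<ge> 0") (auto simp: ennreal_neg ennreal_eq_0_iff)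
    qed
  qed
  have iT: "integrable lborel (\<lambda>\<xi>. indicator T \<xi> * G \<xi>)" if "closed T" for T
  proof -
    have [measurable]: "T \<in> sets borel" using that by auto
    show ?thesis by (rule Bochner_Integration.integrable_bound[OF G(1)]) (auto simp: indicator_def)
  qed
  have ReI: "(LINT \<xi>|lborel. indicator T \<xi> * Re (G \<xi>)) = 0" and ImI: "(LINT \<xi>|lborel. indicator T \<xi> * Im (G \<xi>)) = 0" if "closed T" for T
  proof -
    have "(LINT \<xi>|lborel. indicator T \<xi> * Re (G \<xi>)) = (LINT \<xi>|lborel. Re (indicator T \<xi> * G \<xi>))"
      by (intro Bochner_Integration.integral_cong) (auto simp: indicator_def)
    then show "(LINT \<xi>|lborel. indicator T \<xi> * Re (G \<xi>)) = 0" using integral_Re[OF iT[OF that]] closed0[OF that] by simp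
    have "(LINT \<xi>|lborel. indicator T \<xi> * Im (G \<xi>)) = (LINT \<xi>|lborel. Im (indicator T \<xi> * G \<xi>))"
      by (intro Bochner_Integration.integral_cong) (auto simp: indicator_def)
    then show "(LINT \<xi>|lborel. indicator T \<xi> * Im (G \<xi>)) = 0" using integral_Im[OF iT[OF that]] closed0[OF that] by simp
  qed
  have "AE \<xi> in lborel. Re (G \<xi>) = 0" "AE \<xi> in lborel. Im (G \<xi>) = 0"
    using G ReI ImI by (auto intro!: real_part)
  then show ?thesis by eventually_elim (simp add: complex_eq_iff)
qed

section \<open>Sign retrieval\<close>

text \<open>A point-indexed family of exceptional null sets may be uncountable; by Lindelof
  countably many of the neighbourhoods suffice.\<close>

lemma locally_null_imp_AE:
  fixes X A :: "'a::euclidean_space set"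
  assumes "\<And>x. x \<in> X \<Longrightarrow> \<exists>U. open U \<and> x \<in> U \<and> (AE y in lborel. y \<in> U \<longrightarrow> P y)"
  shows "AE y in lborel. y \<in> X \<longrightarrow> P y"
proof -
  let ?\<F> = "{U. open U \<and> (AE y in lborel. y \<in> U \<longrightarrow> P y)}"
  obtain \<G> where \<G>: "\<G> \<subseteq> ?\<F>" "countable \<G>" "\<Union>\<G> = \<Union>?\<F>" by (rule Lindelof[of ?\<F>]) auto
  have "AE y in lborel. \<forall>U\<in>\<G>. y \<in> U \<longrightarrow> P y"
    using \<G>(1) by (subst AE_ball_countable[OF \<G>(2)]) auto
  then show ?thesis
  proof eventually_elim
    fix y assume y: "\<forall>U\<in>\<G>. y \<in> U \<longrightarrow> P y"
    show "y \<in> X \<longrightarrow> P y"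
    proof
      assume "y \<in> X"
      then have "y \<in> \<Union>?\<F>" using assms by blast
      then show "P y" using \<G>(3) y by blast
    qed
  qed
qed

lemma AE_outside_ess_support: "AE x in lborel. x \<notin> ess_support g \<longrightarrow> g x = 0"
  by (rule locally_null_imp_AE[of "- ess_support g" "\<lambda>x. g x = 0", simplified])
    (auto simp: ess_support_def)

lemma closed_ess_support: "closed (ess_support g)"
  unfolding ess_support_def by (auto intro!: open_Union)

text \<open>The correlations are real, so equal moduli mean that their difference times their sum is
  0. Both factors are band-limited, hence one vanishes identically, and uniqueness of transforms
  carries this back to the frequencies.\<close>

lemma correlation_sign_dichotomy:
  fixes f g \<psi> :: "real^'n \<Rightarrow> real" and h :: "real^'n^'n"
  assumes h: "invertible h" and f: "square_integrable f" and g: "square_integrable g" and \<psi>: "square_integrable \<psi>"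
    and S: "compact (ess_support (fourier_L2 \<psi>))"
    and eq: "\<And>x. \<bar>Defs.convolution g (involution (dilate h \<psi>)) x\<bar> = \<bar>Defs.convolution f (involution (dilate h \<psi>)) x\<bar>"
  shows "(AE \<xi> in lborel. fourier_L2 \<psi> (transpose h *v \<xi>) \<noteq> 0 \<longrightarrow> fourier_L2 g \<xi> = fourier_L2 f \<xi>) \<or>
         (AE \<xi> in lborel. fourier_L2 \<psi> (transpose h *v \<xi>) \<noteq> 0 \<longrightarrow> fourier_L2 g \<xi> = - fourier_L2 f \<xi>)"
proof -
  define F where "F = fourier_L2 f"
  define G where "G = fourier_L2 g"
  define \<Psi> where "\<Psi> = fourier_L2 \<psi>"
  have sq: "square_integrable F" "square_integrable G" "square_integrable \<Psi>"
    using is_fourier_L2_fourier_L2[OF f] is_fourier_L2_fourier_L2[OF g] is_fourier_L2_fourier_L2[OF \<psi>]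
    by (auto simp: is_fourier_L2_iff F_def G_def \<Psi>_def)
  have [measurable]: "F \<in> borel_measurable borel" "G \<in> borel_measurable borel" "\<Psi> \<in> borel_measurable borel"
    using sq by auto
  let ?S = "ess_support \<Psi>"
  have S': "compact ?S" using S by (simp add: \<Psi>_def)
  then have [measurable]: "?S \<in> sets borel" by (rule borel_compact)
  have hT: "invertible (transpose h)" using h by (simp add: invertible_det_nz)
  have [measurable]: "(\<lambda>x. transpose h *v x) \<in> borel \<rightarrow>\<^sub>M borel"
    by (intro borel_measurable_continuous_onI continuous_intros)
  \<comment> \<open>Off its essential support \<open>\<Psi>\<close> vanishes only almost everywhere,
    while the results on band-limited functions ask for vanishing at every point outside a ball.
    \<open>\<Phi>\<close> is the representative corrected on a null set.\<close>
  define \<Phi> where "\<Phi> \<xi> = (if transpose h *v \<xi> \<in> ?S then \<Psi> (transpose h *v \<xi>) else 0)" for \<xi>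
  have [measurable]: "\<Phi> \<in> borel_measurable borel" unfolding \<Phi>_def[abs_def] by measurable
  have "AE \<xi> in lborel. \<xi> \<notin> ?S \<longrightarrow> \<Psi> \<xi> = 0" by (rule AE_outside_ess_support)
  then have "{\<xi>. \<not> (\<xi> \<notin> ?S \<longrightarrow> \<Psi> \<xi> = 0)} \<in> null_sets lborel"
    by (subst (asm) AE_iff_null) auto
  from null_sets_linear_vimage[OF hT this]
  have "AE \<xi> in lborel. \<xi> \<notin> {x. transpose h *v x \<in> {\<xi>. \<not> (\<xi> \<notin> ?S \<longrightarrow> \<Psi> \<xi> = 0)}}" by (rule AE_not_in)
  then have \<Phi>_AE: "AE \<xi> in lborel. \<Phi> \<xi> = \<Psi> (transpose h *v \<xi>)"
    by eventually_elim (auto simp: \<Phi>_def)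
  obtain c where c: "c > 0"
    "\<And>f :: real^'n \<Rightarrow> ennreal. f \<in> borel_measurable borel \<Longrightarrow> (\<integral>\<^sup>+x. f (transpose h *v x) \<partial>lborel) = ennreal c * (\<integral>\<^sup>+x. f x \<partial>lborel)"
    by (rule linear_substitution[OF hT]) (rule that)
  have \<Phi>_sq: "square_integrable \<Phi>"
  proof -
    have "L2dist \<Phi> (\<lambda>_. 0) = (\<integral>\<^sup>+\<xi>. ennreal ((cmod (\<Psi> (transpose h *v \<xi>)))\<^sup>2) \<partial>lborel)"
      unfolding L2dist_def diff_zero
    proof (rule nn_integral_cong_AE)
      show "AE \<xi> in lborel. ennreal ((cmod (\<Phi> \<xi>))\<^sup>2) = ennreal ((cmod (\<Psi> (transpose h *v \<xi>)))\<^sup>2)"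
        using \<Phi>_AE by eventually_elim simp
    qed
    also have "\<dots> = ennreal c * L2dist \<Psi> (\<lambda>_. 0)"
      unfolding L2dist_def diff_zero by (rule c(2)[of "\<lambda>\<xi>. ennreal ((cmod (\<Psi> \<xi>))\<^sup>2)"]) measurable
    finally show ?thesis using sq(3) by (simp add: square_integrable_iff ennreal_mult_less_top)
  qed
  obtain R where R: "\<And>\<xi>. norm \<xi> > R \<Longrightarrow> \<Phi> \<xi> = 0"
  proof -
    have "compact ((\<lambda>x. matrix_inv (transpose h) *v x) ` ?S)"
      by (intro compact_continuous_image S' continuous_intros)
    then obtain R where R: "\<And>\<xi>. \<xi> \<in> ?S \<Longrightarrow> norm (matrix_inv (transpose h) *v \<xi>) \<le> R"
      by (force dest!: compact_imp_bounded simp: bounded_iff)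
    have "\<Phi> \<xi> = 0" if "norm \<xi> > R" for \<xi>
    proof -
      have "matrix_inv (transpose h) *v (transpose h *v \<xi>) = \<xi>"
        unfolding matrix_vector_mul_assoc matrix_inv_cancel[OF hT] by simp
      then show ?thesis using R[of "transpose h *v \<xi>"] that by (auto simp: \<Phi>_def simp del: transpose_matrix_vector)
    qed
    then show thesis by (rule that)
  qed
  \<comment> \<open>For \<open>s = -1\<close> and \<open>s = 1\<close> this is, up to the factor
    \<open>\<kappa>\<close>, the spectrum of the difference and of the sum of the two
    correlations.\<close>
  define Q where "Q s \<xi> = (G \<xi> + s * F \<xi>) * cnj (\<Phi> \<xi>)" for s \<xi>
  have Q_int: "integrable lborel (Q s)" for s
    unfolding Q_def[abs_def] by (intro square_integrable_inner square_integrable_add sq \<Phi>_sq)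
  have Q_supp: "Q s \<xi> = 0" if "norm \<xi> > R" for s \<xi> using R[OF that] by (simp add: Q_def)
  obtain \<kappa> where \<kappa>: "\<kappa> > 0"
    "\<And>f x. square_integrable f \<Longrightarrow> complex_of_real (Defs.convolution f (involution (dilate h \<psi>)) x)
       = of_real \<kappa> * (LINT \<xi>|lborel. fourier_L2 f \<xi> * cnj (fourier_L2 \<psi> (transpose h *v \<xi>)) * cis (2 * pi * (x \<bullet> \<xi>)))"
    by (rule correlation_fourier[OF h \<psi>]) (rule that)
  define w where "w K x = (LINT \<xi>|lborel. K \<xi> * cnj (\<Phi> \<xi>) * cis (2 * pi * (x \<bullet> \<xi>)))" for K :: "real^'n \<Rightarrow> complex" and x
  have w_int: "integrable lborel (\<lambda>\<xi>. K \<xi> * cnj (\<Phi> \<xi>) * cis (2 * pi * (x \<bullet> \<xi>)))" if "square_integrable K" for K x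
  proof -
    have [measurable]: "K \<in> borel_measurable borel" using that by auto
    show ?thesis
      by (rule Bochner_Integration.integrable_bound[OF square_integrable_inner[OF that \<Phi>_sq]]) (auto simp: norm_mult)
  qed
  have w: "(LINT \<xi>|lborel. K \<xi> * cnj (fourier_L2 \<psi> (transpose h *v \<xi>)) * cis (2 * pi * (x \<bullet> \<xi>))) = w K x"
    if [measurable]: "K \<in> borel_measurable borel" for K x
  proof -
    have m: "(\<lambda>\<xi>. K \<xi> * cnj (\<Psi> (transpose h *v \<xi>)) * cis (2 * pi * (x \<bullet> \<xi>))) \<in> borel_measurable lborel"
      "(\<lambda>\<xi>. K \<xi> * cnj (\<Phi> \<xi>) * cis (2 * pi * (x \<bullet> \<xi>))) \<in> borel_measurable lborel" by measurable
    have "AE \<xi> in lborel. K \<xi> * cnj (\<Psi> (transpose h *v \<xi>)) * cis (2 * pi * (x \<bullet> \<xi>)) = K \<xi> * cnj (\<Phi> \<xi>) * cis (2 * pi * (x \<bullet> \<xi>))"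
      using \<Phi>_AE by eventually_elim simp
    from integral_cong_AE[OF m this] show ?thesis unfolding w_def \<Psi>_def .
  qed
  have wQ: "(LINT \<xi>|lborel. Q s \<xi> * cis (2 * pi * (x \<bullet> \<xi>))) = w G x + s * w F x" for s x
  proof -
    have "(LINT \<xi>|lborel. Q s \<xi> * cis (2 * pi * (x \<bullet> \<xi>)))
       = (LINT \<xi>|lborel. G \<xi> * cnj (\<Phi> \<xi>) * cis (2 * pi * (x \<bullet> \<xi>)) + s * (F \<xi> * cnj (\<Phi> \<xi>) * cis (2 * pi * (x \<bullet> \<xi>))))"
      unfolding Q_def by (simp only: distrib_right mult.assoc)
    then show ?thesis unfolding w_def
      using w_int[OF sq(2), of x] w_int[OF sq(1), of x] by (simp add: Bochner_Integration.integral_add)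
  qed
  have conv: "complex_of_real (Defs.convolution f (involution (dilate h \<psi>)) x) = of_real \<kappa> * w F x"
    "complex_of_real (Defs.convolution g (involution (dilate h \<psi>)) x) = of_real \<kappa> * w G x" for x
    using \<kappa>(2)[OF f, of x] \<kappa>(2)[OF g, of x] w[of F x] w[of G x]
    by (simp_all only: F_def[symmetric] G_def[symmetric] \<open>F \<in> borel_measurable borel\<close> \<open>G \<in> borel_measurable borel\<close>)
  have prod: "(LINT \<xi>|lborel. Q (-1) \<xi> * cis (2 * pi * (x \<bullet> \<xi>))) * (LINT \<xi>|lborel. Q 1 \<xi> * cis (2 * pi * (x \<bullet> \<xi>))) = 0" for x
  proof -
    let ?p = "Defs.convolution g (involution (dilate h \<psi>)) x" and ?q = "Defs.convolution f (involution (dilate h \<psi>)) x"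
    have "(?p - ?q) * (?p + ?q) = 0" using eq[of x] by (auto simp: abs_eq_iff)
    then have "complex_of_real ((?p - ?q) * (?p + ?q)) = 0" by (simp only: of_real_0)
    then have "(of_real \<kappa> * w G x - of_real \<kappa> * w F x) * (of_real \<kappa> * w G x + of_real \<kappa> * w F x) = 0"
      by (simp only: of_real_mult of_real_diff of_real_add conv)
    then have "of_real \<kappa> * (w G x - w F x) * (of_real \<kappa> * (w G x + w F x)) = 0"
      by (simp only: right_diff_distrib distrib_left)
    then show ?thesis unfolding wQ using \<kappa>(1) by auto
  qed
  have zero: "AE \<xi> in lborel. \<Psi> (transpose h *v \<xi>) \<noteq> 0 \<longrightarrow> G \<xi> = - s * F \<xi>"
    if "\<forall>x. (LINT \<xi>|lborel. Q s \<xi> * cis (2 * pi * (x \<bullet> \<xi>))) = 0" for s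
  proof -
    have "AE \<xi> in lborel. Q s \<xi> = 0"
      using that by (intro fourier_uniqueness_compact[OF Q_int Q_supp]) auto
    then show ?thesis using \<Phi>_AE
      by eventually_elim (auto simp: Q_def add_eq_0_iff2)
  qed
  have "(\<forall>x. (LINT \<xi>|lborel. Q (-1) \<xi> * cis (2 * pi * (x \<bullet> \<xi>))) = 0) \<or> (\<forall>x. (LINT \<xi>|lborel. Q 1 \<xi> * cis (2 * pi * (x \<bullet> \<xi>))) = 0)"
    by (rule band_limited_product_zero[OF Q_int Q_supp Q_int Q_supp prod])
  then show ?thesis using zero[of "-1"] zero[of 1] by (auto simp: F_def G_def \<Psi>_def simp del: transpose_matrix_vector)
qed

section \<open>From a sign for each dilate to a single sign\<close>

theorem theorem2p12:
  fixes H :: "(real^'n^'n) set"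
    and \<mu> :: "(real^'n^'n) measure"
    and \<psi> f :: "real^'n \<Rightarrow> real"
    and F V :: "(real^'n) set"
  assumes "irreducibly_admissible H"
    and "left_Haar_measure H \<mu>"
    and "square_integrable \<psi>"
    and "\<not> (AE x in lborel. \<psi> x = 0)"
    and "compact (ess_support (fourier_L2 \<psi>))"
    and "ess_support (fourier_L2 \<psi>) \<subseteq> open_dual_orbit H"
    and "AE \<xi> in lborel.
           (\<integral>\<^sup>+h. ennreal ((cmod (fourier_L2 \<psi> (transpose h *v \<xi>)))\<^sup>2) \<partial>\<mu>) = 1"
    and "square_integrable f"
    and "\<not> (AE x in lborel. f x = 0)"
    and "F = interior (ess_support (fourier_L2 f))"
    and "V = interior (ess_support (fourier_L2 \<psi>))"
    and "frontier F \<in> null_sets lborel"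
    and "frontier V \<in> null_sets lborel"
    and "ess_support (fourier_L2 f) \<subseteq> closure F"
    and "connected (F \<inter> open_dual_orbit H)"
  shows "uniquely_sign_retrievable H \<psi> f"
  unfolding uniquely_sign_retrievable_def
proof (intro allI impI)
  fix g :: "real^'n \<Rightarrow> real"
  assume g: "square_integrable g"
    and eq: "\<forall>h\<in>H. \<forall>x. \<bar>Defs.convolution g (involution (dilate h \<psi>)) x\<bar> = \<bar>Defs.convolution f (involution (dilate h \<psi>)) x\<bar>"
  note \<mu> = assms(2) and \<psi> = assms(3) and f = assms(8)
  have H: "closed_matrix_group H" using assms(1) by (simp add: irreducibly_admissible_def)
  define Orb where "Orb = open_dual_orbit H"
  have "is_open_dual_orbit H Orb"
    using assms(1) unfolding irreducibly_admissible_def Orb_def open_dual_orbit_def by (blast intro: theI')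
  then obtain \<xi>0 where Orb: "open (dual_orbit H \<xi>0)" "Orb = dual_orbit H \<xi>0"
    unfolding is_open_dual_orbit_def by blast
  define \<Psi> where "\<Psi> = fourier_L2 \<psi>"
  define Ff where "Ff = fourier_L2 f"
  define Gg where "Gg = fourier_L2 g"
  have sq: "square_integrable Ff" "square_integrable Gg" "square_integrable \<Psi>"
    using is_fourier_L2_fourier_L2[OF f] is_fourier_L2_fourier_L2[OF g] is_fourier_L2_fourier_L2[OF \<psi>]
    by (auto simp: is_fourier_L2_iff Ff_def Gg_def \<Psi>_def)
  have [measurable]: "Ff \<in> borel_measurable borel" "Gg \<in> borel_measurable borel" "\<Psi> \<in> borel_measurable borel"
    using sq by auto
  define W where "W = {\<xi>. \<Psi> \<xi> \<noteq> 0}"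
  have W [measurable]: "W \<in> sets borel" unfolding W_def by measurable
  \<comment> \<open>If \<open>transpose h *v \<xi>\<close> met \<open>W\<close> only for a null set
    of \<open>h\<close>, the admissibility integral at \<open>\<xi>\<close> would be 0 instead of
    1.\<close>
  have pos: "AE \<xi> in lborel. emeasure \<mu> {h \<in> H. transpose h *v \<xi> \<in> W} \<noteq> 0"
    using assms(7)
  proof eventually_elim
    fix \<xi> assume one: "(\<integral>\<^sup>+h. ennreal ((cmod (fourier_L2 \<psi> (transpose h *v \<xi>)))\<^sup>2) \<partial>\<mu>) = 1"
    show "emeasure \<mu> {h \<in> H. transpose h *v \<xi> \<in> W} \<noteq> 0"
    proof
      assume "emeasure \<mu> {h \<in> H. transpose h *v \<xi> \<in> W} = 0"
      then have "{h \<in> H. transpose h *v \<xi> \<in> W} \<in> null_sets \<mu>"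
        using emeasure_Haar_orbit(2)[OF H \<mu> W] by (auto simp: null_sets_def)
      from AE_not_in[OF this] AE_space
      have "AE h in \<mu>. ennreal ((cmod (fourier_L2 \<psi> (transpose h *v \<xi>)))\<^sup>2) = 0"
        by eventually_elim (auto simp: Haar_space[OF H \<mu>] W_def \<Psi>_def simp del: transpose_matrix_vector)
      then have "(\<integral>\<^sup>+h. ennreal ((cmod (fourier_L2 \<psi> (transpose h *v \<xi>)))\<^sup>2) \<partial>\<mu>) = (\<integral>\<^sup>+h. 0 \<partial>\<mu>)"
        by (rule nn_integral_cong_AE)
      then show False using one by simp
    qed
  qed
  \<comment> \<open>For almost every \<open>\<xi>\<close> some \<open>h\<close> carries it into
    \<open>W\<close>, and even into the essential support, since the rest of \<open>W\<close> is
    null and thus invisible along almost every orbit map. The support lies in the orbit, which the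
    inverse of \<open>h\<close> preserves.\<close>
  have AE_Orb: "AE \<xi> in lborel. \<xi> \<in> Orb"
  proof -
    let ?S = "ess_support \<Psi>"
    have [measurable]: "?S \<in> sets borel" using closed_ess_support by (rule borel_closed)
    have "AE \<xi> in lborel. \<not> (\<xi> \<in> W \<and> \<xi> \<notin> ?S)"
      using AE_outside_ess_support[of \<Psi>] by eventually_elim (auto simp: W_def)
    then have N: "{\<xi>. \<xi> \<in> W \<and> \<xi> \<notin> ?S} \<in> null_sets lborel"
      by (subst (asm) AE_iff_null) auto
    show ?thesis
      using pos AE_Haar_orbit_null[OF H \<mu> N]
    proof eventually_elim
      fix \<xi> assume 1: "emeasure \<mu> {h \<in> H. transpose h *v \<xi> \<in> W} \<noteq> 0"
        and 2: "emeasure \<mu> {h \<in> H. transpose h *v \<xi> \<in> {\<xi>. \<xi> \<in> W \<and> \<xi> \<notin> ?S}} = 0"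
      have "\<not> {h \<in> H. transpose h *v \<xi> \<in> W} \<subseteq> {h \<in> H. transpose h *v \<xi> \<in> {\<xi>. \<xi> \<in> W \<and> \<xi> \<notin> ?S}}"
      proof
        assume "{h \<in> H. transpose h *v \<xi> \<in> W} \<subseteq> {h \<in> H. transpose h *v \<xi> \<in> {\<xi>. \<xi> \<in> W \<and> \<xi> \<notin> ?S}}"
        then have "emeasure \<mu> {h \<in> H. transpose h *v \<xi> \<in> W} \<le> emeasure \<mu> {h \<in> H. transpose h *v \<xi> \<in> {\<xi>. \<xi> \<in> W \<and> \<xi> \<notin> ?S}}"
          using N by (intro emeasure_mono emeasure_Haar_orbit(2)[OF H \<mu>]) auto
        then show False using 1 2 by simp
      qed
      then obtain h where h: "h \<in> H" "transpose h *v \<xi> \<in> ?S" by blast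
      then have "transpose h *v \<xi> \<in> Orb" using assms(6) by (auto simp: Orb_def \<Psi>_def)
      then have "transpose (matrix_inv h) *v (transpose h *v \<xi>) \<in> Orb"
        unfolding Orb(2) by (rule dual_orbit_step[OF H matrix_group_matrix_inv[OF H h(1)]])
      then show "\<xi> \<in> Orb" unfolding transpose_mult_vec using matrix_group_inv_mult[OF H h(1)] by simp
    qed
  qed
  have dich: "(AE \<xi> in lborel. transpose h *v \<xi> \<in> W \<longrightarrow> Gg \<xi> = Ff \<xi>) \<or>
      (AE \<xi> in lborel. transpose h *v \<xi> \<in> W \<longrightarrow> Gg \<xi> = - Ff \<xi>)" if "h \<in> H" for h
    using correlation_sign_dichotomy[OF matrix_group_invertible[OF H that] f g \<psi> assms(5)] eq that
    by (simp add: W_def \<Psi>_def Ff_def Gg_def del: transpose_matrix_vector)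
  have null: "{\<zeta> \<in> A. transpose h *v \<zeta> \<in> W} \<in> null_sets lborel"
    if "AE \<xi> in lborel. transpose h *v \<xi> \<in> W \<longrightarrow> P \<xi>" "\<And>\<xi>. \<xi> \<in> A \<Longrightarrow> \<not> P \<xi>" and [measurable]: "A \<in> sets borel"
    for P A and h :: "real^'n^'n"
  proof -
    have [measurable]: "(\<lambda>x. transpose h *v x) \<in> borel \<rightarrow>\<^sub>M borel"
      by (intro borel_measurable_continuous_onI continuous_intros)
    have "AE \<xi> in lborel. \<not> (\<xi> \<in> A \<and> transpose h *v \<xi> \<in> W)"
      using that(1) by eventually_elim (use that(2) in blast)
    moreover have "{\<xi> \<in> A. transpose h *v \<xi> \<in> W} \<in> sets borel" by measurable
    ultimately show ?thesis by (subst (asm) AE_iff_null) (simp_all del: transpose_matrix_vector)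
  qed
  define N where "N = {\<xi>. Gg \<xi> \<noteq> Ff \<xi> \<and> Gg \<xi> \<noteq> - Ff \<xi>}"
  \<comment> \<open>Requiring \<open>Ff \<xi> \<noteq> 0\<close> makes the two signs exclusive:
    where \<open>Ff\<close> vanishes, both equations say the same.\<close>
  define A1 where "A1 = {\<xi>. Ff \<xi> \<noteq> 0 \<and> Gg \<xi> = Ff \<xi>}"
  define A2 where "A2 = {\<xi>. Ff \<xi> \<noteq> 0 \<and> Gg \<xi> = - Ff \<xi>}"
  have [measurable]: "N \<in> sets borel" "A1 \<in> sets borel" "A2 \<in> sets borel"
    unfolding N_def A1_def A2_def by measurable
  have AE_local: "AE y in lborel. y \<in> U \<longrightarrow> y \<notin> A" if "A \<inter> U \<in> null_sets lborel" for A U :: "(real^'n) set"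
    using AE_not_in[OF that] by eventually_elim auto
  have AE_N: "AE \<xi> in lborel. \<xi> \<notin> N"
  proof -
    have "\<exists>U. open U \<and> \<eta> \<in> U \<and> (AE y in lborel. y \<in> U \<longrightarrow> y \<notin> N)" if \<eta>: "\<eta> \<in> Orb" for \<eta>
    proof -
      have "{\<zeta> \<in> N. transpose h *v \<zeta> \<in> W} \<in> null_sets lborel" if "h \<in> H" for h
        using dich[OF that] by (elim disjE) (erule null; simp add: N_def)+
      \<comment> \<open>With \<open>A\<close> and \<open>B\<close> both equal to \<open>N\<close>
        the alternative of \<open>locally_separated\<close> collapses and leaves \<open>N\<close>
        null near \<open>\<eta>\<close>.\<close>
      then obtain U where "open U" "\<eta> \<in> U" "N \<inter> U \<in> null_sets lborel"
        using locally_separated[OF H \<mu> Orb(1) W _ _ pos _ \<eta>[unfolded Orb(2)], of N N] by auto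
      then show ?thesis using AE_local by blast
    qed
    then have "AE \<xi> in lborel. \<xi> \<in> Orb \<longrightarrow> \<xi> \<notin> N" by (rule locally_null_imp_AE)
    with AE_Orb show ?thesis by eventually_elim auto
  qed
  \<comment> \<open>Within the window of each \<open>h\<close> one of the two sets is null: the plus
    sign excludes \<open>A2\<close>, the minus sign excludes \<open>A1\<close>.\<close>
  have sep: "\<exists>U. open U \<and> \<eta> \<in> U \<and> ((AE y in lborel. y \<in> U \<longrightarrow> y \<notin> A1) \<or> (AE y in lborel. y \<in> U \<longrightarrow> y \<notin> A2))"
    if \<eta>: "\<eta> \<in> Orb" for \<eta>
  proof -
    have "{\<zeta> \<in> A1. transpose h *v \<zeta> \<in> W} \<in> null_sets lborel \<or> {\<zeta> \<in> A2. transpose h *v \<zeta> \<in> W} \<in> null_sets lborel"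
      if "h \<in> H" for h
      using dich[OF that]
    proof
      assume "AE \<xi> in lborel. transpose h *v \<xi> \<in> W \<longrightarrow> Gg \<xi> = Ff \<xi>"
      then have "{\<zeta> \<in> A2. transpose h *v \<zeta> \<in> W} \<in> null_sets lborel" by (rule null) (auto simp: A2_def)
      then show ?thesis ..
    next
      assume "AE \<xi> in lborel. transpose h *v \<xi> \<in> W \<longrightarrow> Gg \<xi> = - Ff \<xi>"
      then have "{\<zeta> \<in> A1. transpose h *v \<zeta> \<in> W} \<in> null_sets lborel" by (rule null) (auto simp: A1_def)
      then show ?thesis ..
    qed
    then obtain U where "open U" "\<eta> \<in> U" "A1 \<inter> U \<in> null_sets lborel \<or> A2 \<inter> U \<in> null_sets lborel"
      using locally_separated[OF H \<mu> Orb(1) W _ _ pos _ \<eta>[unfolded Orb(2)], of A1 A2] by auto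
    then show ?thesis using AE_local by blast
  qed
  define X where "X = F \<inter> Orb"
  \<comment> \<open>\<open>X1\<close> and \<open>X2\<close> are the largest open sets in which
    \<open>A1\<close>, respectively \<open>A2\<close>, is null. The unions may be uncountable, so
    nullity in the whole of them rests on \<open>locally_null_imp_AE\<close>.\<close>
  define X1 where "X1 = \<Union>{U. open U \<and> (AE y in lborel. y \<in> U \<longrightarrow> y \<notin> A1)}"
  define X2 where "X2 = \<Union>{U. open U \<and> (AE y in lborel. y \<in> U \<longrightarrow> y \<notin> A2)}"
  have "open X1" "open X2" unfolding X1_def X2_def by (auto intro!: open_Union)
  moreover have "X \<subseteq> X1 \<union> X2" using sep unfolding X_def X1_def X2_def by blast
  moreover have "X1 \<inter> X2 \<inter> X = {}"
  proof (rule ccontr)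
    assume "X1 \<inter> X2 \<inter> X \<noteq> {}"
    then obtain \<eta> U1 U2 where \<eta>: "\<eta> \<in> F" "\<eta> \<in> U1" "\<eta> \<in> U2" "open U1" "open U2"
      and U: "AE y in lborel. y \<in> U1 \<longrightarrow> y \<notin> A1" "AE y in lborel. y \<in> U2 \<longrightarrow> y \<notin> A2"
      unfolding X_def X1_def X2_def by blast
    \<comment> \<open>In the overlap both signs are excluded almost everywhere, which outside
      \<open>N\<close> leaves only \<open>Ff y = 0\<close>. Near a point of \<open>F\<close>,
      interior to the essential support, this is impossible.\<close>
    have "AE y in lborel. y \<in> U1 \<inter> U2 \<longrightarrow> Ff y = 0"
      using U AE_N by eventually_elim (auto simp: A1_def A2_def N_def)
    then have "\<eta> \<notin> ess_support Ff"
      unfolding ess_support_def using \<eta> open_Int by blast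
    then show False using \<eta>(1) interior_subset assms(10) unfolding Ff_def by blast
  qed
  ultimately have "X1 \<inter> X = {} \<or> X2 \<inter> X = {}"
    using assms(15) connectedD[of X X1 X2] by (simp add: X_def Orb_def)
  moreover have "AE \<xi> in lborel. \<xi> \<in> Xi \<longrightarrow> \<xi> \<notin> A" if "Xi = \<Union>{U. open U \<and> (AE y in lborel. y \<in> U \<longrightarrow> y \<notin> A)}" for Xi A :: "(real^'n) set"
    by (rule locally_null_imp_AE) (use that in blast)
  then have AE1: "AE \<xi> in lborel. \<xi> \<in> X1 \<longrightarrow> \<xi> \<notin> A1" and AE2: "AE \<xi> in lborel. \<xi> \<in> X2 \<longrightarrow> \<xi> \<notin> A2"
    using X1_def X2_def by blast+
  \<comment> \<open>\<open>Ff\<close> vanishes off its essential support, \<open>closure F\<close>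
    contains that support, and \<open>closure F\<close> exceeds \<open>F\<close> only within the
    null set \<open>frontier F\<close>. Intersecting with the conull orbit loses nothing.\<close>
  have off: "AE \<xi> in lborel. \<xi> \<notin> X \<longrightarrow> Ff \<xi> = 0"
    using AE_outside_ess_support[of Ff] AE_not_in[OF assms(12)] AE_Orb
  proof eventually_elim
    fix \<xi> assume "\<xi> \<notin> ess_support Ff \<longrightarrow> Ff \<xi> = 0" "\<xi> \<notin> frontier F" "\<xi> \<in> Orb"
    moreover have "closure F \<subseteq> F \<union> frontier F"
      using interior_subset[of F] by (auto simp: frontier_def)
    ultimately show "\<xi> \<notin> X \<longrightarrow> Ff \<xi> = 0" using assms(14) by (auto simp: X_def Ff_def)
  qed
  \<comment> \<open>The factor \<open>s\<close> serves both signs at once; linearity and injectivity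
    of the transform bring the identity back to the signals.\<close>
  have conclude: "AE x in lborel. g x = s * f x" if s: "AE \<xi> in lborel. Gg \<xi> = of_real s * Ff \<xi>" for s
  proof -
    have "AE x in lborel. complex_of_real (g x) + (- of_real s) * complex_of_real (f x) = 0"
    proof (rule fourier_L2_eq_0)
      show "square_integrable (\<lambda>x. complex_of_real (g x) + (- of_real s) * complex_of_real (f x))"
        by (intro square_integrable_add square_integrable_of_real f g)
      show "is_fourier_L2 (\<lambda>x. complex_of_real (g x) + (- of_real s) * complex_of_real (f x)) (\<lambda>\<xi>. Gg \<xi> + (- of_real s) * Ff \<xi>)"
        unfolding Gg_def Ff_def
        by (intro fourier_L2_add square_integrable_of_real is_fourier_L2_fourier_L2 f g)
      show "AE \<xi> in lborel. Gg \<xi> + (- of_real s) * Ff \<xi> = 0" using s by eventually_elim simp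
    qed
    then show ?thesis
    proof eventually_elim
      fix x assume "complex_of_real (g x) + (- of_real s) * complex_of_real (f x) = 0"
      then have "complex_of_real (g x) = complex_of_real (s * f x)" by simp
      then show "g x = s * f x" by (simp only: of_real_eq_iff)
    qed
  qed
  from \<open>X1 \<inter> X = {} \<or> X2 \<inter> X = {}\<close> show "(AE x in lborel. g x = f x) \<or> (AE x in lborel. g x = - f x)"
  proof
    assume "X1 \<inter> X = {}"
    \<comment> \<open>\<open>A2\<close> collects the frequencies with the minus sign, so its nullity
      on \<open>X\<close> forces the plus sign.\<close>
    then have "X \<subseteq> X2" using \<open>X \<subseteq> X1 \<union> X2\<close> by blast
    have "AE \<xi> in lborel. Gg \<xi> = of_real 1 * Ff \<xi>"
      using AE2 AE_N off by eventually_elim (use \<open>X \<subseteq> X2\<close> in \<open>auto simp: A2_def N_def\<close>)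
    from conclude[OF this] show ?thesis by simp
  next
    assume "X2 \<inter> X = {}"
    then have "X \<subseteq> X1" using \<open>X \<subseteq> X1 \<union> X2\<close> by blast
    have "AE \<xi> in lborel. Gg \<xi> = of_real (-1) * Ff \<xi>"
      using AE1 AE_N off by eventually_elim (use \<open>X \<subseteq> X1\<close> in \<open>auto simp: A1_def N_def\<close>)
    from conclude[OF this] show ?thesis by simp
  qed
qed

end
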